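(* The system $\mathsf{RCA}_0^\omega+\mathsf{NCC}$ proves $\mathsf{BOOT}\leftrightarrow[\mathsf{open}^++\mathsf{ACA}_0]$.
   Context: $\mathsf{RCA}_0^\omega$ is Kohlenbach's base theory of higher-order reverse mathematics: a theory in the language of all finite types, with constants $0,1,<,+,\times,=_0$, combinators and Gödel's recursors; axioms: ordered semiring axioms, combinator axioms, defining axioms of the recursor $\mathbf R_0$, extensionality at all finite types, quantifier-free induction, and $\mathsf{QF\text{-}AC}^{1,0}$. $\mathsf{NCC}$: for every $Y^2$, with $A(n,m)\equiv(\exists f\in 2^{\mathbb N})(Y(f,m,n)=0)$, if $(\forall n)(\exists m)A(n,m)$ then $(\exists g^1)(\forall n)A(n,g(n))$. $\mathsf{ACA}_0$: arithmetical comprehension (the existence of $\{n:\varphi(n)\}$ for arithmetical $\varphi$ with function parameters). $\mathsf{BOOT}$: for every $Y^2$ there is $X\subseteq\mathbb N$ with $(\forall n)(n\in X\leftrightarrow(\exists f\in\mathbb N^{\mathbb N})(Y(f,n)=0))$. Open sets: an open set $O\subseteq\mathbb R$ is represented by $\psi:\mathbb R\to\mathbb R^2$, where $x\in O$ means $(\exists y\in\mathbb R)(x\in I^\psi_y)$ and $I^\psi_y$ is the open interval $(\psi(y)(1),\psi(y)(1)+|\psi(y)(2)|)$ if its endpoints differ and $\emptyset$ otherwise. Fix an enumeration $B(q_n,r_n)$ of all open balls with rational centre $q_n$ and rational radius $r_n>0$. $\mathsf{open}^+$: for every open set $Z\subseteq\mathbb R$ (in this sense) there is $X\subseteq\mathbb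 N$ with $(\forall n)(n\in X\leftrightarrow B(q_n,r_n)\subseteq Z)$. *)

theory Defs
  imports Main
begin

section \<open>The language of all finite types\<close>

datatype ty = N | Fn ty ty  (infixr "\<rightarrow>" 70)

abbreviation ty1 :: ty where "ty1 \<equiv> N \<rightarrow> N"
abbreviation ty2 :: ty where "ty2 \<equiv> ty1 \<rightarrow> N"

datatype const = C0 | C1 | CPlus | CTimes | CPi ty ty | CSigma ty ty ty | CRec ty

fun const_ty :: "const \<Rightarrow> ty" where
  "const_ty C0 = N"
| "const_ty C1 = N"
| "const_ty CPlus = N \<rightarrow> N \<rightarrow> N"
| "const_ty CTimes = N \<rightarrow> N \<rightarrow> N"
| "const_ty (CPi \<rho> \<tau>) = \<rho> \<rightarrow> \<tau> \<rightarrow> \<rho>"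
| "const_ty (CSigma \<delta> \<rho> \<tau>) = (\<delta> \<rightarrow> \<rho> \<rightarrow> \<tau>) \<rightarrow> (\<delta> \<rightarrow> \<rho>) \<rightarrow> \<delta> \<rightarrow> \<tau>"
| "const_ty (CRec \<rho>) = (N \<rightarrow> \<rho> \<rightarrow> \<rho>) \<rightarrow> \<rho> \<rightarrow> N \<rightarrow> \<rho>"

text \<open>Variables are de Bruijn indices counted separately for each type: \<open>Var \<rho> i\<close> is a variable
  of type \<open>\<rho>\<close>, and a quantifier over type \<open>\<rho>\<close> binds \<open>Var \<rho> 0\<close> and shifts only the variables of
  type \<open>\<rho>\<close>. So the type of a variable does not depend on a context.\<close>

datatype tm = Var ty nat | Con const | App tm tm  (infixl "\<cdot>" 100)

text \<open>Equality and order at type \<open>N\<close> are the only primitive predicates. The logic is classical, so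
  the other connectives are defined from falsum, implication and universal quantification.\<close>

datatype fm =
    Eq tm tm  (infix "\<doteq>" 55)
  | Less tm tm  (infix "\<lessdot>" 55)
  | Bot
  | Imp fm fm  (infixr "\<leadsto>" 40)
  | All ty fm

abbreviation Neg :: "fm \<Rightarrow> fm" where "Neg A \<equiv> A \<leadsto> Bot"
abbreviation Or :: "fm \<Rightarrow> fm \<Rightarrow> fm"  (infixr "\<oror>" 45) where "A \<oror> B \<equiv> Neg A \<leadsto> B"
abbreviation And :: "fm \<Rightarrow> fm \<Rightarrow> fm"  (infixr "\<andand>" 50) where "A \<andand> B \<equiv> Neg (A \<leadsto> Neg B)"
abbreviation Iff :: "fm \<Rightarrow> fm \<Rightarrow> fm"  (infix "\<leftrightarrow>" 40) where "A \<leftrightarrow> B \<equiv> (A \<leadsto> B) \<andand> (B \<leadsto> A)"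
abbreviation Ex :: "ty \<Rightarrow> fm \<Rightarrow> fm" where "Ex \<rho> A \<equiv> Neg (All \<rho> (Neg A))"
abbreviation Leq :: "tm \<Rightarrow> tm \<Rightarrow> fm"  (infix "\<preceq>" 55) where "s \<preceq> t \<equiv> Neg (t \<lessdot> s)"

fun ty_of :: "tm \<Rightarrow> ty option" where
  "ty_of (Var \<rho> i) = Some \<rho>"
| "ty_of (Con c) = Some (const_ty c)"
| "ty_of (s \<cdot> t) = (case ty_of s of
     Some (\<rho> \<rightarrow> \<tau>) \<Rightarrow> (if ty_of t = Some \<rho> then Some \<tau> else None) | _ \<Rightarrow> None)"

fun wf_fm :: "fm \<Rightarrow> bool" where
  "wf_fm (s \<doteq> t) = (ty_of s = Some N \<and> ty_of t = Some N)"
| "wf_fm (s \<lessdot> t) = (ty_of s = Some N \<and> ty_of t = Some N)"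
| "wf_fm Bot = True"
| "wf_fm (A \<leadsto> B) = (wf_fm A \<and> wf_fm B)"
| "wf_fm (All \<rho> A) = wf_fm A"

fun quantifier_free :: "fm \<Rightarrow> bool" where
  "quantifier_free (A \<leadsto> B) = (quantifier_free A \<and> quantifier_free B)"
| "quantifier_free (All \<rho> A) = False"
| "quantifier_free _ = True"

fun var_tys :: "tm \<Rightarrow> ty set" where
  "var_tys (Var \<rho> i) = {\<rho>}"
| "var_tys (Con c) = {}"
| "var_tys (s \<cdot> t) = var_tys s \<union> var_tys t"

text \<open>Only number quantifiers, and only number and function parameters.\<close>

fun arithmetical :: "fm \<Rightarrow> bool" where
  "arithmetical (s \<doteq> t) = (var_tys s \<union> var_tys t \<subseteq> {N, ty1})"
| "arithmetical (s \<lessdot> t) = (var_tys s \<union> var_tys t \<subseteq> {N, ty1})"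
| "arithmetical Bot = True"
| "arithmetical (A \<leadsto> B) = (arithmetical A \<and> arithmetical B)"
| "arithmetical (All \<rho> A) = (\<rho> = N \<and> arithmetical A)"

text \<open>\<open>lift_tm \<sigma> k\<close> and \<open>lift_fm \<sigma> k\<close> shift the variables of type \<open>\<sigma>\<close> with index at least \<open>k\<close>;
  \<open>subst_tm \<sigma> k u\<close> and \<open>subst_fm \<sigma> k u\<close> replace \<open>Var \<sigma> k\<close> by \<open>u\<close> and lower the variables of
  type \<open>\<sigma>\<close> above it.\<close>

fun lift_tm :: "ty \<Rightarrow> nat \<Rightarrow> tm \<Rightarrow> tm" where
  "lift_tm \<sigma> k (Var \<rho> i) = Var \<rho> (if \<rho> = \<sigma> \<and> k \<le> i then Suc i else i)"
| "lift_tm \<sigma> k (Con c) = Con c"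
| "lift_tm \<sigma> k (s \<cdot> t) = lift_tm \<sigma> k s \<cdot> lift_tm \<sigma> k t"

fun lift_fm :: "ty \<Rightarrow> nat \<Rightarrow> fm \<Rightarrow> fm" where
  "lift_fm \<sigma> k (s \<doteq> t) = (lift_tm \<sigma> k s \<doteq> lift_tm \<sigma> k t)"
| "lift_fm \<sigma> k (s \<lessdot> t) = (lift_tm \<sigma> k s \<lessdot> lift_tm \<sigma> k t)"
| "lift_fm \<sigma> k Bot = Bot"
| "lift_fm \<sigma> k (A \<leadsto> B) = (lift_fm \<sigma> k A \<leadsto> lift_fm \<sigma> k B)"
| "lift_fm \<sigma> k (All \<rho> A) = All \<rho> (lift_fm \<sigma> (if \<rho> = \<sigma> then Suc k else k) A)"

fun subst_tm :: "ty \<Rightarrow> nat \<Rightarrow> tm \<Rightarrow> tm \<Rightarrow> tm" where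
  "subst_tm \<sigma> k u (Var \<rho> i) =
     (if \<rho> \<noteq> \<sigma> \<or> i < k then Var \<rho> i else if i = k then u else Var \<rho> (i - 1))"
| "subst_tm \<sigma> k u (Con c) = Con c"
| "subst_tm \<sigma> k u (s \<cdot> t) = subst_tm \<sigma> k u s \<cdot> subst_tm \<sigma> k u t"

fun subst_fm :: "ty \<Rightarrow> nat \<Rightarrow> tm \<Rightarrow> fm \<Rightarrow> fm" where
  "subst_fm \<sigma> k u (s \<doteq> t) = (subst_tm \<sigma> k u s \<doteq> subst_tm \<sigma> k u t)"
| "subst_fm \<sigma> k u (s \<lessdot> t) = (subst_tm \<sigma> k u s \<lessdot> subst_tm \<sigma> k u t)"
| "subst_fm \<sigma> k u Bot = Bot"
| "subst_fm \<sigma> k u (A \<leadsto> B) = (subst_fm \<sigma> k u A \<leadsto> subst_fm \<sigma> k u B)"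
| "subst_fm \<sigma> k u (All \<rho> A) =
     All \<rho> (subst_fm \<sigma> (if \<rho> = \<sigma> then Suc k else k) (lift_tm \<rho> 0 u) A)"


section \<open>Derivability\<close>

text \<open>Natural deduction for classical many-sorted first-order logic. The formulas in \<open>T\<close> are
  nonlogical axioms; their free variables are implicitly universally quantified, so (unlike the
  hypotheses \<open>\<Gamma>\<close>) they do not restrict the introduction of quantifiers.\<close>

inductive derives :: "fm set \<Rightarrow> fm list \<Rightarrow> fm \<Rightarrow> bool" for T :: "fm set" where
  Axiom: "A \<in> T \<Longrightarrow> derives T \<Gamma> A"
| Assm: "A \<in> set \<Gamma> \<Longrightarrow> derives T \<Gamma> A"
| ImpI: "wf_fm A \<Longrightarrow> derives T (A # \<Gamma>) B \<Longrightarrow> derives T \<Gamma> (A \<leadsto> B)"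
| ImpE: "derives T \<Gamma> (A \<leadsto> B) \<Longrightarrow> derives T \<Gamma> A \<Longrightarrow> derives T \<Gamma> B"
| Raa: "wf_fm A \<Longrightarrow> derives T (Neg A # \<Gamma>) Bot \<Longrightarrow> derives T \<Gamma> A"
| AllI: "derives T (map (lift_fm \<rho> 0) \<Gamma>) A \<Longrightarrow> derives T \<Gamma> (All \<rho> A)"
| AllE: "derives T \<Gamma> (All \<rho> A) \<Longrightarrow> ty_of u = Some \<rho> \<Longrightarrow> derives T \<Gamma> (subst_fm \<rho> 0 u A)"

definition proves :: "fm set \<Rightarrow> fm \<Rightarrow> bool"  (infix "\<turnstile>" 30) where
  "T \<turnstile> A \<longleftrightarrow> derives T [] A"

text \<open>For possibly infinite sets of axioms, \<open>T\<close> proves \<open>S \<leftrightarrow> S'\<close> when each side becomes provable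
  on adding the other one to \<open>T\<close>.\<close>

definition proves_equivalence :: "fm set \<Rightarrow> fm set \<Rightarrow> fm set \<Rightarrow> bool" where
  "proves_equivalence T S S' \<longleftrightarrow> (\<forall>A\<in>S'. T \<union> S \<turnstile> A) \<and> (\<forall>A\<in>S. T \<union> S' \<turnstile> A)"


section \<open>The base theory\<close>

abbreviation Zero :: tm where "Zero \<equiv> Con C0"
abbreviation One :: tm where "One \<equiv> Con C1"
abbreviation Plus :: "tm \<Rightarrow> tm \<Rightarrow> tm"  (infixl "\<oplus>" 65) where "s \<oplus> t \<equiv> Con CPlus \<cdot> s \<cdot> t"
abbreviation Times :: "tm \<Rightarrow> tm \<Rightarrow> tm"  (infixl "\<otimes>" 70) where "s \<otimes> t \<equiv> Con CTimes \<cdot> s \<cdot> t"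

fun eq_ty :: "ty \<Rightarrow> tm \<Rightarrow> tm \<Rightarrow> fm" where
  "eq_ty N s t = (s \<doteq> t)"
| "eq_ty (\<rho> \<rightarrow> \<tau>) s t = All \<rho> (eq_ty \<tau> (lift_tm \<rho> 0 s \<cdot> Var \<rho> 0) (lift_tm \<rho> 0 t \<cdot> Var \<rho> 0))"

definition equality_axioms :: "fm set" where
  "equality_axioms = (let x = Var N 0; y = Var N 1; z = Var N 2; w = Var N 3 in
    {x \<doteq> x, x \<doteq> y \<leadsto> y \<doteq> x, x \<doteq> y \<leadsto> y \<doteq> z \<leadsto> x \<doteq> z,
     x \<doteq> y \<leadsto> z \<doteq> w \<leadsto> x \<lessdot> z \<leadsto> y \<lessdot> w})"

text \<open>Nonnegativity and discreteness follow by quantifier-free induction.\<close>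

definition ordered_semiring_axioms :: "fm set" where
  "ordered_semiring_axioms = (let x = Var N 0; y = Var N 1; z = Var N 2 in
    {(x \<oplus> y) \<oplus> z \<doteq> x \<oplus> (y \<oplus> z), x \<oplus> y \<doteq> y \<oplus> x, x \<oplus> Zero \<doteq> x,
     (x \<otimes> y) \<otimes> z \<doteq> x \<otimes> (y \<otimes> z), x \<otimes> y \<doteq> y \<otimes> x, x \<otimes> One \<doteq> x, x \<otimes> Zero \<doteq> Zero,
     x \<otimes> (y \<oplus> z) \<doteq> x \<otimes> y \<oplus> x \<otimes> z,
     Neg (x \<lessdot> x), x \<lessdot> y \<leadsto> y \<lessdot> z \<leadsto> x \<lessdot> z, x \<lessdot> y \<oror> x \<doteq> y \<oror> y \<lessdot> x,
     Zero \<lessdot> One, x \<lessdot> y \<leadsto> x \<oplus> z \<lessdot> y \<oplus> z, Zero \<lessdot> z \<leadsto> x \<lessdot> y \<leadsto> x \<otimes> z \<lessdot> y \<otimes> z})"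

definition combinator_axioms :: "fm set" where
  "combinator_axioms =
     (\<Union>\<rho> \<tau>. {eq_ty \<rho> (Con (CPi \<rho> \<tau>) \<cdot> Var \<rho> 0 \<cdot> Var \<tau> 1) (Var \<rho> 0)}) \<union>
     (\<Union>\<delta> \<rho> \<tau>. let x = Var (\<delta> \<rightarrow> \<rho> \<rightarrow> \<tau>) 0; y = Var (\<delta> \<rightarrow> \<rho>) 1; z = Var \<delta> 2 in
        {eq_ty \<tau> (Con (CSigma \<delta> \<rho> \<tau>) \<cdot> x \<cdot> y \<cdot> z) (x \<cdot> z \<cdot> (y \<cdot> z))})"

definition recursor_axioms :: "fm set" where
  "recursor_axioms = (let R = Con (CRec N); f = Var (N \<rightarrow> N \<rightarrow> N) 0; m = Var N 0; n = Var N 1 in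
    {R \<cdot> f \<cdot> m \<cdot> Zero \<doteq> m, R \<cdot> f \<cdot> m \<cdot> (n \<oplus> One) \<doteq> f \<cdot> n \<cdot> (R \<cdot> f \<cdot> m \<cdot> n)})"

definition extensionality_axioms :: "fm set" where
  "extensionality_axioms = (\<Union>\<rho> \<tau>. let x = Var \<rho> 0; y = Var \<rho> 1; F = Var (\<rho> \<rightarrow> \<tau>) 0 in
    {eq_ty \<rho> x y \<leadsto> eq_ty \<tau> (F \<cdot> x) (F \<cdot> y)})"

text \<open>In an instance for \<open>A\<close> the induction variable is \<open>Var N 0\<close>; the inner lifting turns
  the substitution into the replacement of \<open>n\<close> by \<open>n + 1\<close>.\<close>

definition QF_induction :: "fm set" where
  "QF_induction =
    {subst_fm N 0 Zero A \<andand> All N (A \<leadsto> subst_fm N 0 (Var N 0 \<oplus> One) (lift_fm N 1 A)) \<leadsto> All N A |A.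
      quantifier_free A \<and> wf_fm A}"

text \<open>In an instance for \<open>A\<close>, \<open>f\<close> is \<open>Var ty1 0\<close> and \<open>n\<close> is \<open>Var N 0\<close>; the choice functional is
  \<open>Var ty2 0\<close>.\<close>

definition QF_AC_1_0 :: "fm set" where
  "QF_AC_1_0 =
    {All ty1 (Ex N A) \<leadsto>
       Ex ty2 (All ty1 (subst_fm N 0 (Var ty2 0 \<cdot> Var ty1 0) (lift_fm ty2 0 A))) |A.
      quantifier_free A \<and> wf_fm A}"

definition RCA0_omega :: "fm set" where
  "RCA0_omega = equality_axioms \<union> ordered_semiring_axioms \<union> combinator_axioms \<union> recursor_axioms \<union>
     extensionality_axioms \<union> QF_induction \<union> QF_AC_1_0"


section \<open>Coding of pairs and rational numbers\<close>

text \<open>Bracket abstraction: \<open>lam \<rho> t\<close> is \<open>\<lambda>x. t\<close> for \<open>x = Var \<rho> 0\<close>. Where \<open>x\<close> does not occur, the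
  substitution in \<open>const_fn\<close> only lowers the other variables of type \<open>\<rho>\<close>.\<close>

fun occurs :: "ty \<Rightarrow> tm \<Rightarrow> bool" where
  "occurs \<rho> (Var \<sigma> i) = (\<sigma> = \<rho> \<and> i = 0)"
| "occurs \<rho> (Con c) = False"
| "occurs \<rho> (s \<cdot> t) = (occurs \<rho> s \<or> occurs \<rho> t)"

definition const_fn :: "ty \<Rightarrow> tm \<Rightarrow> tm" where
  "const_fn \<rho> t = Con (CPi (the (ty_of t)) \<rho>) \<cdot> subst_tm \<rho> 0 (Var \<rho> 0) t"

definition identity_fn :: "ty \<Rightarrow> tm" where
  "identity_fn \<rho> = Con (CSigma \<rho> (\<rho> \<rightarrow> \<rho>) \<rho>) \<cdot> Con (CPi \<rho> (\<rho> \<rightarrow> \<rho>)) \<cdot> Con (CPi \<rho> \<rho>)"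

fun lam :: "ty \<Rightarrow> tm \<Rightarrow> tm" where
  "lam \<rho> (Var \<sigma> i) = (if occurs \<rho> (Var \<sigma> i) then identity_fn \<rho> else const_fn \<rho> (Var \<sigma> i))"
| "lam \<rho> (Con c) = const_fn \<rho> (Con c)"
| "lam \<rho> (s \<cdot> t) =
     (if occurs \<rho> (s \<cdot> t)
      then Con (CSigma \<rho> (the (ty_of t)) (the (ty_of (s \<cdot> t)))) \<cdot> lam \<rho> s \<cdot> lam \<rho> t
      else const_fn \<rho> (s \<cdot> t))"

text \<open>\<open>prim_rec a t\<close> is the term \<open>h : N \<rightarrow> N\<close> with \<open>h 0 = a\<close> and \<open>h (n + 1) = t\<close>, where in
  \<open>t\<close> the variable \<open>Var N 1\<close> stands for \<open>n\<close> and \<open>Var N 0\<close> for \<open>h n\<close>.\<close>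

definition prim_rec :: "tm \<Rightarrow> tm \<Rightarrow> tm" where
  "prim_rec a t = Con (CRec N) \<cdot> lam N (lam N t) \<cdot> a"

definition predecessor :: "tm \<Rightarrow> tm" where
  "predecessor t = prim_rec Zero (Var N 1) \<cdot> t"

definition monus :: "tm \<Rightarrow> tm \<Rightarrow> tm"  (infixl "\<ominus>" 65) where
  "s \<ominus> t = prim_rec s (predecessor (Var N 0)) \<cdot> t"

definition triangle :: "tm \<Rightarrow> tm" where
  "triangle t = prim_rec Zero (Var N 0 \<oplus> (Var N 1 \<oplus> One)) \<cdot> t"

text \<open>The operations below are closed terms applied to their arguments, so that the arguments are
  neither duplicated nor lifted; under two abstractions, \<open>Var \<rho> 1\<close> is the first argument.\<close>

text \<open>Cantor's bijection \<open>(m, n) \<mapsto> triangle (m + n) + m\<close> of pairs of numbers with numbers, and its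
  inverses; \<open>triangle_root k\<close> is the largest \<open>w\<close> with \<open>triangle w \<le> k\<close>.\<close>

definition pair :: "tm \<Rightarrow> tm \<Rightarrow> tm" where
  "pair s t = lam N (lam N (triangle (Var N 1 \<oplus> Var N 0) \<oplus> Var N 1)) \<cdot> s \<cdot> t"

definition triangle_root :: "tm \<Rightarrow> tm" where
  "triangle_root t =
     prim_rec Zero (Var N 0 \<oplus> (One \<ominus> (triangle (Var N 0 \<oplus> One) \<ominus> (Var N 1 \<oplus> One)))) \<cdot> t"

definition first :: "tm \<Rightarrow> tm" where
  "first t = lam N (Var N 0 \<ominus> triangle (triangle_root (Var N 0))) \<cdot> t"

definition second :: "tm \<Rightarrow> tm" where
  "second t = lam N (triangle_root (Var N 0) \<ominus> first (Var N 0)) \<cdot> t"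

text \<open>Every number codes a rational: \<open>pair (pair a b) c\<close> codes \<open>(a - b) / (c + 1)\<close>.\<close>

definition rat :: "tm \<Rightarrow> tm \<Rightarrow> tm \<Rightarrow> tm" where
  "rat a b c = pair (pair a b) c"

definition pos :: "tm \<Rightarrow> tm" where "pos q = first (first q)"
definition neg :: "tm \<Rightarrow> tm" where "neg q = second (first q)"
definition den :: "tm \<Rightarrow> tm" where "den q = second q \<oplus> One"

definition q_less :: "tm \<Rightarrow> tm \<Rightarrow> fm"  (infix "<\<^sub>Q" 55) where
  "q <\<^sub>Q r = (pos q \<otimes> den r \<oplus> neg r \<otimes> den q \<lessdot> pos r \<otimes> den q \<oplus> neg q \<otimes> den r)"

definition q_le :: "tm \<Rightarrow> tm \<Rightarrow> fm"  (infix "\<le>\<^sub>Q" 55) where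
  "q \<le>\<^sub>Q r = Neg (r <\<^sub>Q q)"

definition q_add :: "tm \<Rightarrow> tm \<Rightarrow> tm"  (infixl "+\<^sub>Q" 65) where
  "q +\<^sub>Q r = (let x = Var N 1; y = Var N 0 in
     lam N (lam N (rat (pos x \<otimes> den y \<oplus> pos y \<otimes> den x) (neg x \<otimes> den y \<oplus> neg y \<otimes> den x)
                       (den x \<otimes> den y \<ominus> One))) \<cdot> q \<cdot> r)"

definition q_minus :: "tm \<Rightarrow> tm" where
  "q_minus q = (let x = Var N 0 in lam N (rat (neg x) (pos x) (second x)) \<cdot> q)"

definition q_abs :: "tm \<Rightarrow> tm" where
  "q_abs q = (let x = Var N 0 in
     lam N (rat ((pos x \<ominus> neg x) \<oplus> (neg x \<ominus> pos x)) Zero (second x)) \<cdot> q)"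

definition q_dist :: "tm \<Rightarrow> tm \<Rightarrow> tm" where
  "q_dist q r = q_abs (q +\<^sub>Q q_minus r)"

text \<open>The rational \<open>2\<close> to the power \<open>-n\<close>; the recursion computes \<open>2\<^sup>n - 1\<close>.\<close>

definition half_pow :: "tm \<Rightarrow> tm" where
  "half_pow n = rat One Zero (prim_rec Zero (Var N 0 \<oplus> Var N 0 \<oplus> One) \<cdot> n)"


section \<open>Real numbers\<close>

text \<open>Reals are fast-converging Cauchy sequences of rationals. In the formulas below the arguments
  are arbitrary terms, hence are lifted under each quantifier.\<close>

definition is_real :: "tm \<Rightarrow> fm" where
  "is_real x = (let x' = lift_tm N 0 (lift_tm N 0 x); n = Var N 1; i = Var N 0 in
     All N (All N (q_dist (x' \<cdot> n) (x' \<cdot> (n \<oplus> i)) <\<^sub>Q half_pow n)))"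

definition r_eq :: "tm \<Rightarrow> tm \<Rightarrow> fm"  (infix "=\<^sub>R" 55) where
  "x =\<^sub>R y = (let x' = lift_tm N 0 x; y' = lift_tm N 0 y; n = Var N 0 in
     All N (q_dist (x' \<cdot> n) (y' \<cdot> n) \<le>\<^sub>Q half_pow n +\<^sub>Q half_pow n))"

definition r_less :: "tm \<Rightarrow> tm \<Rightarrow> fm"  (infix "<\<^sub>R" 55) where
  "x <\<^sub>R y = (let x' = lift_tm N 0 x; y' = lift_tm N 0 y; n = Var N 0 in
     Ex N (x' \<cdot> n +\<^sub>Q (half_pow n +\<^sub>Q half_pow n) <\<^sub>Q y' \<cdot> n))"

definition r_of_q :: "tm \<Rightarrow> tm" where
  "r_of_q q = lam N (lam N (Var N 1)) \<cdot> q"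

definition r_add :: "tm \<Rightarrow> tm \<Rightarrow> tm"  (infixl "+\<^sub>R" 65) where
  "x +\<^sub>R y = (let n = Var N 0 in
     lam ty1 (lam ty1 (lam N (Var ty1 1 \<cdot> (n \<oplus> One) +\<^sub>Q Var ty1 0 \<cdot> (n \<oplus> One)))) \<cdot> x \<cdot> y)"

definition r_minus :: "tm \<Rightarrow> tm" where
  "r_minus x = lam ty1 (lam N (q_minus (Var ty1 0 \<cdot> Var N 0))) \<cdot> x"

definition r_abs :: "tm \<Rightarrow> tm" where
  "r_abs x = lam ty1 (lam N (q_abs (Var ty1 0 \<cdot> Var N 0))) \<cdot> x"

text \<open>\<open>F : ty1 \<rightarrow> ty1\<close> represents a function from reals to reals.\<close>

definition is_real_function :: "tm \<Rightarrow> fm" where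
  "is_real_function F = (
     All ty1 (is_real (Var ty1 0) \<leadsto> is_real (lift_tm ty1 0 F \<cdot> Var ty1 0)) \<andand>
     (let F' = lift_tm ty1 0 (lift_tm ty1 0 F); x = Var ty1 1; y = Var ty1 0 in
       All ty1 (All ty1 (is_real x \<andand> is_real y \<andand> x =\<^sub>R y \<leadsto> F' \<cdot> x =\<^sub>R F' \<cdot> y))))"


section \<open>Open sets\<close>

text \<open>A map from reals to pairs of reals is given by its two components \<open>\<psi>\<^sub>1\<close>, \<open>\<psi>\<^sub>2\<close>.\<close>

definition in_interval :: "tm \<Rightarrow> tm \<Rightarrow> tm \<Rightarrow> fm" where
  "in_interval x a b = (let e = a +\<^sub>R r_abs b in Neg (a =\<^sub>R e) \<andand> a <\<^sub>R x \<andand> x <\<^sub>R e)"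

definition in_open :: "tm \<Rightarrow> tm \<Rightarrow> tm \<Rightarrow> fm" where
  "in_open x \<psi>1 \<psi>2 = (let l = lift_tm ty1 0; y = Var ty1 0 in
     Ex ty1 (is_real y \<andand> in_interval (l x) (l \<psi>1 \<cdot> y) (l \<psi>2 \<cdot> y)))"

text \<open>The \<open>n\<close>-th ball has centre \<open>q = first n\<close>, an arbitrary rational, and radius
  \<open>(a + 1) / (b + 1)\<close> for \<open>second n = pair a b\<close>, an arbitrary positive rational.\<close>

definition ball_centre :: "tm \<Rightarrow> tm" where
  "ball_centre n = first n"

definition ball_radius :: "tm \<Rightarrow> tm" where
  "ball_radius n = rat (first (second n) \<oplus> One) Zero (second (second n))"

definition in_ball :: "tm \<Rightarrow> tm \<Rightarrow> fm" where
  "in_ball x n = (r_abs (x +\<^sub>R r_minus (r_of_q (ball_centre n))) <\<^sub>R r_of_q (ball_radius n))"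

definition ball_subset_open :: "tm \<Rightarrow> tm \<Rightarrow> tm \<Rightarrow> fm" where
  "ball_subset_open n \<psi>1 \<psi>2 = (let l = lift_tm ty1 0; x = Var ty1 0 in
     All ty1 (is_real x \<andand> in_ball x (l n) \<leadsto> in_open x (l \<psi>1) (l \<psi>2)))"


section \<open>The principles\<close>

text \<open>Sets of numbers are given by characteristic functions.\<close>

definition is_set :: "tm \<Rightarrow> fm" where
  "is_set X = All N (lift_tm N 0 X \<cdot> Var N 0 \<doteq> Zero \<oror> lift_tm N 0 X \<cdot> Var N 0 \<doteq> One)"

definition mem :: "tm \<Rightarrow> tm \<Rightarrow> fm" where
  "mem n X = (X \<cdot> n \<doteq> One)"

definition NCC :: fm where
  "NCC = (let Y = Var (ty1 \<rightarrow> N \<rightarrow> N \<rightarrow> N) 0; f = Var ty1 0; l = lift_tm ty1 0;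
              A = (\<lambda>n m. Ex ty1 (is_set f \<andand> Y \<cdot> f \<cdot> l m \<cdot> l n \<doteq> Zero)) in
     All (ty1 \<rightarrow> N \<rightarrow> N \<rightarrow> N)
       (All N (Ex N (A (Var N 1) (Var N 0))) \<leadsto>
        Ex ty1 (All N (A (Var N 0) (Var ty1 0 \<cdot> Var N 0)))))"

definition BOOT :: fm where
  "BOOT = (let Y = Var (ty1 \<rightarrow> N \<rightarrow> N) 0; X = Var ty1 0; f = Var ty1 0; n = Var N 0 in
     All (ty1 \<rightarrow> N \<rightarrow> N) (Ex ty1 (is_set X \<andand>
       All N (mem n X \<leftrightarrow> Ex ty1 (Y \<cdot> f \<cdot> n \<doteq> Zero)))))"

text \<open>In an instance for \<open>A\<close> the number variable is \<open>Var N 0\<close>; \<open>A\<close> is lifted because the set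
  variable \<open>Var ty1 0\<close> must not occur in it.\<close>

definition ACA0 :: "fm set" where
  "ACA0 =
    {Ex ty1 (is_set (Var ty1 0) \<andand> All N (mem (Var N 0) (Var ty1 0) \<leftrightarrow> lift_fm ty1 0 A)) |A.
      arithmetical A \<and> wf_fm A}"

definition open_plus :: fm where
  "open_plus = (let \<psi>1 = Var (ty1 \<rightarrow> ty1) 1; \<psi>2 = Var (ty1 \<rightarrow> ty1) 0; X = Var ty1 0; n = Var N 0 in
     All (ty1 \<rightarrow> ty1) (All (ty1 \<rightarrow> ty1)
       (is_real_function \<psi>1 \<andand> is_real_function \<psi>2 \<leadsto>
        Ex ty1 (is_set X \<andand> All N (mem n X \<leftrightarrow> ball_subset_open n \<psi>1 \<psi>2)))))"

end

theory Submission
  imports Defs "HOL-Library.Countable_Set" "HOL-Computational_Algebra.Fraction_Field"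
begin

text \<open>By Henkin's completeness theorem it suffices to argue in a countable model of the base theory,
  which may be taken to be extensional. The numbers of the model form a discretely ordered semiring,
  so the coded rationals form an ordered field and rational arithmetic can be done there.

  \<open>BOOT\<close> implies arithmetical comprehension, since it iterates over number quantifiers coded by
  pairing. For an open set \<open>Z\<close> that is the union of intervals \<open>I\<^sub>y\<close>, \<open>BOOT\<close> decides which closed rational
  intervals lie inside a single \<open>I\<^sub>y\<close>. A ball is contained in \<open>Z\<close> iff every closed rational interval
  inside it has a Lebesgue number for the cover \<open>(I\<^sub>y)\<close>: if some interval has none, bisection yields a
  point outside \<open>Z\<close>.

  For the converse let \<open>Y\<close> be given. If every zero \<open>f\<close> of some \<open>Y(\<cdot>, n)\<close> can be replaced by an initial
  segment of \<open>f\<close> continued by zeros, then the required set is arithmetical in a function that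
  enumerates the values of \<open>Y\<close> on finite sequences. Otherwise Grilliot's trick produces a functional
  that decides number quantifiers. It allows one to decode a real \<open>y\<close>, extensionally, into a number
  \<open>n\<close> and a function \<open>f\<close>, and then \<open>n\<close> is in the required set iff the ball with centre \<open>n + 1/2\<close> and
  radius \<open>1/2\<close> lies in the union of the intervals \<open>(n, n + 1)\<close> over all \<open>y\<close> with \<open>Y(f, n) = 0\<close>.\<close>

section \<open>Parallel substitution\<close>

text \<open>The numbers of the model may be nonstandard, so induction over them is available only
  for predicates with a representable characteristic function (\<open>dec\<close>). This shapes most
  constructions. Bisection, for instance, runs inside the model and its invariant mentions
  \<open>covered\<close>, a condition with number and function quantifiers; the invariant can be
  proved by induction only because \<open>BOOT\<close> makes \<open>covered\<close> decidable. The
  induction on formulas behind arithmetical comprehension is external, since formulas are finite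
  objects of the metatheory.

  In the converse direction the obstacle is extensionality. \<open>open_plus\<close> accepts only
  maps that respect equality of reals, whereas a continuous map from the connected real line to
  sequences of numbers is constant. So reading a function off a real takes a discontinuous
  functional, and the case distinction is arranged such that \<open>Y\<close> itself supplies one
  whenever it is needed. Reals that code nothing also decode to some number and function; they do no
  harm because the interval attached to a real is nonempty only if \<open>Y\<close> vanishes at what
  was decoded.\<close>

definition push :: "ty \<Rightarrow> 'a \<Rightarrow> (ty \<Rightarrow> nat \<Rightarrow> 'a) \<Rightarrow> ty \<Rightarrow> nat \<Rightarrow> 'a" where
  "push \<rho> x e = (\<lambda>\<sigma> i. if \<sigma> = \<rho> then (case i of 0 \<Rightarrow> x | Suc j \<Rightarrow> e \<rho> j) else e \<sigma> i)"

lemma push_simps [simp]: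
  "push \<rho> x e \<rho> 0 = x" "push \<rho> x e \<rho> (Suc i) = e \<rho> i" "\<sigma> \<noteq> \<rho> \<Longrightarrow> push \<rho> x e \<sigma> i = e \<sigma> i"
  by (auto simp: push_def)

definition up :: "ty \<Rightarrow> (ty \<Rightarrow> nat \<Rightarrow> tm) \<Rightarrow> ty \<Rightarrow> nat \<Rightarrow> tm" where
  "up \<rho> s = push \<rho> (Var \<rho> 0) (\<lambda>\<sigma> i. lift_tm \<rho> 0 (s \<sigma> i))"

text \<open>Lifting and substitution for one variable are both instances of parallel substitution,
  so the single law \<open>psubst_comp\<close> replaces the usual family of commutation lemmas for
  de Bruijn indices.\<close>

fun psubst_tm :: "(ty \<Rightarrow> nat \<Rightarrow> tm) \<Rightarrow> tm \<Rightarrow> tm" where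
  "psubst_tm s (Var \<rho> i) = s \<rho> i"
| "psubst_tm s (Con c) = Con c"
| "psubst_tm s (t \<cdot> u) = psubst_tm s t \<cdot> psubst_tm s u"

fun psubst :: "(ty \<Rightarrow> nat \<Rightarrow> tm) \<Rightarrow> fm \<Rightarrow> fm" where
  "psubst s (t \<doteq> u) = (psubst_tm s t \<doteq> psubst_tm s u)"
| "psubst s (t \<lessdot> u) = (psubst_tm s t \<lessdot> psubst_tm s u)"
| "psubst s Bot = Bot"
| "psubst s (A \<leadsto> B) = (psubst s A \<leadsto> psubst s B)"
| "psubst s (All \<rho> A) = All \<rho> (psubst (up \<rho> s) A)"

definition lift_subst :: "ty \<Rightarrow> nat \<Rightarrow> ty \<Rightarrow> nat \<Rightarrow> tm" where
  "lift_subst \<sigma> k = (\<lambda>\<rho> i. Var \<rho> (if \<rho> = \<sigma> \<and> k \<le> i then Suc i else i))"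

definition single_subst :: "ty \<Rightarrow> nat \<Rightarrow> tm \<Rightarrow> ty \<Rightarrow> nat \<Rightarrow> tm" where
  "single_subst \<sigma> k u =
     (\<lambda>\<rho> i. if \<rho> \<noteq> \<sigma> \<or> i < k then Var \<rho> i else if i = k then u else Var \<rho> (i - 1))"

lemma lift_tm_eq: "lift_tm \<sigma> k t = psubst_tm (lift_subst \<sigma> k) t"
  by (induction t) (auto simp: lift_subst_def)

lemma up_lift_subst: "up \<tau> (lift_subst \<sigma> k) = lift_subst \<sigma> (if \<tau> = \<sigma> then Suc k else k)"
  by (rule ext)+ (auto simp: up_def push_def lift_subst_def split: nat.split)

lemma lift_fm_eq: "lift_fm \<sigma> k A = psubst (lift_subst \<sigma> k) A"
  by (induction A arbitrary: k) (auto simp: lift_tm_eq up_lift_subst)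

lemma subst_tm_eq: "subst_tm \<sigma> k u t = psubst_tm (single_subst \<sigma> k u) t"
  by (induction t) (auto simp: single_subst_def)

lemma up_single_subst:
  "up \<tau> (single_subst \<sigma> k u) = single_subst \<sigma> (if \<tau> = \<sigma> then Suc k else k) (lift_tm \<tau> 0 u)"
  by (rule ext)+ (auto simp: up_def push_def single_subst_def split: nat.split)

lemma subst_fm_eq: "subst_fm \<sigma> k u A = psubst (single_subst \<sigma> k u) A"
  by (induction A arbitrary: k u) (auto simp: subst_tm_eq up_single_subst)

lemma psubst_tm_comp:
  "psubst_tm s (psubst_tm r t) = psubst_tm (\<lambda>\<rho> i. psubst_tm s (r \<rho> i)) t"
  by (induction t) auto

lemma psubst_tm_Var [simp]: "psubst_tm Var t = t"
  by (induction t) auto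

lemma up_Var [simp]: "up \<rho> Var = Var"
  by (rule ext)+ (auto simp: up_def push_def split: nat.split)

lemma psubst_Var [simp]: "psubst Var A = A"
  by (induction A) auto

lemma up_lift: "psubst_tm (up \<rho> s) (lift_tm \<rho> 0 t) = lift_tm \<rho> 0 (psubst_tm s t)"
  by (induction t) (auto simp: up_def push_def)

lemma up_comp: "(\<lambda>\<sigma> i. psubst_tm (up \<rho> s) (up \<rho> r \<sigma> i)) = up \<rho> (\<lambda>\<sigma> i. psubst_tm s (r \<sigma> i))"
proof (rule ext)+
  fix \<sigma> i
  show "psubst_tm (up \<rho> s) (up \<rho> r \<sigma> i) = up \<rho> (\<lambda>\<sigma> i. psubst_tm s (r \<sigma> i)) \<sigma> i"
    unfolding up_def[of \<rho> r] up_def[of \<rho> "\<lambda>\<sigma> i. psubst_tm s (r \<sigma> i)"] push_def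
    by (auto simp: up_lift split: nat.split) (simp add: up_def)
qed

lemma psubst_comp: "psubst s (psubst r A) = psubst (\<lambda>\<rho> i. psubst_tm s (r \<rho> i)) A"
  by (induction A arbitrary: s r) (auto simp: psubst_tm_comp up_comp)

definition well_typed :: "(ty \<Rightarrow> nat \<Rightarrow> tm) \<Rightarrow> bool" where
  "well_typed s \<longleftrightarrow> (\<forall>\<rho> i. ty_of (s \<rho> i) = Some \<rho>)"

lemma ty_of_psubst [simp]: "well_typed s \<Longrightarrow> ty_of (psubst_tm s t) = ty_of t"
  by (induction t) (auto simp: well_typed_def split: option.split ty.split)

lemma ty_of_lift [simp]: "ty_of (lift_tm \<rho> k t) = ty_of t"
  by (induction t) (auto split: option.split ty.split)

lemma well_typed_push: "well_typed s \<Longrightarrow> ty_of u = Some \<rho> \<Longrightarrow> well_typed (push \<rho> u s)"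
  by (auto simp: well_typed_def push_def split: nat.split)

lemma well_typed_up: "well_typed s \<Longrightarrow> well_typed (up \<rho> s)"
  by (auto simp: well_typed_def up_def push_def split: nat.split)

lemma well_typed_Var: "well_typed Var"
  by (simp add: well_typed_def)

lemma well_typed_single: "ty_of u = Some \<sigma> \<Longrightarrow> well_typed (single_subst \<sigma> k u)"
  by (auto simp: well_typed_def single_subst_def)

lemma well_typed_lift: "well_typed (lift_subst \<sigma> k)"
  by (auto simp: well_typed_def lift_subst_def)

lemma wf_fm_psubst [simp]: "well_typed s \<Longrightarrow> wf_fm (psubst s A) = wf_fm A"
  by (induction A arbitrary: s) (auto simp: well_typed_up)

lemma single_subst_0 [simp]: "single_subst \<rho> 0 u \<rho> 0 = u"
  by (simp add: single_subst_def)

lemma subst_push: "psubst_tm (single_subst \<rho> 0 u) (lift_tm \<rho> 0 t) = t"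
  by (induction t) (auto simp: single_subst_def)

lemma subst_psubst_up: "subst_fm \<rho> 0 u (psubst (up \<rho> s) A) = psubst (push \<rho> u s) A"
proof -
  have "(\<lambda>\<sigma> i. psubst_tm (single_subst \<rho> 0 u) (up \<rho> s \<sigma> i)) = push \<rho> u s"
    by (rule ext)+ (auto simp: up_def push_def subst_push split: nat.split)
  then show ?thesis by (simp add: subst_fm_eq psubst_comp)
qed

lemma psubst_subst: "psubst s (subst_fm \<rho> 0 u A) = subst_fm \<rho> 0 (psubst_tm s u) (psubst (up \<rho> s) A)"
proof -
  have "(\<lambda>\<sigma> i. psubst_tm s (single_subst \<rho> 0 u \<sigma> i)) = push \<rho> (psubst_tm s u) s"
    by (rule ext)+ (auto simp: push_def single_subst_def split: nat.split)
  then show ?thesis by (simp add: subst_psubst_up) (simp add: subst_fm_eq psubst_comp)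
qed

lemma psubst_lift: "psubst (up \<rho> s) (lift_fm \<rho> 0 A) = lift_fm \<rho> 0 (psubst s A)"
proof -
  have "(\<lambda>\<sigma> i. psubst_tm (up \<rho> s) (lift_subst \<rho> 0 \<sigma> i)) =
        (\<lambda>\<sigma> i. psubst_tm (lift_subst \<rho> 0) (s \<sigma> i))"
    by (rule ext)+ (auto simp: up_def push_def lift_subst_def lift_tm_eq)
  then show ?thesis by (simp add: lift_fm_eq psubst_comp)
qed

section \<open>Free variables and coincidence\<close>

fun fv_tm :: "tm \<Rightarrow> (ty \<times> nat) set" where
  "fv_tm (Var \<rho> i) = {(\<rho>, i)}"
| "fv_tm (Con c) = {}"
| "fv_tm (s \<cdot> t) = fv_tm s \<union> fv_tm t"

text \<open>The index that a variable receives under a quantifier of type \<open>\<rho>\<close>. The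
  bound variable \<open>(\<rho>, 0)\<close> is not in the range, so taking the preimage in
  \<open>fv\<close> removes exactly that one.\<close>

definition bind :: "ty \<Rightarrow> ty \<times> nat \<Rightarrow> ty \<times> nat" where
  "bind \<rho> = (\<lambda>(\<sigma>, i). (\<sigma>, if \<sigma> = \<rho> then Suc i else i))"

fun fv :: "fm \<Rightarrow> (ty \<times> nat) set" where
  "fv (s \<doteq> t) = fv_tm s \<union> fv_tm t"
| "fv (s \<lessdot> t) = fv_tm s \<union> fv_tm t"
| "fv Bot = {}"
| "fv (A \<leadsto> B) = fv A \<union> fv B"
| "fv (All \<rho> A) = bind \<rho> -` fv A"

lemma inj_bind: "inj (bind \<rho>)"
  by (auto simp: inj_def bind_def split: if_splits)

lemma finite_fv_tm: "finite (fv_tm t)"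
  by (induction t) auto

lemma finite_fv: "finite (fv A)"
  by (induction A) (auto simp: finite_fv_tm intro: finite_vimageI inj_bind)

lemma psubst_tm_cong: "(\<And>\<rho> i. (\<rho>, i) \<in> fv_tm t \<Longrightarrow> s \<rho> i = r \<rho> i) \<Longrightarrow> psubst_tm s t = psubst_tm r t"
  by (induction t) auto

lemma psubst_cong: "(\<And>\<rho> i. (\<rho>, i) \<in> fv A \<Longrightarrow> s \<rho> i = r \<rho> i) \<Longrightarrow> psubst s A = psubst r A"
proof (induction A arbitrary: s r)
  case (All \<rho> A)
  have "up \<rho> s \<sigma> i = up \<rho> r \<sigma> i" if "(\<sigma>, i) \<in> fv A" for \<sigma> i
  proof (cases "\<sigma> = \<rho> \<and> i = 0")
    case True
    then show ?thesis by (simp add: up_def)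
  next
    case False
    then have "(\<sigma>, i) = bind \<rho> (\<sigma>, if \<sigma> = \<rho> then i - 1 else i)" by (auto simp: bind_def)
    then obtain j where j: "(\<sigma>, i) = bind \<rho> (\<sigma>, j)" by blast
    then have "s \<sigma> j = r \<sigma> j" using All.prems[of \<sigma> j] that by simp
    then show ?thesis using j by (auto simp: up_def push_def bind_def)
  qed
  then have "psubst (up \<rho> s) A = psubst (up \<rho> r) A" by (rule All.IH)
  then show ?case by simp
next
  case (Imp A B)
  have "psubst s A = psubst r A" "psubst s B = psubst r B"
    by (rule Imp.IH, rule Imp.prems, simp)+
  then show ?case by simp
next
  case (Eq t u)
  then show ?case using psubst_tm_cong[of t s r] psubst_tm_cong[of u s r] by simp
next
  case (Less t u)
  then show ?case using psubst_tm_cong[of t s r] psubst_tm_cong[of u s r] by simp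
qed simp


section \<open>Substitution in derivations\<close>

lemma weaken: "derives T \<Gamma> A \<Longrightarrow> set \<Gamma> \<subseteq> set \<Delta> \<Longrightarrow> derives T \<Delta> A"
proof (induction arbitrary: \<Delta> rule: derives.induct)
  case (ImpI A \<Gamma> B)
  have "derives T (A # \<Delta>) B" by (rule ImpI.IH) (use ImpI.prems in auto)
  then show ?case using ImpI.hyps by (intro derives.ImpI)
next
  case (ImpE \<Gamma> A B)
  then show ?case by (metis derives.ImpE)
next
  case (Raa A \<Gamma>)
  have "derives T (Neg A # \<Delta>) Bot" by (rule Raa.IH) (use Raa.prems in auto)
  then show ?case using Raa.hyps by (rule_tac derives.Raa)
next
  case (AllI \<rho> \<Gamma> A)
  have "derives T (map (lift_fm \<rho> 0) \<Delta>) A" by (rule AllI.IH) (use AllI.prems in auto)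
  then show ?case by (intro derives.AllI)
qed (auto intro: derives.intros)

text \<open>Counting free variables would not do as a measure: if \<open>(\<rho>, 0)\<close> is not
  free, quantifying over \<open>\<rho>\<close> removes none of them. But then it lowers an index, so
  a sum that includes the indices decreases in either case.\<close>

lemma measure_bind:
  assumes "finite F" "(\<rho>, i) \<in> F"
  shows "(\<Sum>x\<in>bind \<rho> -` F. Suc (snd x)) < (\<Sum>x\<in>F. Suc (snd x))"
proof -
  let ?B = "bind \<rho> -` F"
  have fin: "finite ?B" using assms(1) by (intro finite_vimageI inj_bind)
  have im: "(\<Sum>x\<in>?B. Suc (snd (bind \<rho> x))) = (\<Sum>x\<in>bind \<rho> ` ?B. Suc (snd x))"
    by (subst sum.reindex) (auto intro: inj_on_subset[OF inj_bind])
  have sub: "bind \<rho> ` ?B \<subseteq> F" by auto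
  have le: "Suc (snd x) \<le> Suc (snd (bind \<rho> x))" for x by (cases x) (auto simp: bind_def)
  show ?thesis
  proof (cases i)
    case 0
    have "(\<rho>, i) \<notin> bind \<rho> ` ?B" using 0 by (auto simp: bind_def split: if_splits)
    then have "(\<Sum>x\<in>bind \<rho> ` ?B. Suc (snd x)) < (\<Sum>x\<in>F. Suc (snd x))"
      using assms sub by (intro sum_strict_mono2[of _ _ "(\<rho>, i)"]) auto
    moreover have "(\<Sum>x\<in>?B. Suc (snd x)) \<le> (\<Sum>x\<in>?B. Suc (snd (bind \<rho> x)))"
      by (rule sum_mono) (rule le)
    ultimately show ?thesis using im by simp
  next
    case (Suc j)
    then have "(\<rho>, j) \<in> ?B" using assms(2) by (simp add: bind_def)
    then have "(\<Sum>x\<in>?B. Suc (snd x)) < (\<Sum>x\<in>?B. Suc (snd (bind \<rho> x)))"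
      by (intro sum_strict_mono_ex1 fin ballI le) (auto simp: bind_def intro!: bexI[of _ "(\<rho>, j)"])
    moreover have "(\<Sum>x\<in>bind \<rho> ` ?B. Suc (snd x)) \<le> (\<Sum>x\<in>F. Suc (snd x))"
      using assms sub by (intro sum_mono2) auto
    ultimately show ?thesis using im by simp
  qed
qed

text \<open>Instances of a theorem are theorems, since all its free variables can be closed off first.\<close>

lemma derives_instance:
  "derives T [] A \<Longrightarrow> well_typed s \<Longrightarrow> derives T \<Gamma> (psubst s A)"
proof (induction "\<Sum>x\<in>fv A. Suc (snd x)" arbitrary: A s rule: less_induct)
  case less
  show ?case
  proof (cases "fv A = {}")
    case True
    then have "psubst s A = psubst Var A" by (intro psubst_cong) auto
    then show ?thesis using less.prems(1) by (auto intro: weaken)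
  next
    case False
    then obtain \<rho> i where i: "(\<rho>, i) \<in> fv A" by auto
    \<comment> \<open>\<open>s\<close> is its own value at \<open>(\<rho>, 0)\<close> pushed onto
      \<open>r\<close>. Generalizing over \<open>\<rho>\<close>, instantiating by \<open>r\<close>
      and eliminating the quantifier with that value therefore reproduces \<open>s\<close>.\<close>
    define r where "r = (\<lambda>\<sigma> i. if \<sigma> = \<rho> then s \<rho> (Suc i) else s \<sigma> i)"
    have r: "well_typed r" using less.prems(2) by (auto simp: well_typed_def r_def)
    have s: "s = push \<rho> (s \<rho> 0) r"
      by (rule ext)+ (auto simp: push_def r_def split: nat.split)
    have "derives T [] (All \<rho> A)" using less.prems(1) by (intro derives.AllI) simp
    then have "derives T \<Gamma> (psubst r (All \<rho> A))"
      using measure_bind[OF finite_fv i] r by (intro less.hyps) auto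
    then have "derives T \<Gamma> (subst_fm \<rho> 0 (s \<rho> 0) (psubst (up \<rho> r) A))"
      using less.prems(2) by (intro derives.AllE) (auto simp: well_typed_def)
    then show ?thesis using s by (simp add: subst_psubst_up)
  qed
qed

text \<open>\<open>T\<close> need not be closed under substitution, so the axiom case rests on
  \<open>derives_instance\<close>.\<close>

lemma derives_psubst:
  "derives T \<Gamma> A \<Longrightarrow> well_typed s \<Longrightarrow> derives T (map (psubst s) \<Gamma>) (psubst s A)"
proof (induction arbitrary: s rule: derives.induct)
  case (Axiom A \<Gamma>)
  then show ?case by (auto intro: derives_instance derives.Axiom)
next
  case (Assm A \<Gamma>)
  then show ?case by (auto intro: derives.Assm)
next
  case (ImpE \<Gamma> A B)
  then show ?case by (metis derives.ImpE psubst.simps(4))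
next
  case (AllI \<rho> \<Gamma> A)
  have "map (psubst (up \<rho> s)) (map (lift_fm \<rho> 0) \<Gamma>) = map (lift_fm \<rho> 0) (map (psubst s) \<Gamma>)"
    by (simp add: psubst_lift)
  then show ?case using AllI.IH[OF well_typed_up[OF AllI.prems, of \<rho>]]
    by (simp add: derives.AllI del: map_map)
next
  case (AllE \<Gamma> \<rho> A u)
  then show ?case by (simp add: psubst_subst derives.AllE)
next
  case (ImpI A \<Gamma> B)
  then show ?case by (simp add: derives.ImpI)
next
  case (Raa A \<Gamma>)
  then show ?case by (simp add: derives.Raa)
qed

lemma derives_BotE: "derives T \<Gamma> Bot \<Longrightarrow> wf_fm A \<Longrightarrow> derives T \<Gamma> A"
  by (rule derives.Raa) (auto intro: weaken)

lemma derives_fresh: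
  assumes d: "derives T \<Gamma> (subst_fm \<rho> 0 (Var \<rho> k) A)"
    and k: "\<And>B. B \<in> set (All \<rho> A # \<Gamma>) \<Longrightarrow> (\<rho>, k) \<notin> fv B"
  shows "derives T \<Gamma> (All \<rho> A)"
proof (rule derives.AllI)
  \<comment> \<open>The fresh index \<open>k\<close> becomes the bound index 0 and all others move
    up. On formulas without \<open>k\<close> this agrees with the lifting that the rule
    \<open>AllI\<close> demands.\<close>
  define r where "r = (\<lambda>\<sigma> i. if \<sigma> = \<rho> then (if i = k then Var \<rho> 0 else Var \<rho> (Suc i)) else Var \<sigma> i)"
  have "well_typed r" by (auto simp: r_def well_typed_def)
  from derives_psubst[OF d this]
  have 1: "derives T (map (psubst r) \<Gamma>) (psubst r (subst_fm \<rho> 0 (Var \<rho> k) A))" .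
  have "psubst r B = lift_fm \<rho> 0 B" if "B \<in> set \<Gamma>" for B
    unfolding lift_fm_eq using k[of B] that by (intro psubst_cong) (auto simp: r_def lift_subst_def)
  moreover have "psubst r (subst_fm \<rho> 0 (Var \<rho> k) A) = psubst Var A"
    unfolding subst_fm_eq psubst_comp
  proof (rule psubst_cong)
    fix \<sigma> i assume "(\<sigma>, i) \<in> fv A"
    then show "psubst_tm r (single_subst \<rho> 0 (Var \<rho> k) \<sigma> i) = Var \<sigma> i"
      using k[of "All \<rho> A"] by (cases i) (auto simp: single_subst_def r_def bind_def)
  qed
  ultimately show "derives T (map (lift_fm \<rho> 0) \<Gamma>) A"
    using 1 by (simp cong: map_cong)
qed


section \<open>Henkin completeness\<close>

instance ty :: countable by countable_datatype
instance const :: countable by countable_datatype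
instance tm :: countable by countable_datatype
instance fm :: countable by countable_datatype

fun witness :: "fm list \<Rightarrow> fm \<Rightarrow> fm list" where
  "witness \<Gamma> (All \<rho> A \<leadsto> Bot) =
     [Neg (subst_fm \<rho> 0 (Var \<rho> (SOME k. \<forall>B\<in>set (All \<rho> A # \<Gamma>). (\<rho>, k) \<notin> fv B)) A)]"
| "witness \<Gamma> _ = []"

fun henkin_chain :: "fm set \<Rightarrow> fm \<Rightarrow> nat \<Rightarrow> fm list" where
  "henkin_chain T A 0 = [Neg A]"
| "henkin_chain T A (Suc n) = (let \<Gamma> = henkin_chain T A n; B = from_nat n in
     if wf_fm B \<and> \<not> derives T (B # \<Gamma>) Bot then witness \<Gamma> B @ B # \<Gamma> else \<Gamma>)"

lemma ex_fresh: "\<exists>k. \<forall>B\<in>set \<Gamma>. (\<rho>, k) \<notin> fv B"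
proof -
  have "finite (Pair \<rho> -` (\<Union>B\<in>set \<Gamma>. fv B))"
    by (intro finite_vimageI) (auto simp: finite_fv inj_on_def)
  then obtain k where "k \<notin> Pair \<rho> -` (\<Union>B\<in>set \<Gamma>. fv B)"
    by (metis ex_new_if_finite infinite_UNIV_nat)
  then show ?thesis by auto
qed

text \<open>If the witness caused a contradiction, the instance at the fresh variable would be
  derivable, and \<open>derives_fresh\<close> would generalize it to the universal formula that
  \<open>B\<close> denies.\<close>

lemma witness_consistent:
  assumes "\<not> derives T (B # \<Gamma>) Bot" "wf_fm B"
  shows "\<not> derives T (witness \<Gamma> B @ B # \<Gamma>) Bot"
proof (cases "\<exists>\<rho> A. B = (All \<rho> A \<leadsto> Bot)")
  case True
  then obtain \<rho> A where B: "B = (All \<rho> A \<leadsto> Bot)" by auto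
  define k where "k = (SOME k. \<forall>B\<in>set (All \<rho> A # \<Gamma>). (\<rho>, k) \<notin> fv B)"
  have k: "\<forall>B\<in>set (All \<rho> A # \<Gamma>). (\<rho>, k) \<notin> fv B"
    unfolding k_def by (rule someI_ex) (rule ex_fresh)
  have w: "witness \<Gamma> B = [Neg (subst_fm \<rho> 0 (Var \<rho> k) A)]" by (simp add: B k_def)
  show ?thesis
  proof
    assume "derives T (witness \<Gamma> B @ B # \<Gamma>) Bot"
    then have "derives T (Neg (subst_fm \<rho> 0 (Var \<rho> k) A) # B # \<Gamma>) Bot" unfolding w by simp
    moreover have "wf_fm (subst_fm \<rho> 0 (Var \<rho> k) A)"
      using assms(2) by (simp add: B subst_fm_eq well_typed_single)
    ultimately have "derives T (B # \<Gamma>) (subst_fm \<rho> 0 (Var \<rho> k) A)" by (rule_tac derives.Raa)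
    then have "derives T (B # \<Gamma>) (All \<rho> A)"
      by (rule derives_fresh) (use k B in auto)
    moreover have "derives T (B # \<Gamma>) (Neg (All \<rho> A))" by (rule derives.Assm) (simp add: B)
    ultimately show False using assms(1) derives.ImpE by blast
  qed
next
  case False
  then have "witness \<Gamma> B = []" by (cases "(\<Gamma>, B)" rule: witness.cases) auto
  then show ?thesis using assms by simp
qed

section \<open>The complete theory with witnesses\<close>

definition henkin_theory :: "fm set \<Rightarrow> fm \<Rightarrow> fm set" where
  "henkin_theory T A = {B. \<exists>n. derives T (henkin_chain T A n) B}"

context
  fixes T :: "fm set" and A :: fm
  assumes unprovable: "\<not> derives T [] A" and wf: "wf_fm A"
begin

abbreviation "chain \<equiv> henkin_chain T A"
abbreviation "hth \<equiv> henkin_theory T A"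

lemma chain_consistent: "\<not> derives T (chain n) Bot"
proof (induction n)
  case 0
  then show ?case using derives.Raa[of A T "[]"] unprovable wf by auto
next
  case (Suc n)
  then show ?case using witness_consistent by (auto simp: Let_def)
qed

lemma chain_mono: "m \<le> n \<Longrightarrow> set (chain m) \<subseteq> set (chain n)"
  by (rule lift_Suc_mono_le[of "\<lambda>n. set (chain n)"]) (auto simp: Let_def)

text \<open>Premises derivable at different stages are both derivable at the later one, so
  \<open>hth\<close> inherits every rule with two premises.\<close>

lemma henkin_closed: "B \<in> hth \<Longrightarrow> C \<in> hth \<Longrightarrow> (\<And>\<Delta>. derives T \<Delta> B \<Longrightarrow> derives T \<Delta> C \<Longrightarrow> derives T \<Delta> D) \<Longrightarrow> D \<in> hth"
proof -
  assume "B \<in> hth" "C \<in> hth" and *: "\<And>\<Delta>. derives T \<Delta> B \<Longrightarrow> derives T \<Delta> C \<Longrightarrow> derives T \<Delta> D"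
  then obtain m n where "derives T (chain m) B" "derives T (chain n) C" by (auto simp: henkin_theory_def)
  then have "derives T (chain (max m n)) B" "derives T (chain (max m n)) C"
    using weaken[OF _ chain_mono] by (metis max.cobounded1, metis max.cobounded2)
  then show "D \<in> hth" using * by (auto simp: henkin_theory_def)
qed

lemma henkin_consistent: "Bot \<notin> hth"
  using chain_consistent by (auto simp: henkin_theory_def)

lemma henkin_theorem: "(\<And>\<Delta>. derives T \<Delta> B) \<Longrightarrow> B \<in> hth"
  by (auto simp: henkin_theory_def)

text \<open>\<open>B\<close> is examined at stage \<open>to_nat B\<close>, and it is refused only if
  that stage already derives its negation. A negated universal formula enters together with its
  witness.\<close>

lemma henkin_complete:
  assumes "wf_fm B" "Neg B \<notin> hth"
  shows "B \<in> hth \<and> (\<forall>\<rho> C. B = Neg (All \<rho> C) \<longrightarrow> (\<exists>k. Neg (subst_fm \<rho> 0 (Var \<rho> k) C) \<in> hth))"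
proof -
  define n where "n = to_nat B"
  have n: "from_nat n = B" by (simp add: n_def)
  have "\<not> derives T (B # chain n) Bot"
    using assms derives.ImpI[of B T "chain n" Bot] by (auto simp: henkin_theory_def)
  then have eq: "chain (Suc n) = witness (chain n) B @ B # chain n" using assms n by (simp add: Let_def)
  have mem: "C \<in> hth" if "C \<in> set (chain (Suc n))" for C
    using that derives.Assm unfolding henkin_theory_def by blast
  show ?thesis
  proof (intro conjI allI impI)
    show "B \<in> hth" by (rule mem) (simp only: eq, simp)
  next
    fix \<rho> C assume "B = Neg (All \<rho> C)"
    then have "\<exists>k. Neg (subst_fm \<rho> 0 (Var \<rho> k) C) \<in> set (chain (Suc n))" unfolding eq by auto
    then show "\<exists>k. Neg (subst_fm \<rho> 0 (Var \<rho> k) C) \<in> hth" using mem by blast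
  qed
qed

lemma henkin_Neg: "wf_fm B \<Longrightarrow> Neg B \<in> hth \<longleftrightarrow> B \<notin> hth"
  using henkin_complete[of B] henkin_consistent
  by (metis henkin_closed derives.ImpE)

lemma henkin_Imp: "wf_fm B \<Longrightarrow> wf_fm C \<Longrightarrow> (B \<leadsto> C) \<in> hth \<longleftrightarrow> (B \<in> hth \<longrightarrow> C \<in> hth)"
proof (intro iffI impI)
  assume "(B \<leadsto> C) \<in> hth" "B \<in> hth"
  then show "C \<in> hth" by (rule henkin_closed) (rule derives.ImpE)
next
  assume wfs: "wf_fm B" "wf_fm C" and "B \<in> hth \<longrightarrow> C \<in> hth"
  then consider "Neg B \<in> hth" | "C \<in> hth" using henkin_Neg by blast
  then show "(B \<leadsto> C) \<in> hth"
  proof cases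
    case 1
    show ?thesis
    proof (rule henkin_closed[OF 1 1])
      fix \<Delta> assume "derives T \<Delta> (Neg B)"
      then have "derives T (B # \<Delta>) (Neg B)" by (rule weaken) auto
      moreover have "derives T (B # \<Delta>) B" by (rule derives.Assm) simp
      ultimately show "derives T \<Delta> (B \<leadsto> C)"
        using wfs by (rule_tac derives.ImpI, simp, rule_tac derives_BotE) (auto intro: derives.ImpE)
    qed
  next
    case 2
    show ?thesis
    proof (rule henkin_closed[OF 2 2])
      fix \<Delta> assume "derives T \<Delta> C"
      then show "derives T \<Delta> (B \<leadsto> C)" using wfs by (auto intro!: derives.ImpI elim: weaken)
    qed
  qed
qed

lemma henkin_All:
  assumes "wf_fm B"
  shows "All \<rho> B \<in> hth \<longleftrightarrow> (\<forall>u. ty_of u = Some \<rho> \<longrightarrow> subst_fm \<rho> 0 u B \<in> hth)"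
proof (intro iffI allI impI)
  fix u assume 1: "All \<rho> B \<in> hth" and u: "ty_of u = Some \<rho>"
  show "subst_fm \<rho> 0 u B \<in> hth" by (rule henkin_closed[OF 1 1]) (rule derives.AllE[OF _ u])
next
  assume *: "\<forall>u. ty_of u = Some \<rho> \<longrightarrow> subst_fm \<rho> 0 u B \<in> hth"
  show "All \<rho> B \<in> hth"
  proof (rule ccontr)
    assume "All \<rho> B \<notin> hth"
    then have "Neg (Neg (All \<rho> B)) \<notin> hth" using assms by (simp add: henkin_Neg)
    then obtain k where "Neg (subst_fm \<rho> 0 (Var \<rho> k) B) \<in> hth"
      using henkin_complete[of "Neg (All \<rho> B)"] assms by auto
    moreover have "wf_fm (subst_fm \<rho> 0 (Var \<rho> k) B)"
      using assms by (simp add: subst_fm_eq well_typed_single)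
    ultimately show False using * by (simp add: henkin_Neg)
  qed
qed

lemma henkin_axiom: "B \<in> T \<Longrightarrow> well_typed s \<Longrightarrow> psubst s B \<in> hth"
  by (rule henkin_theorem) (auto intro: derives_instance derives.Axiom)

lemma henkin_goal: "A \<notin> hth"
proof -
  have "Neg A \<in> set (chain 0)" by simp
  then have "Neg A \<in> hth" unfolding henkin_theory_def using derives.Assm by blast
  then show ?thesis using henkin_Neg wf by blast
qed

end

section \<open>Structures with a common carrier for all types\<close>

text \<open>All sorts share the carrier \<open>'a\<close>; this costs nothing because in a countable extensional
  model of the base theory every sort is countably infinite.\<close>

record 'a struct =
  ap :: "ty \<Rightarrow> ty \<Rightarrow> 'a \<Rightarrow> 'a \<Rightarrow> 'a"
  cst :: "const \<Rightarrow> 'a"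
  lt :: "'a \<Rightarrow> 'a \<Rightarrow> bool"

text \<open>As all sorts share one carrier, application is indexed by types, which are recovered
  from the operator. Ill-typed applications get the default \<open>undefined\<close>.\<close>

fun val :: "'a struct \<Rightarrow> (ty \<Rightarrow> nat \<Rightarrow> 'a) \<Rightarrow> tm \<Rightarrow> 'a" where
  "val M e (Var \<rho> i) = e \<rho> i"
| "val M e (Con c) = cst M c"
| "val M e (s \<cdot> t) = (case ty_of s of Some (\<rho> \<rightarrow> \<tau>) \<Rightarrow> ap M \<rho> \<tau> (val M e s) (val M e t) | _ \<Rightarrow> undefined)"

fun sat :: "'a struct \<Rightarrow> (ty \<Rightarrow> nat \<Rightarrow> 'a) \<Rightarrow> fm \<Rightarrow> bool" where
  "sat M e (s \<doteq> t) \<longleftrightarrow> val M e s = val M e t"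
| "sat M e (s \<lessdot> t) \<longleftrightarrow> lt M (val M e s) (val M e t)"
| "sat M e Bot \<longleftrightarrow> False"
| "sat M e (A \<leadsto> B) \<longleftrightarrow> (sat M e A \<longrightarrow> sat M e B)"
| "sat M e (All \<rho> A) \<longleftrightarrow> (\<forall>x. sat M (push \<rho> x e) A)"

definition extensional :: "'a struct \<Rightarrow> bool" where
  "extensional M \<longleftrightarrow> (\<forall>\<rho> \<tau> f g. (\<forall>x. ap M \<rho> \<tau> f x = ap M \<rho> \<tau> g x) \<longrightarrow> f = g)"

lemma val_psubst: "well_typed s \<Longrightarrow> val M e (psubst_tm s t) = val M (\<lambda>\<rho> i. val M e (s \<rho> i)) t"
  by (induction t) (auto split: option.split ty.split)

lemma val_lift_push: "val M (push \<rho> x e) (lift_tm \<rho> 0 t) = val M e t"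
  unfolding lift_tm_eq val_psubst[OF well_typed_lift]
  by (rule arg_cong[where f = "\<lambda>e. val M e t"], (rule ext)+) (auto simp: lift_subst_def)

lemma sat_psubst: "well_typed s \<Longrightarrow> sat M e (psubst s A) = sat M (\<lambda>\<rho> i. val M e (s \<rho> i)) A"
proof (induction A arbitrary: e s)
  case (All \<rho> A)
  have "(\<lambda>\<sigma> i. val M (push \<rho> x e) (up \<rho> s \<sigma> i)) = push \<rho> x (\<lambda>\<sigma> i. val M e (s \<sigma> i))" for x
    by (rule ext)+ (auto simp: up_def push_def val_lift_push[unfolded push_def] split: nat.split)
  then show ?case using All by (simp add: well_typed_up)
qed (auto simp: val_psubst)

lemma sat_lift_push: "sat M (push \<rho> x e) (lift_fm \<rho> 0 A) = sat M e A"
proof -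
  have "(\<lambda>\<sigma> i. val M (push \<rho> x e) (lift_subst \<rho> 0 \<sigma> i)) = e"
    by (rule ext)+ (auto simp: lift_subst_def)
  then show ?thesis by (simp add: lift_fm_eq sat_psubst well_typed_lift)
qed

lemma sat_lift_push1: "sat M (push \<rho> x (push \<rho> y e)) (lift_fm \<rho> 1 A) = sat M (push \<rho> x e) A"
proof -
  have "(\<lambda>\<sigma> i. val M (push \<rho> x (push \<rho> y e)) (lift_subst \<rho> 1 \<sigma> i)) = push \<rho> x e"
    by (rule ext)+ (auto simp: lift_subst_def push_def split: nat.split)
  then show ?thesis by (simp add: lift_fm_eq sat_psubst well_typed_lift)
qed

lemma sat_subst: "ty_of u = Some \<rho> \<Longrightarrow> sat M e (subst_fm \<rho> 0 u A) = sat M (push \<rho> (val M e u) e) A"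
proof -
  assume u: "ty_of u = Some \<rho>"
  have "(\<lambda>\<sigma> i. val M e (single_subst \<rho> 0 u \<sigma> i)) = push \<rho> (val M e u) e"
    by (rule ext)+ (auto simp: single_subst_def push_def split: nat.split)
  then show ?thesis by (simp add: subst_fm_eq sat_psubst well_typed_single u)
qed

lemma val_subst: "ty_of u = Some \<rho> \<Longrightarrow> val M e (subst_tm \<rho> 0 u t) = val M (push \<rho> (val M e u) e) t"
proof -
  assume u: "ty_of u = Some \<rho>"
  have "(\<lambda>\<sigma> i. val M e (single_subst \<rho> 0 u \<sigma> i)) = push \<rho> (val M e u) e"
    by (rule ext)+ (auto simp: single_subst_def push_def split: nat.split)
  then show ?thesis by (simp add: subst_tm_eq val_psubst well_typed_single u)
qed

lemma arg_ty_neq: "\<rho> \<noteq> \<rho> \<rightarrow> \<tau>"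
  by (induction \<rho> arbitrary: \<tau>) auto

lemma wf_eq_ty: "ty_of s = Some \<rho> \<Longrightarrow> ty_of t = Some \<rho> \<Longrightarrow> wf_fm (eq_ty \<rho> s t)"
  by (induction \<rho> arbitrary: s t) auto

lemma psubst_eq_ty: "psubst s (eq_ty \<rho> a b) = eq_ty \<rho> (psubst_tm s a) (psubst_tm s b)"
proof (induction \<rho> arbitrary: s a b)
  case (Fn \<rho> \<tau>)
  then show ?case by (simp add: up_lift) (simp add: up_def)
qed simp

lemma sat_eq_ty:
  assumes "extensional M"
  shows "ty_of s = Some \<rho> \<Longrightarrow> ty_of t = Some \<rho> \<Longrightarrow> sat M e (eq_ty \<rho> s t) \<longleftrightarrow> val M e s = val M e t"
proof (induction \<rho> arbitrary: s t e)
  case (Fn \<rho> \<tau>)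
  then show ?case using assms by (auto simp: val_lift_push extensional_def)
qed simp


section \<open>The term model\<close>

lemma push_numeral [simp]:
  "push \<rho> x e \<rho> 1 = e \<rho> 0" "push \<rho> x e \<rho> 2 = e \<rho> 1" "push \<rho> x e \<rho> 3 = e \<rho> 2"
  by (auto simp: push_def eval_nat_numeral)

locale term_model =
  fixes T :: "fm set" and A :: fm
  assumes unprovable: "\<not> derives T [] A" and wf: "wf_fm A"
    and base: "RCA0_omega \<subseteq> T"
begin

abbreviation "\<Theta> \<equiv> henkin_theory T A"

lemmas h_Imp = henkin_Imp[OF unprovable wf]
lemmas h_All = henkin_All[OF unprovable wf]
lemmas h_axiom = henkin_axiom[OF unprovable wf]
lemmas h_consistent = henkin_consistent[OF unprovable wf]
lemmas h_goal = henkin_goal[OF unprovable wf]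

definition eqv :: "ty \<Rightarrow> tm \<Rightarrow> tm \<Rightarrow> bool" where
  "eqv \<rho> s t \<longleftrightarrow> eq_ty \<rho> s t \<in> \<Theta>"

definition less_tm :: "tm \<Rightarrow> tm \<Rightarrow> bool" where
  "less_tm s t \<longleftrightarrow> (s \<lessdot> t) \<in> \<Theta>"

text \<open>The test of the type keeps this a well-typed substitution for every list, so instances
  of axioms can be given by lists of terms.\<close>

definition assign :: "tm list \<Rightarrow> ty \<Rightarrow> nat \<Rightarrow> tm" where
  "assign ts = (\<lambda>\<rho> i. if i < length ts \<and> ty_of (ts ! i) = Some \<rho> then ts ! i else Var \<rho> i)"

lemma well_typed_assign: "well_typed (assign ts)"
  by (auto simp: assign_def well_typed_def)

lemma instance_axiom: "B \<in> RCA0_omega \<Longrightarrow> psubst (assign ts) B \<in> \<Theta>"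
  using base by (intro h_axiom well_typed_assign) auto

lemma eqv_Fn:
  assumes "ty_of s = Some (\<rho> \<rightarrow> \<tau>)" "ty_of t = Some (\<rho> \<rightarrow> \<tau>)"
  shows "eqv (\<rho> \<rightarrow> \<tau>) s t \<longleftrightarrow> (\<forall>u. ty_of u = Some \<rho> \<longrightarrow> eqv \<tau> (s \<cdot> u) (t \<cdot> u))"
proof -
  have "subst_fm \<rho> 0 u (eq_ty \<tau> (lift_tm \<rho> 0 s \<cdot> Var \<rho> 0) (lift_tm \<rho> 0 t \<cdot> Var \<rho> 0)) =
        eq_ty \<tau> (s \<cdot> u) (t \<cdot> u)" for u
    by (simp add: subst_fm_eq psubst_eq_ty subst_push)
  then show ?thesis using assms by (simp add: eqv_def h_All wf_eq_ty)
qed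

lemma N_refl: "ty_of s = Some N \<Longrightarrow> eqv N s s"
  using instance_axiom[of "Var N 0 \<doteq> Var N 0" "[s]"]
  by (simp add: eqv_def RCA0_omega_def Let_def equality_axioms_def assign_def)

lemma N_sym: "ty_of s = Some N \<Longrightarrow> ty_of t = Some N \<Longrightarrow> eqv N s t \<Longrightarrow> eqv N t s"
  using instance_axiom[of "Var N 0 \<doteq> Var N 1 \<leadsto> Var N 1 \<doteq> Var N 0" "[s, t]"]
  by (simp add: eqv_def RCA0_omega_def Let_def equality_axioms_def assign_def h_Imp)

lemma N_trans: "ty_of s = Some N \<Longrightarrow> ty_of t = Some N \<Longrightarrow> ty_of u = Some N \<Longrightarrow>
    eqv N s t \<Longrightarrow> eqv N t u \<Longrightarrow> eqv N s u"
  using instance_axiom[of "Var N 0 \<doteq> Var N 1 \<leadsto> Var N 1 \<doteq> Var N 2 \<leadsto> Var N 0 \<doteq> Var N 2" "[s, t, u]"]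
  by (simp add: eqv_def RCA0_omega_def Let_def equality_axioms_def assign_def h_Imp)

lemma N_less: "ty_of s = Some N \<Longrightarrow> ty_of s' = Some N \<Longrightarrow> ty_of t = Some N \<Longrightarrow> ty_of t' = Some N \<Longrightarrow>
    eqv N s s' \<Longrightarrow> eqv N t t' \<Longrightarrow> less_tm s t \<Longrightarrow> less_tm s' t'"
  using instance_axiom[of "Var N 0 \<doteq> Var N 1 \<leadsto> Var N 2 \<doteq> Var N 3 \<leadsto> Var N 0 \<lessdot> Var N 2 \<leadsto> Var N 1 \<lessdot> Var N 3"
      "[s, s', t, t']"]
  by (simp add: eqv_def less_tm_def RCA0_omega_def Let_def equality_axioms_def assign_def h_Imp)

lemma eqv_equiv:
  "(\<forall>s. ty_of s = Some \<rho> \<longrightarrow> eqv \<rho> s s) \<and>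
   (\<forall>s t. ty_of s = Some \<rho> \<longrightarrow> ty_of t = Some \<rho> \<longrightarrow> eqv \<rho> s t \<longrightarrow> eqv \<rho> t s) \<and>
   (\<forall>s t u. ty_of s = Some \<rho> \<longrightarrow> ty_of t = Some \<rho> \<longrightarrow> ty_of u = Some \<rho> \<longrightarrow>
      eqv \<rho> s t \<longrightarrow> eqv \<rho> t u \<longrightarrow> eqv \<rho> s u)"
proof (induction \<rho>)
  case N
  then show ?case using N_refl N_sym N_trans by blast
next
  case (Fn \<rho> \<tau>)
  have ty: "ty_of (s \<cdot> u) = Some \<tau>" if "ty_of s = Some (\<rho> \<rightarrow> \<tau>)" "ty_of u = Some \<rho>" for s u
    using that by simp
  show ?case
  proof (intro conjI allI impI)
    fix s t u assume ts: "ty_of s = Some (\<rho> \<rightarrow> \<tau>)" "ty_of t = Some (\<rho> \<rightarrow> \<tau>)" "ty_of u = Some (\<rho> \<rightarrow> \<tau>)"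
      and e: "eqv (\<rho> \<rightarrow> \<tau>) s t" "eqv (\<rho> \<rightarrow> \<tau>) t u"
    show "eqv (\<rho> \<rightarrow> \<tau>) s u"
      using e unfolding eqv_Fn[OF ts(1,2)] eqv_Fn[OF ts(2,3)] eqv_Fn[OF ts(1,3)]
      using Fn.IH(2)[THEN conjunct2, THEN conjunct2, rule_format, OF ty ty ty, OF ts(1) _ ts(2) _ ts(3)]
      by blast
  next
    fix s t assume ts: "ty_of s = Some (\<rho> \<rightarrow> \<tau>)" "ty_of t = Some (\<rho> \<rightarrow> \<tau>)" and e: "eqv (\<rho> \<rightarrow> \<tau>) s t"
    show "eqv (\<rho> \<rightarrow> \<tau>) t s"
      using e unfolding eqv_Fn[OF ts(1,2)] eqv_Fn[OF ts(2,1)]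
      using Fn.IH(2)[THEN conjunct2, THEN conjunct1, rule_format, OF ty ty, OF ts(1) _ ts(2)]
      by blast
  next
    fix s assume ts: "ty_of s = Some (\<rho> \<rightarrow> \<tau>)"
    show "eqv (\<rho> \<rightarrow> \<tau>) s s"
      unfolding eqv_Fn[OF ts ts] using Fn.IH(2)[THEN conjunct1, rule_format, OF ty, OF ts] by blast
  qed
qed

lemmas eqv_refl = eqv_equiv[THEN conjunct1, rule_format]
lemmas eqv_sym = eqv_equiv[THEN conjunct2, THEN conjunct1, rule_format]
lemmas eqv_trans = eqv_equiv[THEN conjunct2, THEN conjunct2, rule_format]

text \<open>Exchanging the function is what equality at a function type means; exchanging the
  argument is the extensionality axiom.\<close>

lemma eqv_App:
  assumes ts: "ty_of f = Some (\<rho> \<rightarrow> \<tau>)" "ty_of g = Some (\<rho> \<rightarrow> \<tau>)" "ty_of x = Some \<rho>" "ty_of y = Some \<rho>"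
    and e: "eqv (\<rho> \<rightarrow> \<tau>) f g" "eqv \<rho> x y"
  shows "eqv \<tau> (f \<cdot> x) (g \<cdot> y)"
proof (rule eqv_trans)
  show "eqv \<tau> (f \<cdot> x) (g \<cdot> x)" using e(1) ts by (simp add: eqv_Fn)
  have "psubst (\<lambda>\<sigma> i. if \<sigma> = \<rho> \<rightarrow> \<tau> \<and> i = 0 then g else assign [x, y] \<sigma> i)
     (eq_ty \<rho> (Var \<rho> 0) (Var \<rho> 1) \<leadsto> eq_ty \<tau> (Var (\<rho> \<rightarrow> \<tau>) 0 \<cdot> Var \<rho> 0) (Var (\<rho> \<rightarrow> \<tau>) 0 \<cdot> Var \<rho> 1)) \<in> \<Theta>"
  proof (rule h_axiom)
    show "(eq_ty \<rho> (Var \<rho> 0) (Var \<rho> 1) \<leadsto> eq_ty \<tau> (Var (\<rho> \<rightarrow> \<tau>) 0 \<cdot> Var \<rho> 0) (Var (\<rho> \<rightarrow> \<tau>) 0 \<cdot> Var \<rho> 1)) \<in> T"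
    proof (rule subsetD[OF base])
      have "(eq_ty \<rho> (Var \<rho> 0) (Var \<rho> 1) \<leadsto> eq_ty \<tau> (Var (\<rho> \<rightarrow> \<tau>) 0 \<cdot> Var \<rho> 0) (Var (\<rho> \<rightarrow> \<tau>) 0 \<cdot> Var \<rho> 1))
          \<in> extensionality_axioms" unfolding extensionality_axioms_def Let_def by blast
      then show "(eq_ty \<rho> (Var \<rho> 0) (Var \<rho> 1) \<leadsto> eq_ty \<tau> (Var (\<rho> \<rightarrow> \<tau>) 0 \<cdot> Var \<rho> 0) (Var (\<rho> \<rightarrow> \<tau>) 0 \<cdot> Var \<rho> 1))
          \<in> RCA0_omega" by (simp add: RCA0_omega_def)
    qed
    show "well_typed (\<lambda>\<sigma> i. if \<sigma> = \<rho> \<rightarrow> \<tau> \<and> i = 0 then g else assign [x, y] \<sigma> i)"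
      using ts well_typed_assign by (auto simp: well_typed_def)
  qed
  \<comment> \<open>Were the two types equal, the function variable and the first argument variable
    of the axiom would be the same variable.\<close>
  moreover have "\<rho> \<noteq> \<rho> \<rightarrow> \<tau>" by (rule arg_ty_neq)
  ultimately show "eqv \<tau> (g \<cdot> x) (g \<cdot> y)"
    using ts e(2) by (simp add: psubst_eq_ty h_Imp wf_eq_ty assign_def eqv_def)
qed (use ts in simp_all)

lemma less_irrefl: "ty_of s = Some N \<Longrightarrow> \<not> less_tm s s"
  using instance_axiom[of "Neg (Var N 0 \<lessdot> Var N 0)" "[s]"] h_consistent
  by (simp add: less_tm_def RCA0_omega_def Let_def ordered_semiring_axioms_def assign_def h_Imp)

lemma less_trans: "ty_of s = Some N \<Longrightarrow> ty_of t = Some N \<Longrightarrow> ty_of u = Some N \<Longrightarrow>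
    less_tm s t \<Longrightarrow> less_tm t u \<Longrightarrow> less_tm s u"
  using instance_axiom[of "Var N 0 \<lessdot> Var N 1 \<leadsto> Var N 1 \<lessdot> Var N 2 \<leadsto> Var N 0 \<lessdot> Var N 2" "[s, t, u]"]
  by (simp add: less_tm_def RCA0_omega_def Let_def ordered_semiring_axioms_def assign_def h_Imp)

lemma less_Suc:
  assumes s: "ty_of s = Some N"
  shows "less_tm s (s \<oplus> One)"
proof -
  have comm: "eqv N (t \<oplus> s) (s \<oplus> t)" if "ty_of t = Some N" for t
    using instance_axiom[of "Var N 0 \<oplus> Var N 1 \<doteq> Var N 1 \<oplus> Var N 0" "[t, s]"] s that
    by (simp add: eqv_def RCA0_omega_def Let_def ordered_semiring_axioms_def assign_def)
  have "eqv N (s \<oplus> Zero) s"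
    using instance_axiom[of "Var N 0 \<oplus> Zero \<doteq> Var N 0" "[s]"] s
    by (simp add: eqv_def RCA0_omega_def Let_def ordered_semiring_axioms_def assign_def)
  then have zero: "eqv N (Zero \<oplus> s) s"
    by (rule eqv_trans[rotated -1]) (use s comm[of Zero] in auto)
  have "less_tm (Zero \<oplus> s) (One \<oplus> s)"
    using instance_axiom[of "Zero \<lessdot> One"] s
      instance_axiom[of "Var N 0 \<lessdot> Var N 1 \<leadsto> Var N 0 \<oplus> Var N 2 \<lessdot> Var N 1 \<oplus> Var N 2" "[Zero, One, s]"]
    by (simp add: less_tm_def RCA0_omega_def Let_def ordered_semiring_axioms_def assign_def h_Imp)
  from N_less[OF _ _ _ _ zero comm[of One] this] show ?thesis using s by simp
qed

fun num_tm :: "nat \<Rightarrow> tm" where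
  "num_tm 0 = Zero"
| "num_tm (Suc n) = num_tm n \<oplus> One"

lemma ty_num [simp]: "ty_of (num_tm n) = Some N"
  by (induction n) auto

lemma num_less: "m < n \<Longrightarrow> less_tm (num_tm m) (num_tm n)"
proof (induction n)
  case (Suc n)
  have "less_tm (num_tm n) (num_tm (Suc n))" using less_Suc[of "num_tm n"] by simp
  then show ?case using Suc less_trans[of "num_tm m" "num_tm n" "num_tm (Suc n)"]
    by (cases "m = n") (auto simp del: num_tm.simps)
qed simp

text \<open>Numerals are distinct because they increase strictly, and at function types the constant
  functions inherit this. So every sort has infinitely many classes and can be numbered by all of
  \<open>nat\<close>, which allows the common carrier.\<close>

lemma infinite_sort: "\<exists>f :: nat \<Rightarrow> tm. (\<forall>n. ty_of (f n) = Some \<rho>) \<and> (\<forall>m n. eqv \<rho> (f m) (f n) \<longrightarrow> m = n)"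
proof (induction \<rho>)
  case N
  have "m = n" if "eqv N (num_tm m) (num_tm n)" for m n
  proof (rule ccontr)
    assume "m \<noteq> n"
    then have "less_tm (num_tm m) (num_tm n) \<or> less_tm (num_tm n) (num_tm m)"
      using num_less by (metis linorder_neqE_nat)
    then have "less_tm (num_tm n) (num_tm n)"
      using that N_less N_sym N_refl by (metis ty_num)
    then show False using less_irrefl ty_num by blast
  qed
  then show ?case using ty_num by blast
next
  case (Fn \<rho> \<tau>)
  then obtain f where ty: "\<And>n. ty_of (f n) = Some \<tau>" and f: "\<And>m n :: nat. eqv \<tau> (f m) (f n) \<Longrightarrow> m = n"
    by blast
  define g where "g n = Con (CPi \<tau> \<rho>) \<cdot> f n" for n
  have tg: "ty_of (g n) = Some (\<rho> \<rightarrow> \<tau>)" for n using ty by (simp add: g_def)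
  have g: "eqv \<tau> (g n \<cdot> Var \<rho> 1) (f n)" for n
  proof -
    have "eq_ty \<tau> (Con (CPi \<tau> \<rho>) \<cdot> Var \<tau> 0 \<cdot> Var \<rho> 1) (Var \<tau> 0) \<in> combinator_axioms"
      unfolding combinator_axioms_def by blast
    then have "psubst (\<lambda>\<sigma> i. if \<sigma> = \<tau> \<and> i = 0 then f n else Var \<sigma> i)
      (eq_ty \<tau> (Con (CPi \<tau> \<rho>) \<cdot> Var \<tau> 0 \<cdot> Var \<rho> 1) (Var \<tau> 0)) \<in> \<Theta>"
      using base ty
      by (intro h_axiom) (auto simp: RCA0_omega_def well_typed_def)
    then show ?thesis by (simp add: psubst_eq_ty g_def eqv_def)
  qed
  have "m = n" if "eqv (\<rho> \<rightarrow> \<tau>) (g m) (g n)" for m n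
  proof -
    have "eqv \<tau> (g m \<cdot> Var \<rho> 1) (g n \<cdot> Var \<rho> 1)" using that eqv_Fn[OF tg tg] by simp
    then have "eqv \<tau> (f m) (f n)"
      using eqv_trans[OF ty _ ty, OF _ eqv_sym[OF _ ty g] eqv_trans[OF _ _ ty, OF _ _ _ g]] tg by simp
    then show ?thesis by (rule f)
  qed
  then show ?case using tg by blast
qed

section \<open>The quotient structure and its truth lemma\<close>

definition eqv_rel :: "ty \<Rightarrow> (tm \<times> tm) set" where
  "eqv_rel \<rho> = {(s, t). ty_of s = Some \<rho> \<and> ty_of t = Some \<rho> \<and> eqv \<rho> s t}"

definition sort :: "ty \<Rightarrow> tm set set" where
  "sort \<rho> = {t. ty_of t = Some \<rho>} // eqv_rel \<rho>"

definition cls :: "ty \<Rightarrow> tm \<Rightarrow> nat" where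
  "cls \<rho> t = to_nat_on (sort \<rho>) (eqv_rel \<rho> `` {t})"

definition rep :: "ty \<Rightarrow> nat \<Rightarrow> tm" where
  "rep \<rho> x = (SOME t. ty_of t = Some \<rho> \<and> cls \<rho> t = x)"

lemma equiv_eqv: "equiv {t. ty_of t = Some \<rho>} (eqv_rel \<rho>)"
  unfolding equiv_def refl_on_def sym_def trans_def eqv_rel_def
  using eqv_refl eqv_sym eqv_trans by blast

lemma bij_sort: "bij_betw (to_nat_on (sort \<rho>)) (sort \<rho>) UNIV"
proof (rule to_nat_on_infinite)
  show "countable (sort \<rho>)"
    unfolding sort_def quotient_def by (intro countable_UN) (auto intro: countable_subset[OF subset_UNIV])
  obtain f where ty: "\<And>n. ty_of (f n) = Some \<rho>" and f: "\<And>m n :: nat. eqv \<rho> (f m) (f n) \<Longrightarrow> m = n"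
    using infinite_sort by blast
  have "inj (\<lambda>n. eqv_rel \<rho> `` {f n})"
  proof (rule injI)
    fix m n assume "eqv_rel \<rho> `` {f m} = eqv_rel \<rho> `` {f n}"
    then have "(f m, f n) \<in> eqv_rel \<rho>" using eq_equiv_class[OF _ equiv_eqv] ty by blast
    then show "m = n" using f by (simp add: eqv_rel_def)
  qed
  moreover have "range (\<lambda>n. eqv_rel \<rho> `` {f n}) \<subseteq> sort \<rho>"
    using ty by (auto simp: sort_def intro!: quotientI)
  ultimately show "infinite (sort \<rho>)"
    by (meson finite_imageD finite_subset infinite_UNIV_nat)
qed

lemma cls_eq_iff:
  "ty_of s = Some \<rho> \<Longrightarrow> ty_of t = Some \<rho> \<Longrightarrow> cls \<rho> s = cls \<rho> t \<longleftrightarrow> eqv \<rho> s t"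
proof -
  assume ts: "ty_of s = Some \<rho>" "ty_of t = Some \<rho>"
  then have "eqv_rel \<rho> `` {s} \<in> sort \<rho>" "eqv_rel \<rho> `` {t} \<in> sort \<rho>"
    by (auto simp: sort_def intro!: quotientI)
  then have "cls \<rho> s = cls \<rho> t \<longleftrightarrow> eqv_rel \<rho> `` {s} = eqv_rel \<rho> `` {t}"
    using inj_on_eq_iff[OF bij_betw_imp_inj_on[OF bij_sort]] by (simp add: cls_def)
  also have "\<dots> \<longleftrightarrow> (s, t) \<in> eqv_rel \<rho>" using eq_equiv_class_iff[OF equiv_eqv] ts by blast
  finally show ?thesis using ts by (simp add: eqv_rel_def)
qed

lemma rep: "ty_of (rep \<rho> x) = Some \<rho> \<and> cls \<rho> (rep \<rho> x) = x"
  unfolding rep_def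
proof (rule someI_ex)
  have "x \<in> to_nat_on (sort \<rho>) ` sort \<rho>" using bij_sort[of \<rho>] by (simp add: bij_betw_def)
  then obtain c where c: "c \<in> sort \<rho>" "to_nat_on (sort \<rho>) c = x" by blast
  then obtain t where "ty_of t = Some \<rho>" "c = eqv_rel \<rho> `` {t}"
    by (auto simp: sort_def elim: quotientE)
  then show "\<exists>t. ty_of t = Some \<rho> \<and> cls \<rho> t = x" using c by (auto simp: cls_def)
qed

definition M :: "nat struct" where
  "M = \<lparr>ap = (\<lambda>\<rho> \<tau> x y. cls \<tau> (rep (\<rho> \<rightarrow> \<tau>) x \<cdot> rep \<rho> y)), cst = (\<lambda>c. cls (const_ty c) (Con c)),
        lt = (\<lambda>x y. less_tm (rep N x) (rep N y))\<rparr>"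

lemma rep_cls: "ty_of t = Some \<rho> \<Longrightarrow> eqv \<rho> (rep \<rho> (cls \<rho> t)) t"
  using rep cls_eq_iff by blast

lemma val_M:
  assumes "well_typed s" "\<And>\<rho> i. e \<rho> i = cls \<rho> (s \<rho> i)"
  shows "ty_of t = Some \<tau> \<Longrightarrow> val M e t = cls \<tau> (psubst_tm s t)"
proof (induction t arbitrary: \<tau>)
  case (App f t)
  then obtain \<rho> where ty: "ty_of f = Some (\<rho> \<rightarrow> \<tau>)" "ty_of t = Some \<rho>"
    by (auto split: option.splits ty.splits if_splits)
  have "eqv \<tau> (rep (\<rho> \<rightarrow> \<tau>) (cls (\<rho> \<rightarrow> \<tau>) (psubst_tm s f)) \<cdot> rep \<rho> (cls \<rho> (psubst_tm s t)))
    (psubst_tm s f \<cdot> psubst_tm s t)"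
    using assms(1) ty rep_cls[of "psubst_tm s f" "\<rho> \<rightarrow> \<tau>"] rep_cls[of "psubst_tm s t" \<rho>] rep
    by (intro eqv_App[of _ \<rho>]) auto
  then show ?case using App ty assms by (simp add: M_def cls_eq_iff rep)
qed (use assms in \<open>auto simp: M_def\<close>)

text \<open>Every element of the carrier is the class of a term at every type, so the instances by
  terms in \<open>h_All\<close> exhaust the quantifier. The substitution stays arbitrary because the
  quantifier step extends it by a push.\<close>

lemma sat_M:
  assumes "well_typed s" "\<And>\<rho> i. e \<rho> i = cls \<rho> (s \<rho> i)" "wf_fm B"
  shows "sat M e B \<longleftrightarrow> psubst s B \<in> \<Theta>"
  using assms
proof (induction B arbitrary: e s)
  case (Eq t u)
  then show ?case using val_M[OF Eq.prems(1,2)] by (simp add: cls_eq_iff) (simp add: eqv_def)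
next
  case (Less t u)
  have "less_tm (rep N (cls N (psubst_tm s t))) (rep N (cls N (psubst_tm s u))) \<longleftrightarrow>
        less_tm (psubst_tm s t) (psubst_tm s u)"
    using Less.prems N_less rep_cls N_sym rep by (smt (verit) ty_of_psubst wf_fm.simps(2))
  then show ?case using val_M[OF Less.prems(1,2)] Less.prems(3)
    by (simp add: M_def less_tm_def)
next
  case Bot
  then show ?case using h_consistent by simp
next
  case (Imp B C)
  then show ?case by (simp add: h_Imp)
next
  case (All \<rho> B)
  have "sat M (push \<rho> (cls \<rho> u) e) B \<longleftrightarrow> subst_fm \<rho> 0 u (psubst (up \<rho> s) B) \<in> \<Theta>"
    if "ty_of u = Some \<rho>" for u
    unfolding subst_psubst_up
    using All.prems that
    by (intro All.IH) (auto simp: well_typed_push, auto simp: push_def split: nat.split)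
  then have "(\<forall>u. ty_of u = Some \<rho> \<longrightarrow> sat M (push \<rho> (cls \<rho> u) e) B) \<longleftrightarrow> psubst s (All \<rho> B) \<in> \<Theta>"
    using All.prems by (simp add: h_All well_typed_up)
  then show ?case using rep by (metis sat.simps(5))
qed

lemma extensional_M: "extensional M"
  unfolding extensional_def
proof (intro allI impI)
  fix \<rho> \<tau> f g assume *: "\<forall>x. ap M \<rho> \<tau> f x = ap M \<rho> \<tau> g x"
  have "eqv \<tau> (rep (\<rho> \<rightarrow> \<tau>) f \<cdot> u) (rep (\<rho> \<rightarrow> \<tau>) g \<cdot> u)" if "ty_of u = Some \<rho>" for u
  proof -
    have "eqv \<tau> (rep (\<rho> \<rightarrow> \<tau>) h \<cdot> rep \<rho> (cls \<rho> u)) (rep (\<rho> \<rightarrow> \<tau>) h \<cdot> u)" for h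
      using that rep rep_cls[OF that] by (intro eqv_App[of _ \<rho>] eqv_refl) auto
    moreover have "eqv \<tau> (rep (\<rho> \<rightarrow> \<tau>) f \<cdot> rep \<rho> (cls \<rho> u)) (rep (\<rho> \<rightarrow> \<tau>) g \<cdot> rep \<rho> (cls \<rho> u))"
      using *[rule_format, of "cls \<rho> u"] by (simp add: M_def cls_eq_iff rep)
    moreover have "ty_of (rep (\<rho> \<rightarrow> \<tau>) h \<cdot> rep \<rho> x) = Some \<tau>" "ty_of (rep (\<rho> \<rightarrow> \<tau>) h \<cdot> u) = Some \<tau>" for h x
      using that by (simp_all add: rep)
    ultimately show ?thesis by (meson eqv_sym eqv_trans)
  qed
  then have "eqv (\<rho> \<rightarrow> \<tau>) (rep (\<rho> \<rightarrow> \<tau>) f) (rep (\<rho> \<rightarrow> \<tau>) g)" by (simp add: eqv_Fn rep)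
  then show "f = g" using rep cls_eq_iff by metis
qed

end

text \<open>The theory contains all substitution instances of the axioms, in particular those by
  representatives of an arbitrary assignment. Hence axioms with free variables are valid under every
  \<open>e\<close>.\<close>

theorem completeness:
  assumes "\<not> (T \<turnstile> A)" "wf_fm A" "RCA0_omega \<subseteq> T"
  obtains M :: "nat struct" and e where "extensional M" "\<not> sat M e A"
    "\<And>B e. B \<in> T \<Longrightarrow> wf_fm B \<Longrightarrow> sat M e B"
proof -
  interpret term_model T A by unfold_locales (use assms in \<open>auto simp: proves_def\<close>)
  have "\<not> sat M (\<lambda>\<rho> i. cls \<rho> (Var \<rho> i)) A"
    using sat_M[OF well_typed_Var refl wf] h_goal by simp
  moreover have "sat M e B" if "B \<in> T" "wf_fm B" for B e
  proof -
    have "well_typed (\<lambda>\<rho> i. rep \<rho> (e \<rho> i))" by (simp add: well_typed_def rep)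
    with that show ?thesis by (subst sat_M) (auto simp: rep h_axiom)
  qed
  ultimately show ?thesis using extensional_M that by blast
qed

section \<open>Models of the base theory\<close>

lemma wf_subst_fm [simp]: "ty_of u = Some \<rho> \<Longrightarrow> wf_fm (subst_fm \<rho> k u A) = wf_fm A"
  by (simp add: subst_fm_eq well_typed_single)

lemma wf_lift_fm [simp]: "wf_fm (lift_fm \<rho> k A) = wf_fm A"
  by (simp add: lift_fm_eq well_typed_lift)

lemma push_commute: "\<rho> \<noteq> \<sigma> \<Longrightarrow> push \<rho> x (push \<sigma> y e) = push \<sigma> y (push \<rho> x e)"
  by (rule ext)+ (auto simp: push_def split: nat.split)

lemma val_push_not_occurs: "\<not> occurs \<rho> t \<Longrightarrow> val M (push \<rho> x e) t = val M (push \<rho> y e) t"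
proof (induction t)
  case (Var \<sigma> i)
  then show ?case by (cases i) (auto simp: push_def)
next
  case (App s t)
  then show ?case by (simp split: option.split ty.split)
qed simp

lemma ty_lam [simp]: "ty_of t = Some \<tau> \<Longrightarrow> ty_of (lam \<rho> t) = Some (\<rho> \<rightarrow> \<tau>)"
proof (induction t arbitrary: \<tau>)
  case (Var \<sigma> i)
  then show ?case by (auto simp: identity_fn_def const_fn_def)
next
  case (Con c)
  then show ?case by (simp add: const_fn_def)
next
  case (App s t)
  then obtain \<sigma> where ty: "ty_of s = Some (\<sigma> \<rightarrow> \<tau>)" "ty_of t = Some \<sigma>"
    by (auto split: option.splits ty.splits if_splits)
  then show ?case using App.IH
    by (auto simp: const_fn_def subst_tm_eq well_typed_single)
qed

declare lam.simps [simp del]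

lemma ty_prim_rec [simp]: "ty_of a = Some N \<Longrightarrow> ty_of t = Some N \<Longrightarrow> ty_of (prim_rec a t) = Some ty1"
  by (simp add: prim_rec_def)

lemma ty_coding [simp]:
  "ty_of t = Some N \<Longrightarrow> ty_of (predecessor t) = Some N"
  "ty_of s = Some N \<Longrightarrow> ty_of t = Some N \<Longrightarrow> ty_of (s \<ominus> t) = Some N"
  "ty_of t = Some N \<Longrightarrow> ty_of (Defs.triangle t) = Some N"
  "ty_of t = Some N \<Longrightarrow> ty_of (triangle_root t) = Some N"
  "ty_of t = Some N \<Longrightarrow> ty_of (first t) = Some N"
  "ty_of t = Some N \<Longrightarrow> ty_of (second t) = Some N"
  "ty_of s = Some N \<Longrightarrow> ty_of t = Some N \<Longrightarrow> ty_of (pair s t) = Some N"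
proof -
  show 1: "ty_of t = Some N \<Longrightarrow> ty_of (predecessor t) = Some N" for t by (simp add: predecessor_def)
  show 2: "ty_of s = Some N \<Longrightarrow> ty_of t = Some N \<Longrightarrow> ty_of (s \<ominus> t) = Some N" for s t by (simp add: monus_def 1)
  show 3: "ty_of t = Some N \<Longrightarrow> ty_of (Defs.triangle t) = Some N" for t by (simp add: Defs.triangle_def)
  show 4: "ty_of t = Some N \<Longrightarrow> ty_of (triangle_root t) = Some N" for t by (simp add: triangle_root_def 2 3)
  show 5: "ty_of t = Some N \<Longrightarrow> ty_of (first t) = Some N" for t by (simp add: first_def 2 3 4)
  show "ty_of t = Some N \<Longrightarrow> ty_of (second t) = Some N" by (simp add: second_def 2 4 5)
  show "ty_of s = Some N \<Longrightarrow> ty_of t = Some N \<Longrightarrow> ty_of (pair s t) = Some N" by (simp add: pair_def 3)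
qed

lemma ty_rat [simp]:
  "ty_of a = Some N \<Longrightarrow> ty_of b = Some N \<Longrightarrow> ty_of c = Some N \<Longrightarrow> ty_of (rat a b c) = Some N"
  "ty_of q = Some N \<Longrightarrow> ty_of (pos q) = Some N"
  "ty_of q = Some N \<Longrightarrow> ty_of (neg q) = Some N"
  "ty_of q = Some N \<Longrightarrow> ty_of (den q) = Some N"
  by (simp_all add: rat_def pos_def neg_def den_def)

lemma ty_q_ops [simp]:
  "ty_of q = Some N \<Longrightarrow> ty_of r = Some N \<Longrightarrow> ty_of (q +\<^sub>Q r) = Some N"
  "ty_of q = Some N \<Longrightarrow> ty_of (q_minus q) = Some N"
  "ty_of q = Some N \<Longrightarrow> ty_of (q_abs q) = Some N"
  "ty_of q = Some N \<Longrightarrow> ty_of (half_pow q) = Some N"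
  by (simp_all add: q_add_def q_minus_def q_abs_def half_pow_def Let_def)

lemma ty_q_dist [simp]: "ty_of q = Some N \<Longrightarrow> ty_of r = Some N \<Longrightarrow> ty_of (q_dist q r) = Some N"
  by (simp add: q_dist_def)

lemma ty_r_ops [simp]:
  "ty_of q = Some N \<Longrightarrow> ty_of (r_of_q q) = Some ty1"
  "ty_of x = Some ty1 \<Longrightarrow> ty_of y = Some ty1 \<Longrightarrow> ty_of (x +\<^sub>R y) = Some ty1"
  "ty_of x = Some ty1 \<Longrightarrow> ty_of (r_minus x) = Some ty1"
  "ty_of x = Some ty1 \<Longrightarrow> ty_of (r_abs x) = Some ty1"
  by (simp_all add: r_of_q_def r_add_def r_minus_def r_abs_def Let_def)

lemma wf_relations [simp]:
  "ty_of q = Some N \<Longrightarrow> ty_of r = Some N \<Longrightarrow> wf_fm (q <\<^sub>Q r)"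
  "ty_of q = Some N \<Longrightarrow> ty_of r = Some N \<Longrightarrow> wf_fm (q \<le>\<^sub>Q r)"
  "ty_of x = Some ty1 \<Longrightarrow> wf_fm (is_real x)"
  "ty_of x = Some ty1 \<Longrightarrow> ty_of y = Some ty1 \<Longrightarrow> wf_fm (x =\<^sub>R y)"
  "ty_of x = Some ty1 \<Longrightarrow> ty_of y = Some ty1 \<Longrightarrow> wf_fm (x <\<^sub>R y)"
  "ty_of X = Some ty1 \<Longrightarrow> wf_fm (is_set X)"
  "ty_of F = Some (ty1 \<rightarrow> ty1) \<Longrightarrow> wf_fm (is_real_function F)"
  by (simp_all add: q_less_def q_le_def is_real_def r_eq_def r_less_def is_set_def is_real_function_def Let_def)

lemma wf_BOOT: "wf_fm BOOT"
  by (simp add: BOOT_def mem_def Let_def)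

lemma wf_open_plus: "wf_fm open_plus"
  by (simp add: open_plus_def mem_def ball_subset_open_def in_ball_def ball_centre_def ball_radius_def
      in_open_def in_interval_def Let_def)

locale rca =
  fixes M :: "'a struct"
  assumes ext: "extensional M"
    and ax: "B \<in> RCA0_omega \<Longrightarrow> wf_fm B \<Longrightarrow> sat M e B"
begin

lemma ap_ext: "(\<And>x. ap M \<rho> \<tau> f x = ap M \<rho> \<tau> g x) \<Longrightarrow> f = g"
  using ext unfolding extensional_def by blast

lemma ap_K: "ap M \<tau> \<rho> (ap M \<rho> (\<tau> \<rightarrow> \<rho>) (cst M (CPi \<rho> \<tau>)) x) y = x"
proof -
  let ?B = "eq_ty \<rho> (Con (CPi \<rho> \<tau>) \<cdot> Var \<rho> 0 \<cdot> Var \<tau> 1) (Var \<rho> 0)"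
  have "?B \<in> combinator_axioms" unfolding combinator_axioms_def by blast
  then have "?B \<in> RCA0_omega" by (simp add: RCA0_omega_def)
  then have "sat M (\<lambda>\<sigma> i. if \<sigma> = \<rho> \<and> i = 0 then x else y) ?B" by (rule ax) (simp add: wf_eq_ty)
  then show ?thesis by (simp add: sat_eq_ty[OF ext])
qed

lemma ap_S: "ap M \<delta> \<tau> (ap M (\<delta> \<rightarrow> \<rho>) (\<delta> \<rightarrow> \<tau>) (ap M (\<delta> \<rightarrow> \<rho> \<rightarrow> \<tau>) ((\<delta> \<rightarrow> \<rho>) \<rightarrow> \<delta> \<rightarrow> \<tau>) (cst M (CSigma \<delta> \<rho> \<tau>)) x) y) z =
   ap M \<rho> \<tau> (ap M \<delta> (\<rho> \<rightarrow> \<tau>) x z) (ap M \<delta> \<rho> y z)"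
proof -
  let ?B = "eq_ty \<tau> (Con (CSigma \<delta> \<rho> \<tau>) \<cdot> Var (\<delta> \<rightarrow> \<rho> \<rightarrow> \<tau>) 0 \<cdot> Var (\<delta> \<rightarrow> \<rho>) 1 \<cdot> Var \<delta> 2)
     (Var (\<delta> \<rightarrow> \<rho> \<rightarrow> \<tau>) 0 \<cdot> Var \<delta> 2 \<cdot> (Var (\<delta> \<rightarrow> \<rho>) 1 \<cdot> Var \<delta> 2))"
  have "?B \<in> combinator_axioms" unfolding combinator_axioms_def Let_def
    by (intro UnI2 UN_I[of \<delta>] UN_I[of \<rho>] UN_I[of \<tau>]) simp_all
  then have "?B \<in> RCA0_omega" by (simp add: RCA0_omega_def)
  then have "sat M (\<lambda>\<sigma> i. if i = 0 then x else if i = 1 then y else z) ?B"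
    by (rule ax) (simp add: wf_eq_ty)
  then show ?thesis by (simp add: sat_eq_ty[OF ext])
qed

text \<open>A model need not contain all functions on its carrier; \<open>rp\<close> singles out
  those that are given by an element of function type.\<close>

definition rp :: "ty \<Rightarrow> ty \<Rightarrow> ('a \<Rightarrow> 'a) \<Rightarrow> bool" where
  "rp \<rho> \<tau> F \<longleftrightarrow> (\<exists>f. \<forall>x. ap M \<rho> \<tau> f x = F x)"

text \<open>Extensionality makes the representing element unique. For a function that is not
  representable the choice is arbitrary, so \<open>ap_Lam\<close> has to assume
  \<open>rp\<close>.\<close>

definition Lam :: "ty \<Rightarrow> ty \<Rightarrow> ('a \<Rightarrow> 'a) \<Rightarrow> 'a" where
  "Lam \<rho> \<tau> F = (SOME f. \<forall>x. ap M \<rho> \<tau> f x = F x)"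

lemma ap_Lam: "rp \<rho> \<tau> F \<Longrightarrow> ap M \<rho> \<tau> (Lam \<rho> \<tau> F) x = F x"
  using someI_ex[of "\<lambda>f. \<forall>x. ap M \<rho> \<tau> f x = F x"] unfolding rp_def Lam_def by blast

lemma Lam_eqI: "(\<And>x. ap M \<rho> \<tau> f x = F x) \<Longrightarrow> f = Lam \<rho> \<tau> F"
  by (rule ap_ext, subst ap_Lam) (auto simp: rp_def)

lemma Lam_ap [simp]: "Lam \<rho> \<tau> (ap M \<rho> \<tau> f) = f"
  by (rule Lam_eqI[symmetric]) simp

lemma rp_const: "rp \<rho> \<tau> (\<lambda>x. c)"
  unfolding rp_def using ap_K by blast

lemma rp_ap1: "rp \<rho> \<tau> (ap M \<rho> \<tau> f)"
  by (auto simp: rp_def)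

lemma rp_ap:
  assumes "rp \<rho> (\<sigma> \<rightarrow> \<tau>) F" "rp \<rho> \<sigma> G"
  shows "rp \<rho> \<tau> (\<lambda>x. ap M \<sigma> \<tau> (F x) (G x))"
proof -
  obtain f g where "\<And>x. ap M \<rho> (\<sigma> \<rightarrow> \<tau>) f x = F x" "\<And>x. ap M \<rho> \<sigma> g x = G x"
    using assms unfolding rp_def by blast
  then show ?thesis unfolding rp_def using ap_S[of \<rho> \<tau> \<sigma> f g] by (metis (no_types, lifting))
qed

lemma rp_id: "rp \<rho> \<rho> (\<lambda>x. x)"
proof -
  have "rp \<rho> \<rho> (\<lambda>x. ap M (\<rho> \<rightarrow> \<rho>) \<rho> (ap M \<rho> ((\<rho> \<rightarrow> \<rho>) \<rightarrow> \<rho>) (cst M (CPi \<rho> (\<rho> \<rightarrow> \<rho>))) x)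
      (ap M \<rho> (\<rho> \<rightarrow> \<rho>) (cst M (CPi \<rho> \<rho>)) x))"
    by (intro rp_ap rp_ap1)
  then show ?thesis by (simp add: ap_K)
qed

text \<open>Functions of several variables take an assignment to de Bruijn variables, whose types are
  listed in \<open>\<Gamma>\<close>. This lets representability be proved by following the shape of the term.\<close>

primrec Rp :: "ty list \<Rightarrow> ty \<Rightarrow> ((nat \<Rightarrow> 'a) \<Rightarrow> 'a) \<Rightarrow> bool" where
  "Rp [] \<tau> F \<longleftrightarrow> (\<forall>c d. F c = F d)"
| "Rp (\<sigma> # \<Gamma>) \<tau> F \<longleftrightarrow> (\<forall>c. rp \<sigma> \<tau> (\<lambda>y. F (case_nat y c))) \<and>
     Rp \<Gamma> (\<sigma> \<rightarrow> \<tau>) (\<lambda>c. Lam \<sigma> \<tau> (\<lambda>y. F (case_nat y c)))"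

lemma Rp_const: "Rp \<Gamma> \<tau> (\<lambda>c. v)"
  by (induction \<Gamma> arbitrary: \<tau> v) (auto simp: rp_const)

text \<open>The S combinator moves an abstraction inside an application, so one more variable is
  bound without leaving the representable functions.\<close>

lemma Rp_ap: "Rp \<Gamma> (\<sigma> \<rightarrow> \<tau>) F \<Longrightarrow> Rp \<Gamma> \<sigma> G \<Longrightarrow> Rp \<Gamma> \<tau> (\<lambda>c. ap M \<sigma> \<tau> (F c) (G c))"
proof (induction \<Gamma> arbitrary: \<sigma> \<tau> F G)
  case Nil
  then have "F c = F d" "G c = G d" for c d by simp_all
  then show ?case by simp metis
next
  case (Cons \<mu> \<Gamma>)
  have eq: "Lam \<mu> \<tau> (\<lambda>y. ap M \<sigma> \<tau> (F (case_nat y c)) (G (case_nat y c))) =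
     ap M (\<mu> \<rightarrow> \<sigma>) (\<mu> \<rightarrow> \<tau>) (ap M (\<mu> \<rightarrow> \<sigma> \<rightarrow> \<tau>) ((\<mu> \<rightarrow> \<sigma>) \<rightarrow> \<mu> \<rightarrow> \<tau>) (cst M (CSigma \<mu> \<sigma> \<tau>))
       (Lam \<mu> (\<sigma> \<rightarrow> \<tau>) (\<lambda>y. F (case_nat y c)))) (Lam \<mu> \<sigma> (\<lambda>y. G (case_nat y c)))" for c
    using Cons.prems by (intro Lam_eqI[symmetric]) (simp add: ap_S ap_Lam)
  show ?case
    unfolding Rp.simps eq using Cons.prems by (auto intro!: rp_ap Cons.IH Rp_const)
qed

lemma Rp_weaken: "Rp \<Gamma> \<tau> F \<Longrightarrow> Rp (\<sigma> # \<Gamma>) \<tau> (\<lambda>c. F (\<lambda>i. c (Suc i)))"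
proof -
  assume F: "Rp \<Gamma> \<tau> F"
  have "Lam \<sigma> \<tau> (\<lambda>y. F c) = ap M \<tau> (\<sigma> \<rightarrow> \<tau>) (cst M (CPi \<tau> \<sigma>)) (F c)" for c
    by (rule Lam_eqI[symmetric]) (rule ap_K)
  then show ?thesis using F by (simp add: rp_const Rp_ap Rp_const)
qed

lemma Rp_var: "i < length \<Gamma> \<Longrightarrow> \<Gamma> ! i = \<tau> \<Longrightarrow> Rp \<Gamma> \<tau> (\<lambda>c. c i)"
proof (induction \<Gamma> arbitrary: i)
  case (Cons \<sigma> \<Gamma>)
  then show ?case
    using Rp_weaken[of \<Gamma> \<tau> "\<lambda>c. c (i - 1)" \<sigma>] by (cases i) (auto simp: rp_id intro: Rp_const)
qed simp

lemma Rp_Lam: "Rp (\<sigma> # \<Gamma>) \<tau> (\<lambda>c. F (\<lambda>i. c (Suc i)) (c 0)) \<Longrightarrow> Rp \<Gamma> (\<sigma> \<rightarrow> \<tau>) (\<lambda>c. Lam \<sigma> \<tau> (F c))"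
  by simp

lemma rpI: "Rp [\<rho>] \<tau> (\<lambda>c. F (c 0)) \<Longrightarrow> rp \<rho> \<tau> F"
  by simp

lemma Rp_rp: "rp \<rho> \<tau> f \<Longrightarrow> Rp \<Gamma> \<rho> F \<Longrightarrow> Rp \<Gamma> \<tau> (\<lambda>c. f (F c))"
proof -
  assume f: "rp \<rho> \<tau> f" and "Rp \<Gamma> \<rho> F"
  then have "Rp \<Gamma> \<tau> (\<lambda>c. ap M \<rho> \<tau> (Lam \<rho> \<tau> f) (F c))" by (intro Rp_ap Rp_const)
  then show ?thesis using f by (simp add: ap_Lam)
qed

lemma ap_Lam2:
  assumes "Rp [\<sigma>, \<rho>] \<tau> (\<lambda>c. F (c (Suc 0)) (c 0))"
  shows "ap M \<sigma> \<tau> (ap M \<rho> (\<sigma> \<rightarrow> \<tau>) (Lam \<rho> (\<sigma> \<rightarrow> \<tau>) (\<lambda>x. Lam \<sigma> \<tau> (F x))) x) y = F x y"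
proof -
  have "rp \<sigma> \<tau> (F x)" using assms by simp (metis old.nat.simps(4))
  moreover have "rp \<rho> (\<sigma> \<rightarrow> \<tau>) (\<lambda>x. Lam \<sigma> \<tau> (F x))" using assms by simp
  ultimately show ?thesis by (simp add: ap_Lam)
qed

lemma Rp_rp2:
  assumes "Rp [\<sigma>, \<rho>] \<tau> (\<lambda>c. f (c (Suc 0)) (c 0))" "Rp \<Gamma> \<rho> F" "Rp \<Gamma> \<sigma> G"
  shows "Rp \<Gamma> \<tau> (\<lambda>c. f (F c) (G c))"
proof -
  have "Rp \<Gamma> \<tau> (\<lambda>c. ap M \<sigma> \<tau> (ap M \<rho> (\<sigma> \<rightarrow> \<tau>) (Lam \<rho> (\<sigma> \<rightarrow> \<tau>) (\<lambda>x. Lam \<sigma> \<tau> (f x))) (F c)) (G c))"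
    by (intro Rp_ap Rp_const assms)
  then show ?thesis by (simp only: ap_Lam2[OF assms(1)])
qed

lemma val_ap_lam [simp]:
  "ty_of t = Some \<tau> \<Longrightarrow> ap M \<rho> \<tau> (val M e (lam \<rho> t)) x = val M (push \<rho> x e) t"
proof (induction t arbitrary: \<tau>)
  case const: (Con c)
  then show ?case by (auto simp: const_fn_def ap_K lam.simps)
next
  have const: "ap M \<rho> \<tau> (val M e (const_fn \<rho> t)) x = val M (push \<rho> x e) t"
    if "ty_of t = Some \<tau>" "\<not> occurs \<rho> t" for t \<tau>
  proof -
    have "ty_of (subst_tm \<rho> 0 (Var \<rho> 0) t) = Some \<tau>"
      using that by (simp add: subst_tm_eq well_typed_single)
    \<comment> \<open>The substitution in \<open>const_fn\<close> puts \<open>e \<rho> 0\<close> in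
      the place of the abstracted variable. As that variable does not occur, any other value does as
      well, in particular \<open>x\<close>.\<close>
    then have "ap M \<rho> \<tau> (val M e (const_fn \<rho> t)) x = val M (push \<rho> (e \<rho> 0) e) t"
      using that(1) by (simp add: const_fn_def ap_K val_subst)
    then show ?thesis using val_push_not_occurs[OF that(2)] by metis
  qed
  {
    case (Var \<sigma> i)
    show ?case
    proof (cases "occurs \<rho> (Var \<sigma> i)")
      case True
      then show ?thesis using Var by (auto simp: identity_fn_def ap_S ap_K lam.simps)
    next
      case False
      then have "lam \<rho> (Var \<sigma> i) = const_fn \<rho> (Var \<sigma> i)" by (auto simp: lam.simps)
      then show ?thesis using const[OF Var False] by simp
    qed
  next
    case (App s t)
    then obtain \<sigma> where ty: "ty_of s = Some (\<sigma> \<rightarrow> \<tau>)" "ty_of t = Some \<sigma>"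
      by (auto split: option.splits ty.splits if_splits)
    show ?case
    proof (cases "occurs \<rho> (s \<cdot> t)")
      case True
      then show ?thesis using App.IH(1)[OF ty(1)] App.IH(2)[OF ty(2)] ty by (simp add: ap_S lam.simps)
    next
      case False
      then show ?thesis using const[OF App.prems False] by (simp add: lam.simps)
    qed
  }
qed

lemma val_lam: "ty_of t = Some \<tau> \<Longrightarrow> val M e (lam \<rho> t) = Lam \<rho> \<tau> (\<lambda>x. val M (push \<rho> x e) t)"
  by (rule Lam_eqI) simp

section \<open>Arithmetic that follows from the axioms\<close>

abbreviation "add x y \<equiv> ap M N N (ap M N ty1 (cst M CPlus) x) y"
abbreviation "mult x y \<equiv> ap M N N (ap M N ty1 (cst M CTimes) x) y"
abbreviation "zero \<equiv> cst M C0"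
abbreviation "one \<equiv> cst M C1"

abbreviation "env3 x y z \<equiv> push N x (push N y (push N z undefined))"

lemma semiring_ax: "B \<in> ordered_semiring_axioms \<Longrightarrow> wf_fm B \<Longrightarrow> sat M e B"
  by (rule ax) (auto simp: RCA0_omega_def)

lemma raw_semiring:
  "add (add x y) z = add x (add y z)" "add x y = add y x" "add x zero = x"
  "mult (mult x y) z = mult x (mult y z)" "mult x y = mult y x" "mult x one = x" "mult x zero = zero"
  "mult x (add y z) = add (mult x y) (mult x z)"
  "\<not> lt M x x" "lt M x y \<Longrightarrow> lt M y z \<Longrightarrow> lt M x z" "lt M x y \<or> x = y \<or> lt M y x"
  "lt M zero one" "lt M x y \<Longrightarrow> lt M (add x z) (add y z)" "lt M zero z \<Longrightarrow> lt M x y \<Longrightarrow> lt M (mult x z) (mult y z)"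
  using semiring_ax[of "(Var N 0 \<oplus> Var N 1) \<oplus> Var N 2 \<doteq> Var N 0 \<oplus> (Var N 1 \<oplus> Var N 2)" "env3 x y z"]
   semiring_ax[of "Var N 0 \<oplus> Var N 1 \<doteq> Var N 1 \<oplus> Var N 0" "env3 x y z"]
   semiring_ax[of "Var N 0 \<oplus> Zero \<doteq> Var N 0" "env3 x y z"]
   semiring_ax[of "(Var N 0 \<otimes> Var N 1) \<otimes> Var N 2 \<doteq> Var N 0 \<otimes> (Var N 1 \<otimes> Var N 2)" "env3 x y z"]
   semiring_ax[of "Var N 0 \<otimes> Var N 1 \<doteq> Var N 1 \<otimes> Var N 0" "env3 x y z"]
   semiring_ax[of "Var N 0 \<otimes> One \<doteq> Var N 0" "env3 x y z"]
   semiring_ax[of "Var N 0 \<otimes> Zero \<doteq> Zero" "env3 x y z"]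
   semiring_ax[of "Var N 0 \<otimes> (Var N 1 \<oplus> Var N 2) \<doteq> Var N 0 \<otimes> Var N 1 \<oplus> Var N 0 \<otimes> Var N 2" "env3 x y z"]
   semiring_ax[of "Neg (Var N 0 \<lessdot> Var N 0)" "env3 x y z"]
   semiring_ax[of "Var N 0 \<lessdot> Var N 1 \<leadsto> Var N 1 \<lessdot> Var N 2 \<leadsto> Var N 0 \<lessdot> Var N 2" "env3 x y z"]
   semiring_ax[of "Var N 0 \<lessdot> Var N 1 \<oror> Var N 0 \<doteq> Var N 1 \<oror> Var N 1 \<lessdot> Var N 0" "env3 x y z"]
   semiring_ax[of "Zero \<lessdot> One" "env3 x y z"]
   semiring_ax[of "Var N 0 \<lessdot> Var N 1 \<leadsto> Var N 0 \<oplus> Var N 2 \<lessdot> Var N 1 \<oplus> Var N 2" "env3 x y z"]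
   semiring_ax[of "Zero \<lessdot> Var N 2 \<leadsto> Var N 0 \<lessdot> Var N 1 \<leadsto> Var N 0 \<otimes> Var N 2 \<lessdot> Var N 1 \<otimes> Var N 2" "env3 x y z"]
  by (simp_all add: ordered_semiring_axioms_def Let_def) blast?

definition prec :: "'a \<Rightarrow> ('a \<Rightarrow> 'a \<Rightarrow> 'a) \<Rightarrow> 'a \<Rightarrow> 'a" where
  "prec a G n = ap M N N (ap M N ty1 (ap M (N \<rightarrow> N \<rightarrow> N) (N \<rightarrow> N \<rightarrow> N) (cst M (CRec N))
     (Lam N ty1 (\<lambda>n. Lam N N (G n)))) a) n"

lemma raw_prec:
  assumes "Rp [N, N] N (\<lambda>c. G (c (Suc 0)) (c 0))"
  shows "prec a G zero = a" "prec a G (add n one) = G n (prec a G n)"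
proof -
  let ?f = "Lam N ty1 (\<lambda>n. Lam N N (G n))"
  let ?e = "\<lambda>\<sigma> i. if \<sigma> = N then (if i = 0 then a else n) else ?f"
  have f: "ap M N N (ap M N ty1 ?f x) y = G x y" for x y
    by (rule ap_Lam2[OF assms])
  have "sat M ?e B" if "B \<in> recursor_axioms" "wf_fm B" for B
    using that by (intro ax) (auto simp: RCA0_omega_def)
  from this[of "Con (CRec N) \<cdot> Var (N \<rightarrow> N \<rightarrow> N) 0 \<cdot> Var N 0 \<cdot> Zero \<doteq> Var N 0"]
    this[of "Con (CRec N) \<cdot> Var (N \<rightarrow> N \<rightarrow> N) 0 \<cdot> Var N 0 \<cdot> (Var N 1 \<oplus> One) \<doteq>
      Var (N \<rightarrow> N \<rightarrow> N) 0 \<cdot> Var N 1 \<cdot> (Con (CRec N) \<cdot> Var (N \<rightarrow> N \<rightarrow> N) 0 \<cdot> Var N 0 \<cdot> Var N 1)"]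
  show "prec a G zero = a" "prec a G (add n one) = G n (prec a G n)"
    by (simp_all add: recursor_axioms_def Let_def prec_def f)
qed

lemma val_prim_rec:
  "ty_of t = Some N \<Longrightarrow>
   ap M N N (val M e (prim_rec a t)) n = prec (val M e a) (\<lambda>n h. val M (push N h (push N n e)) t) n"
  by (simp add: prim_rec_def val_lam prec_def)

lemma QF_induct:
  assumes "quantifier_free A" "wf_fm A" "sat M (push N zero e) A"
    and "\<And>n. sat M (push N n e) A \<Longrightarrow> sat M (push N (add n one) e) A"
  shows "sat M (push N n e) A"
proof -
  have "sat M e (subst_fm N 0 Zero A \<andand> All N (A \<leadsto> subst_fm N 0 (Var N 0 \<oplus> One) (lift_fm N 1 A)) \<leadsto> All N A)"
    using assms(1,2) by (intro ax) (auto simp: RCA0_omega_def QF_induction_def)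
  then show ?thesis using assms(3,4) by (simp add: sat_subst sat_lift_push1[simplified])
qed

lemma QF_AC:
  assumes "quantifier_free A" "wf_fm A" "\<And>f. \<exists>n. sat M (push N n (push ty1 f e)) A"
  shows "\<exists>F. \<forall>f. sat M (push N (ap M ty1 N F f) (push ty1 f e)) A"
proof -
  have "sat M e (All ty1 (Ex N A) \<leadsto>
       Ex ty2 (All ty1 (subst_fm N 0 (Var ty2 0 \<cdot> Var ty1 0) (lift_fm ty2 0 A))))"
    using assms(1,2) by (intro ax) (auto simp: RCA0_omega_def QF_AC_1_0_def)
  then obtain F where "\<And>f. sat M (push N (ap M ty1 N F f) (push ty1 f (push ty2 F e))) (lift_fm ty2 0 A)"
    using assms(3) by (auto simp: sat_subst)
  then have "\<And>f. sat M (push N (ap M ty1 N F f) (push ty1 f e)) A"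
    by (simp add: push_commute[of _ ty2] sat_lift_push)
  then show ?thesis by blast
qed

lemma raw_nonneg: "\<not> lt M x zero"
proof -
  have "sat M (push N x undefined) (Neg (Var N 0 \<lessdot> Zero))"
  proof (rule QF_induct)
    fix n assume *: "sat M (push N n undefined) (Neg (Var N 0 \<lessdot> Zero))"
    have "lt M n (add n one)"
      using raw_semiring(13)[of zero one n] raw_semiring(12) raw_semiring(2,3) by metis
    then show "sat M (push N (add n one) undefined) (Neg (Var N 0 \<lessdot> Zero))"
      using * raw_semiring(10) by auto
  qed (auto simp: raw_semiring)
  then show ?thesis by simp
qed

text \<open>Differences are not among the axioms. The recursor computes truncated subtraction by
  iterating the predecessor, and quantifier-free induction verifies it with the functions
  \<open>p\<close> and \<open>h\<close> as parameters.\<close>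

lemma raw_diff: "\<exists>d. lt M a x \<or> add d x = a"
  and raw_pred: "x = zero \<or> (\<exists>d. add d one = x)"
proof -
  define p where "p = Lam N N (prec zero (\<lambda>n h. n))"
  define h where "h = Lam N N (prec a (\<lambda>n h. ap M N N p h))"
  have rp: "rp N N (prec b G)" for b G unfolding prec_def[abs_def] by (rule rp_ap1)
  have r2: "Rp [N, N] N (\<lambda>c. c (Suc 0))" "Rp [N, N] N (\<lambda>c. ap M N N p (c 0))"
    by (rule Rp_const Rp_ap Rp_var | simp)+
  have p: "ap M N N p zero = zero" "ap M N N p (add n one) = n" for n
    using raw_prec[of "\<lambda>n h. n", OF r2(1)] by (simp_all add: p_def ap_Lam rp)
  have h: "ap M N N h zero = a" "ap M N N h (add n one) = ap M N N p (ap M N N h n)" for n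
    using raw_prec[of "\<lambda>n h. ap M N N p h", OF r2(2)] by (simp_all add: h_def ap_Lam rp)
  have pred: "x = zero \<or> add (ap M N N p x) one = x" for x
  proof -
    have "sat M (push N x (\<lambda>_ _. p)) (Var N 0 \<doteq> Zero \<oror> Var ty1 0 \<cdot> Var N 0 \<oplus> One \<doteq> Var N 0)"
      by (rule QF_induct) (simp_all add: p)
    then show ?thesis by auto
  qed
  let ?e = "\<lambda>\<sigma> i. if \<sigma> = N then a else h"
  let ?A = "Var N 1 \<lessdot> Var N 0 \<oror> Var ty1 0 \<cdot> Var N 0 \<oplus> Var N 0 \<doteq> Var N 1"
  have "sat M (push N x ?e) ?A"
  proof (rule QF_induct)
    fix n assume "sat M (push N n ?e) ?A"
    then consider "lt M a n" | "add (ap M N N h n) n = a" by auto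
    moreover have Suc: "lt M n (add n one)"
      using raw_semiring(13)[of zero one n] raw_semiring(12) raw_semiring(2,3) by metis
    ultimately have "lt M a (add n one) \<or> add (ap M N N h (add n one)) (add n one) = a"
    proof cases
      case 1
      then show ?thesis using raw_semiring(10) Suc by blast
    next
      case 2
      show ?thesis
      proof (cases "ap M N N h n = zero")
        case True
        then show ?thesis using 2 Suc raw_semiring(2,3) by metis
      next
        case False
        then have "add (ap M N N h (add n one)) one = ap M N N h n" using pred h by metis
        then show ?thesis using 2 raw_semiring(1,2) by metis
      qed
    qed
    then show "sat M (push N (add n one) ?e) ?A"
      by auto
  qed (simp_all add: h raw_semiring)
  then have "lt M a x \<or> add (ap M N N h x) x = a" by auto
  then show "\<exists>d. lt M a x \<or> add d x = a" by blast
  show "x = zero \<or> (\<exists>d. add d one = x)" using pred by blast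
qed

end

section \<open>The ordered field of fractions of a discrete semiring\<close>

text \<open>The arithmetic of possibly nonstandard numbers: truncated subtraction and discreteness
  are assumed, induction is not.\<close>

class discrete_semidom = linordered_semidom + comm_monoid_diff +
  assumes nonneg: "0 \<le> a"
    and less_imp_add_one_le: "a < b \<Longrightarrow> a + 1 \<le> b"
begin

lemma less_add_one_iff: "a < b + 1 \<longleftrightarrow> a \<le> b"
  using less_imp_add_one_le[of b a] by (metis add_increasing2 less_add_one le_less_trans not_less zero_le_one order.refl leD)

lemma add_one_le_iff: "a + 1 \<le> b \<longleftrightarrow> a < b"
  using less_imp_add_one_le less_add_one less_le_trans by blast

lemma diff_eq_0: "a \<le> b \<Longrightarrow> a - b = 0"
  by (metis add.commute diff_add_zero le_add_diff_inverse2)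

lemma zero_or_succ: "a = 0 \<or> (\<exists>b. a = b + 1)"
  using nonneg[of a] less_imp_add_one_le[of 0 a] le_add_diff_inverse2[of 1 a]
  by (metis add_0 order.not_eq_order_implies_strict)

end

\<comment> \<open>Formal differences of numbers. They form the integral domain that
  \<open>fract\<close> needs in order to build the rationals of a model.\<close>
quotient_type (overloaded) 'a dint = "'a::linordered_semidom \<times> 'a" / "\<lambda>(a, b) (c, d). a + d = c + b"
  morphisms Rep_dint Abs_dint
proof (rule equivpI)
  show "transp (\<lambda>(a, b) (c, d). a + d = c + (b :: 'a))"
  proof (rule transpI, clarify)
    fix a b c d e f :: 'a
    assume "a + d = c + b" "c + f = e + d"
    then have "(a + f) + (c + d) = (e + b) + (c + d)" by (simp add: algebra_simps) (metis add.assoc add.commute)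
    then show "a + f = e + b" by (rule add_right_imp_eq)
  qed
qed (auto intro!: reflpI sympI)

instantiation dint :: (linordered_semidom) comm_ring_1
begin

lift_definition zero_dint :: "'a dint" is "(0, 0)" .
lift_definition one_dint :: "'a dint" is "(1, 0)" .
lift_definition plus_dint :: "'a dint \<Rightarrow> 'a dint \<Rightarrow> 'a dint" is "\<lambda>(a, b) (c, d). (a + c, b + d)"
proof clarify
  fix a b a' b' c d c' d' :: 'a
  assume "a + b' = a' + b" "c + d' = c' + d"
  then have "(a + b') + (c + d') = (a' + b) + (c' + d)" by simp
  then show "a + c + (b' + d') = a' + c' + (b + d)" by (simp add: ac_simps)
qed
lift_definition uminus_dint :: "'a dint \<Rightarrow> 'a dint" is "\<lambda>(a, b). (b, a)"
  by (auto simp: ac_simps)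
lift_definition times_dint :: "'a dint \<Rightarrow> 'a dint \<Rightarrow> 'a dint" is "\<lambda>(a, b) (c, d). (a * c + b * d, a * d + b * c)"
proof clarify
  fix a b a' b' c d c' d' :: 'a
  assume *: "a + b' = a' + b" "c + d' = c' + d"
  have "(a + b') * c + (a' + b) * d + a' * (c + d') + b' * (c' + d) =
        (a' + b) * c + (a + b') * d + a' * (c' + d) + b' * (c + d')"
    using * by simp
  then have "(a * c + b * d + (a' * d' + b' * c')) + (a' * c + a' * d + b' * c + b' * d) =
      (a' * c' + b' * d' + (a * d + b * c)) + (a' * c + a' * d + b' * c + b' * d)"
    by (simp add: algebra_simps)
  then show "a * c + b * d + (a' * d' + b' * c') = a' * c' + b' * d' + (a * d + b * c)"
    by (rule add_right_imp_eq)
qed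
definition minus_dint :: "'a dint \<Rightarrow> 'a dint \<Rightarrow> 'a dint" where "minus_dint x y = x + - y"

instance
  by standard (unfold minus_dint_def, (transfer, auto simp: algebra_simps)+)

end

instantiation dint :: (linordered_semidom) linordered_idom
begin

lift_definition less_eq_dint :: "'a dint \<Rightarrow> 'a dint \<Rightarrow> bool" is "\<lambda>(a, b) (c, d). a + d \<le> c + b"
proof clarify
  fix a b a' b' c d c' d' :: 'a
  assume *: "a + b' = a' + b" "c + d' = c' + d"
  have "a + d \<le> c + b \<longleftrightarrow> (a + d) + (b' + d') \<le> (c + b) + (b' + d')" by simp
  also have "(a + d) + (b' + d') = (a' + d') + (b + d)" using * by (metis ab_semigroup_add_class.add_ac)
  also have "(c + b) + (b' + d') = (c' + b') + (b + d)" using * by (metis ab_semigroup_add_class.add_ac)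
  finally show "a + d \<le> c + b \<longleftrightarrow> a' + d' \<le> c' + b'" by simp
qed
definition less_dint :: "'a dint \<Rightarrow> 'a dint \<Rightarrow> bool" where "less_dint x y \<longleftrightarrow> x \<le> y \<and> \<not> y \<le> x"
definition abs_dint :: "'a dint \<Rightarrow> 'a dint" where "abs_dint x = (if x < 0 then - x else x)"
definition sgn_dint :: "'a dint \<Rightarrow> 'a dint" where "sgn_dint x = (if x = 0 then 0 else if 0 < x then 1 else - 1)"

instance
proof
  fix x y z :: "'a dint"
  show "x \<le> x" by transfer auto
  show "x < y \<longleftrightarrow> x \<le> y \<and> \<not> y \<le> x" by (rule less_dint_def)
  show "x \<le> z" if "x \<le> y" "y \<le> z"
    using that
  proof (transfer, clarify)
    fix a b c d e f :: 'a
    assume "a + d \<le> c + b" "c + f \<le> e + d"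
    then have "(a + d) + (c + f) \<le> (c + b) + (e + d)" by (rule add_mono)
    then have "(a + f) + (c + d) \<le> (e + b) + (c + d)" by (simp add: ac_simps)
    then show "a + f \<le> e + b" by simp
  qed
  show "x = y" if "x \<le> y" "y \<le> x" using that by transfer (auto simp: ac_simps)
  show "x \<le> y \<or> y \<le> x" by transfer (auto simp: ac_simps)
  show "z + x \<le> z + y" if "x \<le> y"
    using that
  proof (transfer, clarify)
    fix a b c d e f :: 'a
    assume "a + d \<le> c + b"
    then have "(e + f) + (a + d) \<le> (e + f) + (c + b)" by simp
    then show "e + a + (f + d) \<le> e + c + (f + b)" by (simp add: ac_simps)
  qed
  show "z * x < z * y" if "x < y" "0 < z"
  proof -
    have less: "u < v \<longleftrightarrow> \<not> v \<le> u" for u v :: "'a dint"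
      unfolding less_dint_def by transfer (auto simp: ac_simps)
    show ?thesis
      using that unfolding less
    proof (transfer, clarify)
      fix a b c d e f :: 'a
      assume *: "\<not> c + b \<le> a + d" "\<not> e + 0 \<le> 0 + f"
      define k where "k = e - f"
      have e: "e = k + f" using * by (simp add: k_def)
      then have "0 < k" using * by (metis add_0 add_0_right add_le_cancel_right not_le)
      then have "k * (a + d) < k * (c + b)" using * by (intro mult_strict_left_mono) auto
      moreover assume "e * c + f * d + (e * b + f * a) \<le> e * a + f * b + (e * d + f * c)"
      then have "k * (c + b) + (f * (a + d) + f * (b + c)) \<le> k * (a + d) + (f * (a + d) + f * (b + c))"
        unfolding e by (simp add: algebra_simps)
      ultimately show False by simp
    qed
  qed
  show "\<bar>x\<bar> = (if x < 0 then - x else x)" by (rule abs_dint_def)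
  show "sgn x = (if x = 0 then 0 else if 0 < x then 1 else - 1)" by (rule sgn_dint_def)
qed

end

lift_definition dint_of :: "'a::linordered_semidom \<Rightarrow> 'a dint" is "\<lambda>a. (a, 0)" .

lemma dint_of_simps:
  "dint_of 0 = 0" "dint_of 1 = 1" "dint_of (a + b) = dint_of a + dint_of b"
  "dint_of (a * b) = dint_of a * dint_of b" "dint_of a = dint_of b \<longleftrightarrow> a = b"
  "dint_of a \<le> dint_of b \<longleftrightarrow> a \<le> b"
  by (transfer, simp)+

lemma dint_cases: obtains a b where "x = dint_of a - dint_of b"
  unfolding minus_dint_def by transfer auto

definition emb :: "'a::linordered_semidom \<Rightarrow> 'a dint fract" where
  "emb a = Fract (dint_of a) 1"

lemma emb_simps [simp]:
  "emb 0 = 0" "emb 1 = 1" "emb (a + b) = emb a + emb b" "emb (a * b) = emb a * emb b"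
  "emb a = emb b \<longleftrightarrow> a = b" "emb a \<le> emb b \<longleftrightarrow> a \<le> b" "emb a < emb b \<longleftrightarrow> a < b"
  by (simp_all add: emb_def dint_of_simps Zero_fract_def One_fract_def eq_fract not_le[symmetric] del: not_le)

lemma emb_nonneg [simp]: "0 \<le> emb (a :: 'a :: discrete_semidom)"
  using emb_simps(6)[of 0 a] nonneg by simp

lemma emb_diff: "b \<le> a \<Longrightarrow> emb (a - b) = emb a - emb b"
  by (metis add_diff_cancel_right' emb_simps(3) le_add_diff_inverse2)

text \<open>A denominator can be made positive and is then a successor by discreteness. So every
  element of the field has the shape in which rationals are coded, and no rational lacks a
  code.\<close>

lemma fract_cases:
  fixes q :: "'a::discrete_semidom dint fract"
  obtains a b c where "q = (emb a - emb b) / (emb c + 1)"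
proof -
  have pos: "\<exists>a b c. q = (emb a - emb b) / (emb c + 1)" if q: "q = Fract x y" "0 < y" for q :: "'a dint fract" and x y
  proof -
    obtain a b where x: "x = dint_of a - dint_of b" by (rule dint_cases)
    obtain c d where y: "y = dint_of c - dint_of d" by (rule dint_cases)
    have "d < c" using q(2) y by (simp add: not_le[symmetric] dint_of_simps)
    then have "c - d \<noteq> 0" using le_add_diff_inverse2[of d c] by (metis add_0 less_imp_le less_irrefl)
    then obtain k where k: "c - d = k + 1" using zero_or_succ by blast
    then have "c = k + 1 + d" using \<open>d < c\<close> by (metis le_add_diff_inverse2 less_imp_le)
    then have "y = dint_of k + 1" by (simp add: y dint_of_simps)
    then have "q = (emb a - emb b) / (emb k + 1)"
      using q by (simp add: emb_def One_fract_def x)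
    then show ?thesis by blast
  qed
  obtain x y where q: "q = Fract x y" "y \<noteq> 0" by (cases q)
  then show ?thesis
  proof (cases "0 < y")
    case True
    then show ?thesis using pos[OF q(1)] that by blast
  next
    case False
    then have "q = Fract (- x) (- y)" "0 < - y" using q by simp_all
    then show ?thesis using pos that by blast
  qed
qed

section \<open>The numbers of a countermodel as a type\<close>

text \<open>Failures of either direction are covered by one predicate, so that one chosen model, and
  hence one type, serves both.\<close>

definition countermodel :: "nat struct \<Rightarrow> bool" where
  "countermodel M \<longleftrightarrow> rca M \<and>
     ((\<forall>e. sat M e BOOT) \<and> (\<exists>A\<in>insert open_plus ACA0. wf_fm A \<and> (\<exists>e. \<not> sat M e A)) \<or>
      (\<forall>A\<in>insert open_plus ACA0. wf_fm A \<longrightarrow> (\<forall>e. sat M e A)) \<and> (\<exists>e. \<not> sat M e BOOT))"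

definition the_cm :: "nat struct" where
  "the_cm = (SOME M. countermodel M)"

abbreviation "cm_add x y \<equiv> ap the_cm N N (ap the_cm N ty1 (cst the_cm CPlus) x) y"
abbreviation "cm_mult x y \<equiv> ap the_cm N N (ap the_cm N ty1 (cst the_cm CTimes) x) y"

text \<open>Making the numbers of a fixed countermodel a type gives access to the type class
  infrastructure of ordered fields. If there is no countermodel, \<open>mnat\<close> is a copy of \<open>nat\<close>.\<close>

typedef mnat = "UNIV :: nat set" ..

instantiation mnat :: "{zero, one, plus, times, minus, ord}"
begin

definition zero_mnat :: mnat where
  "zero_mnat = Abs_mnat (if HOL.Ex countermodel then cst the_cm C0 else 0)"
definition one_mnat :: mnat where
  "one_mnat = Abs_mnat (if HOL.Ex countermodel then cst the_cm C1 else 1)"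
definition plus_mnat :: "mnat \<Rightarrow> mnat \<Rightarrow> mnat" where
  "plus_mnat x y = Abs_mnat (if HOL.Ex countermodel then
     cm_add (Rep_mnat x) (Rep_mnat y)
     else Rep_mnat x + Rep_mnat y)"
definition times_mnat :: "mnat \<Rightarrow> mnat \<Rightarrow> mnat" where
  "times_mnat x y = Abs_mnat (if HOL.Ex countermodel then
     cm_mult (Rep_mnat x) (Rep_mnat y)
     else Rep_mnat x * Rep_mnat y)"
definition less_mnat :: "mnat \<Rightarrow> mnat \<Rightarrow> bool" where
  "less_mnat x y \<longleftrightarrow> (if HOL.Ex countermodel then lt the_cm (Rep_mnat x) (Rep_mnat y) else Rep_mnat x < Rep_mnat y)"
definition less_eq_mnat :: "mnat \<Rightarrow> mnat \<Rightarrow> bool" where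
  "less_eq_mnat x y \<longleftrightarrow> x < y \<or> x = y"
definition minus_mnat :: "mnat \<Rightarrow> mnat \<Rightarrow> mnat" where
  "minus_mnat x y = (if y \<le> x then SOME d. d + y = x else 0)"

instance ..

end

lemmas mnat_defs = zero_mnat_def one_mnat_def plus_mnat_def times_mnat_def less_mnat_def
  Abs_mnat_inverse[OF UNIV_I] Rep_mnat_inverse Abs_mnat_inject[OF UNIV_I UNIV_I] Rep_mnat_inject

lemma mnat_arith:
  fixes x y z :: mnat
  shows "(x + y) + z = x + (y + z)" "x + y = y + x" "x + 0 = x"
    "(x * y) * z = x * (y * z)" "x * y = y * x" "x * 1 = x" "x * 0 = 0" "x * (y + z) = x * y + x * z"
    "\<not> x < x" "x < y \<Longrightarrow> y < z \<Longrightarrow> x < z" "x < y \<or> x = y \<or> y < x" "(0 :: mnat) < 1"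
    "x < y \<Longrightarrow> x + z < y + z" "0 < z \<Longrightarrow> x < y \<Longrightarrow> x * z < y * z" "\<not> x < 0"
    "y \<le> x \<Longrightarrow> \<exists>d. d + y = x" "x = 0 \<or> (\<exists>d. d + 1 = x)"
proof -
  define P where "P \<longleftrightarrow> HOL.Ex countermodel"
  have m: "rca the_cm" if P
  proof -
    have "countermodel the_cm"
      unfolding the_cm_def using that unfolding P_def by (rule someI_ex)
    then show ?thesis by (simp add: countermodel_def)
  qed
  note d = mnat_defs P_def[symmetric]
  note raw = rca.raw_semiring[OF m] rca.raw_nonneg[OF m]
  show "(x + y) + z = x + (y + z)" by (cases P) (simp_all add: d raw(1))
  show "x + y = y + x" by (cases P) (simp_all add: d raw(2))
  show "x + 0 = x" by (cases P) (simp_all add: d raw(3))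
  show "(x * y) * z = x * (y * z)" by (cases P) (simp_all add: d raw(4))
  show "x * y = y * x" by (cases P) (simp_all add: d raw(5))
  show "x * 1 = x" by (cases P) (simp_all add: d raw(6))
  show "x * 0 = 0" by (cases P) (simp_all add: d raw(7))
  show "x * (y + z) = x * y + x * z" by (cases P) (simp_all add: d raw(8) add_mult_distrib2)
  show "\<not> x < x" by (cases P) (simp_all add: d raw(9))
  show "x < y \<Longrightarrow> y < z \<Longrightarrow> x < z" by (cases P) (auto simp add: d intro: raw(10))
  show "x < y \<or> x = y \<or> y < x"
    using raw(11) by (cases P) (auto simp: d Rep_mnat_inject[symmetric] simp del: Rep_mnat_inject)
  show "(0 :: mnat) < 1" by (cases P) (simp_all add: d raw(12))
  show "x < y \<Longrightarrow> x + z < y + z" by (cases P) (simp_all add: d raw(13))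
  show "0 < z \<Longrightarrow> x < y \<Longrightarrow> x * z < y * z" by (cases P) (simp_all add: d raw(14))
  show "\<not> x < 0" by (cases P) (simp_all add: d raw(15))
  show "\<exists>d. d + y = x" if le: "y \<le> x"
  proof (cases P)
    case True
    have "\<not> lt the_cm (Rep_mnat x) (Rep_mnat y)"
      using le True raw(9)[OF True] raw(10)[OF True] by (auto simp: less_eq_mnat_def d)
    then obtain d where "cm_add d (Rep_mnat y) = Rep_mnat x"
      using rca.raw_diff[OF m[OF True]] by blast
    then have "Abs_mnat d + y = x" using True by (simp add: d)
    then show ?thesis by blast
  next
    case False
    then have "Rep_mnat y \<le> Rep_mnat x" using le by (auto simp: less_eq_mnat_def d)
    then have "Abs_mnat (Rep_mnat x - Rep_mnat y) + y = x" using False by (simp add: d)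
    then show ?thesis by blast
  qed
  show "x = 0 \<or> (\<exists>d. d + 1 = x)"
  proof (cases P)
    case True
    from rca.raw_pred[OF m[OF True], of "Rep_mnat x"] show ?thesis
    proof
      assume "Rep_mnat x = cst the_cm C0"
      then have "x = Abs_mnat (cst the_cm C0)" by (metis Rep_mnat_inverse)
      then show ?thesis using True by (simp add: d)
    next
      assume "\<exists>d. cm_add d (cst the_cm C1) = Rep_mnat x"
      then obtain d where "cm_add d (cst the_cm C1) = Rep_mnat x" by blast
      then have "Abs_mnat d + 1 = x" using True by (simp add: d)
      then show ?thesis by blast
    qed
  next
    case False
    have "Rep_mnat x = 0 \<or> Abs_mnat (Rep_mnat x - 1) + 1 = x"
      using False by (cases "Rep_mnat x = 0") (simp_all add: d)
    moreover have "x = 0" if "Rep_mnat x = 0" using False that by (simp add: d) (metis Rep_mnat_inverse)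
    ultimately show ?thesis by blast
  qed
qed

instance mnat :: discrete_semidom
proof
  note A = mnat_arith
  have cancel: "d = d'" if "d + b = d' + b" for d d' b :: mnat
    using that A(9,11,13) by metis
  have diff: "a + b - b = a" for a b :: mnat
  proof -
    have "b \<le> a + b"
    proof (cases "a = 0")
      case True
      then have "a + b = b" using A(2,3) by metis
      then show ?thesis by (simp add: less_eq_mnat_def)
    next
      case False
      then have "0 < a" using A(11,15) by metis
      then show ?thesis using A(2,3,13) by (metis less_eq_mnat_def)
    qed
    then have "a + b - b + b = a + b" unfolding minus_mnat_def
      using someI_ex[OF A(16), of b "a + b"] by simp
    then show ?thesis by (rule cancel)
  qed
  have le_imp: "\<exists>d. a = d + b" if "b \<le> a" for a b :: mnat using A(16)[OF that] by metis
  have not_le: "\<not> b \<le> a \<longleftrightarrow> a < b" for a b :: mnat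
    using A(9,10,11) by (metis less_eq_mnat_def)
  have le_add: "b \<le> a + b" for a b :: mnat
    using A(2,3,11,13,15) by (metis less_eq_mnat_def)
  have zero: "a - b = 0" if "a < b" for a b :: mnat
    using that not_le[of b a] by (simp add: minus_mnat_def)
  have zero_diff: "0 - a = 0" for a :: mnat
    using diff[of 0 0] A(3,11,15) zero by metis
  fix a b c :: mnat
  show "0 - a = 0" by (rule zero_diff)
  show "a + b + c = a + (b + c)" "a + b = b + a" "0 + a = a" "a * b * c = a * (b * c)" "a * b = b * a"
    "1 * a = a" "(0 :: mnat) \<noteq> 1" "0 * a = 0" "a * 0 = 0" "(0 :: mnat) < 1"
    using A by metis+
  show "(a + b) * c = a * c + b * c" "a * (b + c) = a * b + a * c" using A(5,8) by metis+
  show "a + b - a = b" using diff A(2) by metis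
  show "a - b - c = a - (b + c)"
  proof (cases "b + c \<le> a")
    case True
    then obtain d where d: "a = d + (b + c)" using le_imp by blast
    then have "a = (d + c) + b" using A(1,2) by metis
    then have "a - b = d + c" using diff by simp
    then show ?thesis using d diff by simp
  next
    case False
    then have 1: "a - (b + c) = 0" using not_le zero by blast
    show ?thesis
    proof (cases "b \<le> a")
      case True
      then obtain d where d: "a = d + b" using le_imp by blast
      have "\<not> c \<le> d"
      proof
        assume "c \<le> d"
        then obtain e where "d = e + c" using le_imp by blast
        then have "a = e + (b + c)" using d A(1,2) by metis
        then show False using False le_add by simp
      qed
      then show ?thesis using d diff zero 1 not_le by metis
    next
      case F: False
      then have "a - b = 0" using not_le zero by blast
      then show ?thesis using 1 zero_diff by simp
    qed
  qed
  show "a * (b - c) = a * b - a * c"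
  proof (cases "c \<le> b")
    case True
    then obtain d where "b = d + c" using le_imp by blast
    then show ?thesis using diff A(8) by simp
  next
    case False
    show ?thesis
    proof (cases "a = 0")
      case True
      have "(0 :: mnat) - 0 = 0" using diff[of 0 0] A(3) by simp
      then show ?thesis using True A(5,7) by metis
    next
      case nz: False
      then have "0 < a" using A(11,15) by metis
      then have "a * b < a * c" using A(5,14) False not_le by metis
      then show ?thesis using zero False not_le A(7) by metis
    qed
  qed
  show "a < b \<longleftrightarrow> a \<le> b \<and> \<not> b \<le> a" using A(9,10) by (metis less_eq_mnat_def)
  show "a \<le> a" by (simp add: less_eq_mnat_def)
  show "a \<le> b \<Longrightarrow> b \<le> c \<Longrightarrow> a \<le> c" using A(10) by (metis less_eq_mnat_def)
  show "a \<le> b \<Longrightarrow> b \<le> a \<Longrightarrow> a = b" using A(9,10) by (metis less_eq_mnat_def)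
  show "a \<le> b \<or> b \<le> a" using A(11) by (metis less_eq_mnat_def)
  show "a \<le> b \<Longrightarrow> c + a \<le> c + b" using A(2,13) by (metis less_eq_mnat_def)
  show "a < b \<Longrightarrow> 0 < c \<Longrightarrow> c * a < c * b" using A(5,14) by metis
  show "b \<le> a \<Longrightarrow> a - b + b = a" using le_imp diff by metis
  show "0 \<le> a" using A(11,15) by (metis less_eq_mnat_def)
  show "a * b \<noteq> 0" if "a \<noteq> 0" "b \<noteq> 0"
  proof -
    have "0 < a" "0 < b" using that A(11,15) by metis+
    then have "0 * b < a * b" using A(14) by blast
    then show ?thesis using A(5,7,9) by metis
  qed
  show "a + 1 \<le> b" if "a < b"
  proof -
    have "a \<le> b" using that by (simp add: less_eq_mnat_def)
    then obtain d where d: "b = d + a" using le_imp by blast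
    have "d \<noteq> 0" using that d A(2,3,9) by metis
    then have "1 \<le> d" using A(17)[of d] le_add by metis
    then show ?thesis using d A(2,13) by (metis less_eq_mnat_def)
  qed
qed

text \<open>A mere renaming of the carrier. Applied to a countermodel \<open>the_cm\<close>, it
  makes the interpreted arithmetic coincide with the class operations of
  \<open>mnat\<close>.\<close>

definition transport :: "nat struct \<Rightarrow> mnat struct" where
  "transport M = \<lparr>ap = (\<lambda>\<rho> \<tau> x y. Abs_mnat (ap M \<rho> \<tau> (Rep_mnat x) (Rep_mnat y))),
     cst = (\<lambda>c. Abs_mnat (cst M c)), lt = (\<lambda>x y. lt M (Rep_mnat x) (Rep_mnat y))\<rparr>"

lemma val_transport:
  "ty_of t = Some \<tau> \<Longrightarrow> val (transport M) e t = Abs_mnat (val M (\<lambda>\<rho> i. Rep_mnat (e \<rho> i)) t)"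
proof (induction t arbitrary: \<tau>)
  case (App s t)
  then obtain \<rho> where "ty_of s = Some (\<rho> \<rightarrow> \<tau>)" "ty_of t = Some \<rho>"
    by (auto split: option.splits ty.splits if_splits)
  then show ?case using App by (simp add: transport_def Abs_mnat_inverse)
qed (simp_all add: transport_def Rep_mnat_inverse)

lemma sat_transport: "wf_fm A \<Longrightarrow> sat (transport M) e A \<longleftrightarrow> sat M (\<lambda>\<rho> i. Rep_mnat (e \<rho> i)) A"
proof (induction A arbitrary: e)
  case (Less s t)
  then show ?case by (simp add: val_transport) (simp add: transport_def Abs_mnat_inverse)
next
  case (All \<rho> A)
  have "(\<lambda>\<sigma> i. Rep_mnat (push \<rho> x e \<sigma> i)) = push \<rho> (Rep_mnat x) (\<lambda>\<sigma> i. Rep_mnat (e \<sigma> i))" for x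
    by (rule ext)+ (auto simp: push_def split: nat.split)
  then have "sat (transport M) e (All \<rho> A) \<longleftrightarrow> (\<forall>x. sat M (push \<rho> (Rep_mnat x) (\<lambda>\<sigma> i. Rep_mnat (e \<sigma> i))) A)"
    using All by simp
  also have "\<dots> \<longleftrightarrow> (\<forall>x. sat M (push \<rho> x (\<lambda>\<sigma> i. Rep_mnat (e \<sigma> i))) A)"
    by (metis Abs_mnat_inverse UNIV_I)
  finally show ?case by simp
qed (simp_all add: val_transport Abs_mnat_inject)

lemma extensional_transport: "extensional M \<Longrightarrow> extensional (transport M)"
  unfolding extensional_def
proof (intro allI impI)
  fix \<rho> \<tau> f g
  assume ext: "\<forall>\<rho> \<tau> f g. (\<forall>x. ap M \<rho> \<tau> f x = ap M \<rho> \<tau> g x) \<longrightarrow> f = g"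
    and *: "\<forall>x. ap (transport M) \<rho> \<tau> f x = ap (transport M) \<rho> \<tau> g x"
  have "ap M \<rho> \<tau> (Rep_mnat f) x = ap M \<rho> \<tau> (Rep_mnat g) x" for x
    using *[rule_format, of "Abs_mnat x"] by (simp add: transport_def mnat_defs)
  then have "Rep_mnat f = Rep_mnat g"
    using ext[rule_format, of \<rho> \<tau> "Rep_mnat f" "Rep_mnat g"] by simp
  then show "f = g" by (simp add: Rep_mnat_inject)
qed

section \<open>Primitive recursive functions in a model\<close>

locale rca_model = rca M for M :: "'n::discrete_semidom struct" +
  assumes zero_eq [simp]: "cst M C0 = 0" and one_eq [simp]: "cst M C1 = 1"
    and add_eq [simp]: "add x y = x + y"
    and mult_eq [simp]: "mult x y = x * y"
    and lt_eq [simp]: "lt M x y \<longleftrightarrow> x < y"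
begin

lemma prec_0: "Rp [N, N] N (\<lambda>c. G (c (Suc 0)) (c 0)) \<Longrightarrow> prec a G 0 = a"
  and prec_Suc: "Rp [N, N] N (\<lambda>c. G (c (Suc 0)) (c 0)) \<Longrightarrow> prec a G (n + 1) = G n (prec a G n)"
  using raw_prec(1)[of G a] raw_prec(2)[of G a n] by simp_all

lemma rp_prec: "rp N N (prec a G)"
  unfolding prec_def[abs_def] by (rule rp_ap1)

lemma Rp_prec:
  assumes "Rp \<Gamma> N A" "Rp (N # N # \<Gamma>) N (\<lambda>c. G (\<lambda>i. c (Suc (Suc i))) (c (Suc 0)) (c 0))" "Rp \<Gamma> N B"
  shows "Rp \<Gamma> N (\<lambda>c. prec (A c) (G c) (B c))"
  unfolding prec_def
proof (intro Rp_ap Rp_const assms)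
  have "Rp (N # \<Gamma>) (N \<rightarrow> N) (\<lambda>c. Lam N N (G (\<lambda>i. c (Suc i)) (c 0)))"
    using assms(2) by (intro Rp_Lam) simp
  then show "Rp \<Gamma> (N \<rightarrow> N \<rightarrow> N) (\<lambda>c. Lam N (N \<rightarrow> N) (\<lambda>n. Lam N N (G c n)))" by (rule Rp_Lam)
qed

lemma Rp_add:
  assumes "Rp \<Gamma> N F" "Rp \<Gamma> N G"
  shows "Rp \<Gamma> N (\<lambda>c. F c + G c)"
proof -
  have "Rp \<Gamma> N (\<lambda>c. ap M N N (ap M N ty1 (cst M CPlus) (F c)) (G c))"
    by (intro Rp_ap[OF Rp_ap[OF Rp_const]] assms)
  then show ?thesis by simp
qed

lemma Rp_mult:
  assumes "Rp \<Gamma> N F" "Rp \<Gamma> N G"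
  shows "Rp \<Gamma> N (\<lambda>c. F c * G c)"
proof -
  have "Rp \<Gamma> N (\<lambda>c. ap M N N (ap M N ty1 (cst M CTimes) (F c)) (G c))"
    by (intro Rp_ap[OF Rp_ap[OF Rp_const]] assms)
  then show ?thesis by simp
qed

lemmas Rp0 = Rp_const Rp_var Rp_add Rp_mult Rp_ap Rp_prec Rp_Lam

definition pd :: "'n \<Rightarrow> 'n" where "pd = prec 0 (\<lambda>n h. n)"

lemma pd_simps: "pd 0 = 0" "pd (n + 1) = n"
  unfolding pd_def by (subst prec_0 prec_Suc; (rule Rp0 | simp)+)+

lemma rp_pd: "rp N N pd" by (simp add: pd_def rp_prec)

lemma pd_eq: "pd n = n - 1"
  using zero_or_succ[of n] pd_simps by auto

text \<open>The invariant has to be quantifier-free: either the iteration has reached zero and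
  \<open>a < n\<close>, or its value still adds up with \<open>n\<close> to
  \<open>a\<close>.\<close>

lemma prec_pd: "prec a (\<lambda>n. pd) n = a - n"
proof -
  define h where "h = Lam N N (prec a (\<lambda>n. pd))"
  have R: "Rp [N, N] N (\<lambda>c. pd (c 0))" by (rule Rp_rp[OF rp_pd] Rp0 | simp)+
  have h: "ap M N N h n = prec a (\<lambda>n. pd) n" for n by (simp add: h_def ap_Lam rp_prec)
  let ?e = "\<lambda>\<sigma> i. if \<sigma> = N then a else h"
  let ?A = "(Var ty1 0 \<cdot> Var N 0 \<doteq> Zero \<andand> Var N 1 \<lessdot> Var N 0) \<oror> Var ty1 0 \<cdot> Var N 0 \<oplus> Var N 0 \<doteq> Var N 1"
  have "sat M (push N n ?e) ?A"
  proof (rule QF_induct)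
    fix n assume "sat M (push N n ?e) ?A"
    then have "prec a (\<lambda>n. pd) n = 0 \<and> a < n \<or> prec a (\<lambda>n. pd) n + n = a" by (auto simp: h)
    moreover have "prec a (\<lambda>n. pd) (n + 1) = pd (prec a (\<lambda>n. pd) n)"
      by (rule prec_Suc[of "\<lambda>n. pd", OF R])
    moreover have "n < n + 1" by simp
    ultimately have "prec a (\<lambda>n. pd) (n + 1) = 0 \<and> a < n + 1 \<or> prec a (\<lambda>n. pd) (n + 1) + (n + 1) = a"
      using zero_or_succ[of "prec a (\<lambda>n. pd) n"] pd_simps
      by (auto simp: ac_simps intro: less_trans)
    then show "sat M (push N (add n one) ?e) ?A"
      by (auto simp: h)
  qed (auto simp: h prec_0[of "\<lambda>n. pd", OF R])
  then have *: "prec a (\<lambda>n. pd) n = 0 \<and> a < n \<or> prec a (\<lambda>n. pd) n + n = a" by (auto simp: h)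
  then show ?thesis
  proof
    assume "prec a (\<lambda>n. pd) n + n = a"
    then show ?thesis by (metis add_diff_cancel_right')
  qed (simp add: diff_eq_0 less_imp_le)
qed


lemma prec_monus: "prec a (\<lambda>n h. h - 1) n = a - n"
  using prec_pd[of a n] by (simp add: pd_eq[abs_def])

lemma Rp_minus: "Rp \<Gamma> N F \<Longrightarrow> Rp \<Gamma> N G \<Longrightarrow> Rp \<Gamma> N (\<lambda>c. F c - G c)"
  unfolding prec_pd[symmetric] by (rule Rp_rp[OF rp_pd] Rp0 | assumption | simp)+

text \<open>Decidability inside the model, uniformly in variables with the types
  \<open>\<Gamma>\<close>. Other parameters are elements of the model of any type.\<close>

definition dec :: "ty list \<Rightarrow> ((nat \<Rightarrow> 'n) \<Rightarrow> bool) \<Rightarrow> bool" where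
  "dec \<Gamma> P \<longleftrightarrow> Rp \<Gamma> N (\<lambda>c. if P c then 1 else 0)"

lemma one_le_diff: "a < b \<Longrightarrow> (1 :: 'n) - (b - a) = 0"
proof -
  assume "a < b"
  then have "b - a \<noteq> 0" using le_add_diff_inverse2[of a b] by (metis add_0 less_imp_le less_irrefl)
  then have "1 \<le> b - a" using less_imp_add_one_le[of 0 "b - a"] nonneg[of "b - a"] by (simp add: order.strict_iff_order)
  then show ?thesis by (rule diff_eq_0)
qed

lemma dec_less: "Rp \<Gamma> N F \<Longrightarrow> Rp \<Gamma> N G \<Longrightarrow> dec \<Gamma> (\<lambda>c. F c < G c)"
proof -
  assume "Rp \<Gamma> N F" "Rp \<Gamma> N G"
  then have "Rp \<Gamma> N (\<lambda>c. 1 - (1 - (G c - F c)))" by (intro Rp_minus Rp_const)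
  moreover have "1 - (1 - (G c - F c)) = (if F c < G c then 1 else 0)" for c
    by (simp add: one_le_diff diff_eq_0 not_less)
  ultimately show ?thesis unfolding dec_def by simp
qed

lemma dec_not: "dec \<Gamma> P \<Longrightarrow> dec \<Gamma> (\<lambda>c. \<not> P c)"
proof -
  assume "dec \<Gamma> P"
  then have "Rp \<Gamma> N (\<lambda>c. 1 - (if P c then 1 else 0))" unfolding dec_def by (intro Rp_minus Rp_const)
  moreover have "(1 - (if P c then 1 else 0)) = (if \<not> P c then 1 else (0 :: 'n))" for c by simp
  ultimately show ?thesis unfolding dec_def by simp
qed

lemma dec_conj: "dec \<Gamma> P \<Longrightarrow> dec \<Gamma> Q \<Longrightarrow> dec \<Gamma> (\<lambda>c. P c \<and> Q c)"
proof -
  assume "dec \<Gamma> P" "dec \<Gamma> Q"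
  then have "Rp \<Gamma> N (\<lambda>c. (if P c then 1 else 0) * (if Q c then 1 else 0))" unfolding dec_def by (rule Rp_mult)
  moreover have "(if P c then 1 else 0) * (if Q c then 1 else 0) = (if P c \<and> Q c then 1 else (0 :: 'n))" for c by simp
  ultimately show ?thesis unfolding dec_def by simp
qed

lemma dec_imp: "dec \<Gamma> P \<Longrightarrow> dec \<Gamma> Q \<Longrightarrow> dec \<Gamma> (\<lambda>c. P c \<longrightarrow> Q c)"
  using dec_not[OF dec_conj[OF _ dec_not], of \<Gamma> P Q] by simp

lemma dec_disj: "dec \<Gamma> P \<Longrightarrow> dec \<Gamma> Q \<Longrightarrow> dec \<Gamma> (\<lambda>c. P c \<or> Q c)"
  using dec_imp[OF dec_not, of \<Gamma> P Q] by (simp add: imp_conv_disj)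

lemma dec_le: "Rp \<Gamma> N F \<Longrightarrow> Rp \<Gamma> N G \<Longrightarrow> dec \<Gamma> (\<lambda>c. F c \<le> G c)"
  using dec_not[OF dec_less, of \<Gamma> G F] by (simp add: not_less)

lemma dec_eq: "Rp \<Gamma> N F \<Longrightarrow> Rp \<Gamma> N G \<Longrightarrow> dec \<Gamma> (\<lambda>c. F c = G c)"
  using dec_conj[OF dec_le dec_le, of \<Gamma> F G G F] by (simp add: order_eq_iff)

lemma dec_const: "dec \<Gamma> (\<lambda>c. b)"
  unfolding dec_def by (rule Rp_const)

lemma Rp_if:
  assumes "dec \<Gamma> P" "Rp \<Gamma> N F" "Rp \<Gamma> N G"
  shows "Rp \<Gamma> N (\<lambda>c. if P c then F c else G c)"
proof -
  have "Rp \<Gamma> N (\<lambda>c. (if P c then 1 else 0) * F c + (1 - (if P c then 1 else 0)) * G c)"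
    using assms unfolding dec_def by (intro Rp_minus Rp_add Rp_mult Rp_const)
  moreover have "(if P c then 1 else 0) * F c + (1 - (if P c then 1 else 0)) * G c = (if P c then F c else G c)" for c
    by simp
  ultimately show ?thesis by simp
qed

lemmas dec_rules = dec_const dec_not dec_conj dec_imp dec_disj dec_less dec_le dec_eq

lemmas Rp1 = Rp_const Rp_var Rp_add Rp_mult Rp_minus Rp_if Rp_ap Rp_prec Rp_Lam

text \<open>With the characteristic function as a parameter \<open>f\<close>, the predicate becomes
  the quantifier-free formula \<open>f n = 1\<close>, to which the induction axiom applies.\<close>

lemma dec_induct:
  assumes "dec [N] (\<lambda>c. P (c 0))" "P 0" "\<And>n. P n \<Longrightarrow> P (n + 1)"
  shows "P n"
proof -
  have rp: "rp N N (\<lambda>n. if P n then 1 else 0)" using assms(1) unfolding dec_def by (rule rpI)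
  define f where "f = Lam N N (\<lambda>n. if P n then 1 else 0)"
  have f: "ap M N N f n = 1 \<longleftrightarrow> P n" for n by (simp add: f_def ap_Lam[OF rp])
  have "sat M (push N n (\<lambda>_ _. f)) (Var ty1 0 \<cdot> Var N 0 \<doteq> One)"
    by (rule QF_induct) (use assms(2,3) in \<open>simp_all add: f\<close>)
  then show ?thesis by (simp add: f)
qed


section \<open>Pairing\<close>

definition tri :: "'n \<Rightarrow> 'n" where "tri = prec 0 (\<lambda>n h. h + (n + 1))"

lemma tri_simps: "tri 0 = 0" "tri (n + 1) = tri n + (n + 1)"
  unfolding tri_def by (subst prec_0 prec_Suc; (rule Rp1 | simp)+)+

lemma Rp_tri: "Rp \<Gamma> N F \<Longrightarrow> Rp \<Gamma> N (\<lambda>c. tri (F c))"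
  by (rule Rp_rp) (simp_all add: tri_def rp_prec)

definition troot :: "'n \<Rightarrow> 'n" where
  "troot = prec 0 (\<lambda>n w. w + (1 - (tri (w + 1) - (n + 1))))"

lemma troot_simps: "troot 0 = 0" "troot (n + 1) = troot n + (1 - (tri (troot n + 1) - (n + 1)))"
  unfolding troot_def by (subst prec_0 prec_Suc; (rule Rp_tri Rp1 | simp)+)+

lemma Rp_troot: "Rp \<Gamma> N F \<Longrightarrow> Rp \<Gamma> N (\<lambda>c. troot (F c))"
  by (rule Rp_rp) (simp_all add: troot_def rp_prec)

text \<open>The recursion raises the root by one exactly when the argument reaches the next
  triangular number.\<close>

lemma troot: "tri (troot k) \<le> k \<and> k < tri (troot k + 1)"
proof (rule dec_induct[of "\<lambda>k. tri (troot k) \<le> k \<and> k < tri (troot k + 1)"])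
  show "dec [N] (\<lambda>c. tri (troot (c 0)) \<le> c 0 \<and> c 0 < tri (troot (c 0) + 1))"
    by (rule dec_rules Rp_tri Rp_troot Rp1 | simp)+
  show "tri (troot 0) \<le> 0 \<and> 0 < tri (troot 0 + 1)"
    using tri_simps(2)[of 0] by (simp add: tri_simps troot_simps)
next
  fix k assume *: "tri (troot k) \<le> k \<and> k < tri (troot k + 1)"
  then have le: "k + 1 \<le> tri (troot k + 1)" by (simp add: add_one_le_iff)
  show "tri (troot (k + 1)) \<le> k + 1 \<and> k + 1 < tri (troot (k + 1) + 1)"
  proof (cases "tri (troot k + 1) = k + 1")
    case True
    have "0 < troot k + 1 + 1" using nonneg[of "troot k"] by (simp add: add_nonneg_pos)
    then show ?thesis using True tri_simps(2)[of "troot k + 1"] by (simp add: troot_simps)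
  next
    case False
    then have lt: "k + 1 < tri (troot k + 1)" using le by simp
    then have "troot (k + 1) = troot k" by (simp add: troot_simps one_le_diff)
    moreover have "k \<le> k + 1" by simp
    ultimately show ?thesis using * lt by (auto intro: order_trans)
  qed
qed

lemma tri_mono: "tri a \<le> tri (a + b)"
proof (rule dec_induct[of "\<lambda>b. tri a \<le> tri (a + b)"])
  show "dec [N] (\<lambda>x. tri a \<le> tri (a + x 0))"
    by (rule dec_rules Rp_tri Rp1 | simp)+
  fix b assume "tri a \<le> tri (a + b)"
  then have "tri a \<le> tri (a + b) + (a + b + 1)" by (intro add_increasing2 nonneg)
  then show "tri a \<le> tri (a + (b + 1))" using tri_simps(2)[of "a + b"] by (simp add: add.assoc)
qed simp

lemma troot_unique: "tri w \<le> k \<Longrightarrow> k < tri (w + 1) \<Longrightarrow> troot k = w"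
proof -
  assume *: "tri w \<le> k" "k < tri (w + 1)"
  have "False" if "v < w" "tri w \<le> k" "k < tri (v + 1)" for v w :: 'n
  proof -
    have "w = v + 1 + (w - (v + 1))" using that(1) by (metis add.commute le_add_diff_inverse2 less_imp_add_one_le)
    then show False using tri_mono[of "v + 1" "w - (v + 1)"] that by simp
  qed
  then show ?thesis using * troot[of k] by (metis linorder_neqE)
qed

definition nfirst :: "'n \<Rightarrow> 'n" where "nfirst k = k - tri (troot k)"
definition nsecond :: "'n \<Rightarrow> 'n" where "nsecond k = troot k - nfirst k"
definition npair :: "'n \<Rightarrow> 'n \<Rightarrow> 'n" where "npair m n = tri (m + n) + m"

lemma troot_npair: "troot (npair m n) = m + n"
proof (rule troot_unique)
  show "tri (m + n) \<le> npair m n" using nonneg[of m] by (simp add: npair_def)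
  have "m < m + n + 1" using nonneg[of n] by (simp add: less_add_one_iff)
  then show "npair m n < tri (m + n + 1)" unfolding tri_simps npair_def by simp
qed

lemma npair_simps [simp]: "nfirst (npair m n) = m" "nsecond (npair m n) = n"
proof -
  show 1: "nfirst (npair m n) = m" unfolding nfirst_def troot_npair by (simp add: npair_def)
  show "nsecond (npair m n) = n" unfolding nsecond_def troot_npair 1 by simp
qed

lemma Rp_nfirst: "Rp \<Gamma> N F \<Longrightarrow> Rp \<Gamma> N (\<lambda>c. nfirst (F c))"
  unfolding nfirst_def by (intro Rp_minus Rp_tri Rp_troot)

lemma Rp_nsecond: "Rp \<Gamma> N F \<Longrightarrow> Rp \<Gamma> N (\<lambda>c. nsecond (F c))"
  unfolding nsecond_def by (intro Rp_minus Rp_nfirst Rp_troot)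

lemma Rp_npair: "Rp \<Gamma> N F \<Longrightarrow> Rp \<Gamma> N G \<Longrightarrow> Rp \<Gamma> N (\<lambda>c. npair (F c) (G c))"
  unfolding npair_def by (intro Rp_add Rp_tri)

lemma predecessor [simp]:
  "ty_of t = Some N \<Longrightarrow> val M e (predecessor t) = val M e t - 1"
  by (simp_all add: predecessor_def val_prim_rec flip: pd_eq) (simp add: pd_def)


lemma monus [simp]:
  "ty_of s = Some N \<Longrightarrow> ty_of t = Some N \<Longrightarrow> val M e (s \<ominus> t) = val M e s - val M e t"
  by (simp_all add: monus_def val_prim_rec prec_monus)

lemma triangle [simp]:
  "ty_of t = Some N \<Longrightarrow> val M e (Defs.triangle t) = tri (val M e t)"
  by (simp_all add: Defs.triangle_def val_prim_rec tri_def)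

lemma triangle_root [simp]:
  "ty_of t = Some N \<Longrightarrow> val M e (triangle_root t) = troot (val M e t)"
  by (simp_all add: triangle_root_def val_prim_rec troot_def)

lemma first [simp]:
  "ty_of t = Some N \<Longrightarrow> val M e (first t) = nfirst (val M e t)"
  by (simp_all add: first_def nfirst_def)

lemma second [simp]:
  "ty_of t = Some N \<Longrightarrow> val M e (second t) = nsecond (val M e t)"
  by (simp_all add: second_def nsecond_def)

lemma pair [simp]:
  "ty_of s = Some N \<Longrightarrow> ty_of t = Some N \<Longrightarrow> val M e (pair s t) = npair (val M e s) (val M e t)"
  by (simp_all add: pair_def npair_def)


section \<open>Rational numbers in a model\<close>

definition nrat :: "'n \<Rightarrow> 'n \<Rightarrow> 'n \<Rightarrow> 'n" where "nrat a b c = npair (npair a b) c"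
definition npos :: "'n \<Rightarrow> 'n" where "npos q = nfirst (nfirst q)"
definition nneg :: "'n \<Rightarrow> 'n" where "nneg q = nsecond (nfirst q)"
definition nden :: "'n \<Rightarrow> 'n" where "nden q = nsecond q + 1"

definition qv :: "'n \<Rightarrow> 'n dint fract" where
  "qv q = (emb (npos q) - emb (nneg q)) / emb (nden q)"

lemma nrat_simps [simp]: "npos (nrat a b c) = a" "nneg (nrat a b c) = b" "nden (nrat a b c) = c + 1"
  "nsecond (nrat a b c) = c"
  by (simp_all add: npos_def nneg_def nden_def nrat_def)

lemma nden_pos: "0 < emb (nden q)"
  using nonneg[of "nsecond q"] by (simp add: nden_def add_nonneg_pos)

lemma qv_nrat: "qv (nrat a b c) = (emb a - emb b) / (emb c + 1)"
  by (simp add: qv_def)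

lemma qv_surj: obtains c where "qv c = q"
proof -
  obtain a b c where "q = (emb a - emb b) / (emb c + 1)" by (rule fract_cases)
  then have "qv (nrat a b c) = q" by (simp add: qv_nrat)
  then show ?thesis by (rule that)
qed

definition nless :: "'n \<Rightarrow> 'n \<Rightarrow> bool" where
  "nless q r \<longleftrightarrow> npos q * nden r + nneg r * nden q < npos r * nden q + nneg q * nden r"

lemma nless_iff: "nless q r \<longleftrightarrow> qv q < qv r"
proof -
  have "qv q < qv r \<longleftrightarrow> (emb (npos q) - emb (nneg q)) * emb (nden r) < (emb (npos r) - emb (nneg r)) * emb (nden q)"
    unfolding qv_def using nden_pos[of q] nden_pos[of r] by (simp add: field_simps)
  also have "\<dots> \<longleftrightarrow> emb (npos q) * emb (nden r) + emb (nneg r) * emb (nden q) < emb (npos r) * emb (nden q) + emb (nneg q) * emb (nden r)"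
    by (simp add: algebra_simps)
  also have "\<dots> \<longleftrightarrow> emb (npos q * nden r + nneg r * nden q) < emb (npos r * nden q + nneg q * nden r)"
    by simp
  finally show ?thesis unfolding nless_def emb_simps(7) by simp
qed

definition nadd :: "'n \<Rightarrow> 'n \<Rightarrow> 'n" where
  "nadd x y = nrat (npos x * nden y + npos y * nden x) (nneg x * nden y + nneg y * nden x) (nden x * nden y - 1)"

text \<open>A code stores its denominator less one. The product of two denominators is positive, so
  the truncated subtraction of 1 in \<open>nadd\<close> is exact.\<close>

lemma qv_nadd [simp]: "qv (nadd x y) = qv x + qv y"
proof -
  have "0 < nden z" for z using nonneg[of "nsecond z"] by (simp add: nden_def add_nonneg_pos)
  then have "0 < nden x * nden y" by (intro mult_pos_pos)
  then have "1 \<le> nden x * nden y" using less_imp_add_one_le[of 0 "nden x * nden y"] by simp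
  then have "emb (nden x * nden y - 1) + 1 = emb (nden x) * emb (nden y)" by (simp add: emb_diff)
  then show ?thesis unfolding nadd_def qv_nrat using nden_pos[of x] nden_pos[of y]
    by (simp add: qv_def field_simps)
qed

definition numinus :: "'n \<Rightarrow> 'n" where "numinus x = nrat (nneg x) (npos x) (nsecond x)"

lemma qv_numinus [simp]: "qv (numinus x) = - qv x"
  by (simp add: numinus_def qv_nrat) (simp add: qv_def nden_def minus_divide_left)

definition nabs :: "'n \<Rightarrow> 'n" where "nabs x = nrat ((npos x - nneg x) + (nneg x - npos x)) 0 (nsecond x)"

text \<open>At most one of the two truncated differences is nonzero, and it is the absolute
  value.\<close>

lemma qv_nabs [simp]: "qv (nabs x) = \<bar>qv x\<bar>"
proof -
  have "emb ((npos x - nneg x) + (nneg x - npos x)) = \<bar>emb (npos x) - emb (nneg x)\<bar>"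
    by (cases "npos x" "nneg x" rule: linorder_cases)
       (auto simp: emb_diff diff_eq_0 abs_if less_imp_le dest: less_asym)
  then have "qv (nabs x) = \<bar>emb (npos x) - emb (nneg x)\<bar> / emb (nden x)"
    unfolding nabs_def qv_nrat by (simp add: nden_def)
  also have "\<dots> = \<bar>qv x\<bar>" using nden_pos[of x] by (simp add: qv_def)
  finally show ?thesis .
qed

definition ndist :: "'n \<Rightarrow> 'n \<Rightarrow> 'n" where "ndist x y = nabs (nadd x (numinus y))"

lemma qv_ndist [simp]: "qv (ndist x y) = \<bar>qv x - qv y\<bar>"
  by (simp add: ndist_def)

definition nhalf :: "'n \<Rightarrow> 'n" where "nhalf n = nrat 1 0 (prec 0 (\<lambda>n h. h + h + 1) n)"

definition hp :: "'n \<Rightarrow> 'n dint fract" where "hp n = qv (nhalf n)"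

lemma hp_pos [simp]: "0 < hp n"
  unfolding hp_def nhalf_def qv_nrat by (simp add: add_nonneg_pos)

lemma hp_simps [simp]: "hp 0 = 1" "hp (n + 1) = hp n / 2"
proof -
  have R: "Rp [N, N] N (\<lambda>c. c 0 + c 0 + 1)" by (rule Rp1 | simp)+
  show "hp 0 = 1" by (simp add: hp_def nhalf_def qv_nrat prec_0[of "\<lambda>n h. h + h + 1", OF R])
  define p where "p = prec 0 (\<lambda>n h. h + h + 1)"
  have nh: "nhalf m = nrat 1 0 (p m)" for m by (simp add: nhalf_def p_def)
  have "p (n + 1) = p n + p n + 1" unfolding p_def by (rule prec_Suc[OF R])
  moreover have "emb (p n) + 1 > 0" by (simp add: add_nonneg_pos)
  ultimately show "hp (n + 1) = hp n / 2"
    by (simp add: hp_def nh qv_nrat field_simps)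
qed

lemma q_less [simp]:
  assumes "ty_of q = Some N" "ty_of r = Some N"
  shows "sat M e (q <\<^sub>Q r) \<longleftrightarrow> qv (val M e q) < qv (val M e r)"
proof -
  have "sat M e (q <\<^sub>Q r) \<longleftrightarrow> nless (val M e q) (val M e r)"
    using assms by (simp add: q_less_def pos_def neg_def den_def nless_def npos_def nneg_def nden_def)
  then show "sat M e (q <\<^sub>Q r) \<longleftrightarrow> qv (val M e q) < qv (val M e r)" by (simp add: nless_iff)
qed

end

lemma sat_Ex [simp]: "sat M e (Ex \<rho> A) \<longleftrightarrow> (\<exists>x. sat M (push \<rho> x e) A)"
  by auto

context rca_model
begin

lemma rat [simp]:
  assumes "ty_of a = Some N" "ty_of b = Some N" "ty_of c = Some N"
  shows "val M e (rat a b c) = nrat (val M e a) (val M e b) (val M e c)"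
  using assms by (simp_all add: rat_def nrat_def)

lemma pos_neg_den [simp]:
  assumes "ty_of q = Some N"
  shows "val M e (pos q) = npos (val M e q)"
    "val M e (neg q) = nneg (val M e q)"
    "val M e (den q) = nden (val M e q)"
  using assms by (simp_all add: pos_def neg_def den_def npos_def nneg_def nden_def)

lemma q_le [simp]:
  assumes "ty_of q = Some N" "ty_of r = Some N"
  shows "sat M e (q \<le>\<^sub>Q r) \<longleftrightarrow> qv (val M e q) \<le> qv (val M e r)"
  using assms by (simp_all add: q_le_def not_less)

lemma q_add [simp]:
  assumes "ty_of q = Some N" "ty_of r = Some N"
  shows "val M e (q +\<^sub>Q r) = nadd (val M e q) (val M e r)"
  using assms by (simp_all add: q_add_def nadd_def Let_def)

lemma q_minus [simp]:
  assumes "ty_of q = Some N"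
  shows "val M e (q_minus q) = numinus (val M e q)"
  using assms by (simp_all add: q_minus_def numinus_def Let_def)

lemma q_abs [simp]:
  assumes "ty_of q = Some N"
  shows "val M e (q_abs q) = nabs (val M e q)"
  using assms by (simp_all add: q_abs_def nabs_def Let_def)

lemma q_dist [simp]:
  assumes "ty_of q = Some N" "ty_of r = Some N"
  shows "val M e (q_dist q r) = ndist (val M e q) (val M e r)"
  using assms by (simp_all add: q_dist_def ndist_def)

lemma half_pow [simp]:
  assumes "ty_of q = Some N"
  shows "val M e (half_pow q) = nhalf (val M e q)"
  using assms by (simp_all add: half_pow_def nhalf_def val_prim_rec)

declare hp_def [symmetric, simp] val_lift_push [simp]


section \<open>Real numbers in a model\<close>

abbreviation app1 :: "'n \<Rightarrow> 'n \<Rightarrow> 'n"  (infixl "$" 90) where "x $ n \<equiv> ap M N N x n"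
abbreviation app2 :: "'n \<Rightarrow> 'n \<Rightarrow> 'n"  (infixl "$$" 90) where "F $$ x \<equiv> ap M ty1 ty1 F x"

definition rv :: "'n \<Rightarrow> 'n \<Rightarrow> 'n dint fract" where "rv x k = qv (x $ k)"

definition isreal :: "'n \<Rightarrow> bool" where
  "isreal x \<longleftrightarrow> (\<forall>n i. \<bar>rv x n - rv x (n + i)\<bar> < hp n)"
definition req :: "'n \<Rightarrow> 'n \<Rightarrow> bool" where
  "req x y \<longleftrightarrow> (\<forall>n. \<bar>rv x n - rv y n\<bar> \<le> hp n + hp n)"
definition rless :: "'n \<Rightarrow> 'n \<Rightarrow> bool" where
  "rless x y \<longleftrightarrow> (\<exists>n. rv x n + (hp n + hp n) < rv y n)"

definition rofq :: "'n \<Rightarrow> 'n" where "rofq q = Lam N N (\<lambda>k. q)"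
definition radd :: "'n \<Rightarrow> 'n \<Rightarrow> 'n" where "radd x y = Lam N N (\<lambda>k. nadd (x $ (k + 1)) (y $ (k + 1)))"
definition rminus :: "'n \<Rightarrow> 'n" where "rminus x = Lam N N (\<lambda>k. numinus (x $ k))"
definition rabs :: "'n \<Rightarrow> 'n" where "rabs x = Lam N N (\<lambda>k. nabs (x $ k))"

lemma is_real [simp]:
  assumes "ty_of t = Some ty1"
  shows "sat M e (is_real t) \<longleftrightarrow> isreal (val M e t)"
  using assms by (simp_all add: is_real_def isreal_def rv_def Let_def)

lemma r_eq [simp]:
  assumes "ty_of s = Some ty1" "ty_of t = Some ty1"
  shows "sat M e (s =\<^sub>R t) \<longleftrightarrow> req (val M e s) (val M e t)"
  using assms by (simp_all add: r_eq_def req_def rv_def Let_def)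

lemma r_less [simp]:
  assumes "ty_of s = Some ty1" "ty_of t = Some ty1"
  shows "sat M e (s <\<^sub>R t) \<longleftrightarrow> rless (val M e s) (val M e t)"
  using assms by (simp_all add: r_less_def rless_def rv_def Let_def)

lemma r_of_q [simp]:
  assumes "ty_of q = Some N"
  shows "val M e (r_of_q q) = rofq (val M e q)"
proof -
  show "val M e (r_of_q q) = rofq (val M e q)"
    unfolding rofq_def by (rule Lam_eqI) (use assms in \<open>simp add: r_of_q_def\<close>)
qed

lemma r_add [simp]:
  assumes "ty_of x = Some ty1" "ty_of y = Some ty1"
  shows "val M e (x +\<^sub>R y) = radd (val M e x) (val M e y)"
proof -
  show "val M e (x +\<^sub>R y) = radd (val M e x) (val M e y)"
    unfolding radd_def by (rule Lam_eqI) (use assms in \<open>simp add: r_add_def Let_def\<close>)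
qed

lemma r_minus [simp]:
  assumes "ty_of x = Some ty1"
  shows "val M e (r_minus x) = rminus (val M e x)"
proof -
  show "val M e (r_minus x) = rminus (val M e x)"
    unfolding rminus_def by (rule Lam_eqI) (use assms in \<open>simp add: r_minus_def\<close>)
qed

lemma r_abs [simp]:
  assumes "ty_of x = Some ty1"
  shows "val M e (r_abs x) = rabs (val M e x)"
proof -
  show "val M e (r_abs x) = rabs (val M e x)"
    unfolding rabs_def by (rule Lam_eqI) (use assms in \<open>simp add: r_abs_def\<close>)
qed

lemma Rp_nrat: "Rp \<Gamma> N F \<Longrightarrow> Rp \<Gamma> N G \<Longrightarrow> Rp \<Gamma> N H \<Longrightarrow> Rp \<Gamma> N (\<lambda>c. nrat (F c) (G c) (H c))"
  unfolding nrat_def by (intro Rp_npair)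

lemma Rp_parts:
  "Rp \<Gamma> N F \<Longrightarrow> Rp \<Gamma> N (\<lambda>c. npos (F c))" "Rp \<Gamma> N F \<Longrightarrow> Rp \<Gamma> N (\<lambda>c. nneg (F c))"
  "Rp \<Gamma> N F \<Longrightarrow> Rp \<Gamma> N (\<lambda>c. nden (F c))"
  unfolding npos_def nneg_def nden_def by (intro Rp_nfirst Rp_nsecond Rp_add Rp_const; assumption)+

lemma Rp_nadd: "Rp \<Gamma> N F \<Longrightarrow> Rp \<Gamma> N G \<Longrightarrow> Rp \<Gamma> N (\<lambda>c. nadd (F c) (G c))"
  unfolding nadd_def by (intro Rp_nrat Rp_parts Rp_add Rp_mult Rp_minus Rp_const)

lemma Rp_numinus: "Rp \<Gamma> N F \<Longrightarrow> Rp \<Gamma> N (\<lambda>c. numinus (F c))"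
  unfolding numinus_def by (intro Rp_nrat Rp_parts Rp_nsecond)

lemma Rp_nabs: "Rp \<Gamma> N F \<Longrightarrow> Rp \<Gamma> N (\<lambda>c. nabs (F c))"
  unfolding nabs_def by (intro Rp_nrat Rp_parts Rp_nsecond Rp_add Rp_minus Rp_const)

lemma Rp_nhalf: "Rp \<Gamma> N F \<Longrightarrow> Rp \<Gamma> N (\<lambda>c. nhalf (F c))"
  unfolding nhalf_def by (rule Rp_nrat Rp1 | assumption | simp)+

lemma dec_qless: "Rp \<Gamma> N F \<Longrightarrow> Rp \<Gamma> N G \<Longrightarrow> dec \<Gamma> (\<lambda>c. qv (F c) < qv (G c))"
  unfolding nless_iff[symmetric] nless_def by (intro dec_less Rp_add Rp_mult Rp_parts)

lemma dec_qle: "Rp \<Gamma> N F \<Longrightarrow> Rp \<Gamma> N G \<Longrightarrow> dec \<Gamma> (\<lambda>c. qv (F c) \<le> qv (G c))"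
  unfolding not_less[symmetric] by (intro dec_not dec_qless)

lemmas Rp_rules = Rp1 Rp_nfirst Rp_nsecond Rp_npair Rp_nrat Rp_nadd Rp_numinus Rp_nabs Rp_nhalf
lemmas dec_all = dec_rules dec_qless dec_qle

lemma rp_real_ops: "rp N N (\<lambda>k. q)" "rp N N (\<lambda>k. nadd (x $ (k + 1)) (y $ (k + 1)))"
  "rp N N (\<lambda>k. numinus (x $ k))" "rp N N (\<lambda>k. nabs (x $ k))"
  by (rule rpI, (rule Rp_rules | simp)+)+

lemma rv_simps [simp]:
  "rv (rofq q) k = qv q" "rv (radd x y) k = rv x (k + 1) + rv y (k + 1)"
  "rv (rminus x) k = - rv x k" "rv (rabs x) k = \<bar>rv x k\<bar>"
  by (simp_all add: rv_def rofq_def radd_def rminus_def rabs_def ap_Lam rp_real_ops)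

lemma hp_antimono: "hp (n + i) \<le> hp n"
proof (rule dec_induct[of "\<lambda>i. hp (n + i) \<le> hp n"])
  show "dec [N] (\<lambda>c. hp (n + c 0) \<le> hp n)"
    unfolding hp_def by (rule dec_all Rp_rules | simp del: hp_def[symmetric])+
  fix i assume "hp (n + i) \<le> hp n"
  then have "hp (n + i + 1) \<le> hp n" using hp_simps(2)[of "n + i"] hp_pos[of "n + i"] by linarith
  then show "hp (n + (i + 1)) \<le> hp n" by (simp only: add.assoc)
qed simp

lemma hp_mono: "m \<le> n \<Longrightarrow> hp n \<le> hp m"
  using hp_antimono[of m "n - m"] by (simp add: add.commute)

text \<open>The recursion in \<open>nhalf\<close> computes 2^n - 1, which is at least
  \<open>n\<close>.\<close>

lemma hp_le_inverse: "hp n * (emb n + 1) \<le> 1"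
proof -
  define p where "p = prec 0 (\<lambda>n h. h + h + 1)"
  have R: "Rp [N, N] N (\<lambda>c. c 0 + c 0 + 1)" by (rule Rp1 | simp)+
  have p: "p 0 = 0" "p (n + 1) = p n + p n + 1" for n
    unfolding p_def by (rule prec_0[OF R], rule prec_Suc[OF R])
  have "n \<le> p n"
  proof (rule dec_induct[of "\<lambda>n. n \<le> p n"])
    show "dec [N] (\<lambda>c. c 0 \<le> p (c 0))" unfolding p_def by (rule dec_all Rp_rules | simp)+
    fix n assume "n \<le> p n"
    then show "n + 1 \<le> p (n + 1)" using add_mono[OF \<open>n \<le> p n\<close> nonneg[of "p n"]] p by simp
  qed (simp add: p)
  moreover have "hp n = 1 / (emb (p n) + 1)" by (simp add: hp_def nhalf_def qv_nrat p_def del: hp_def[symmetric])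
  moreover have "0 < emb (p n) + 1" by (simp add: add_nonneg_pos)
  ultimately have "hp n * (emb (p n) + 1) = 1" "emb n + 1 \<le> emb (p n) + 1" by (simp_all add: field_simps)
  then show ?thesis using mult_left_mono[of "emb n + 1" "emb (p n) + 1" "hp n"] by (simp add: less_imp_le)
qed

text \<open>The field need not be archimedean in the usual sense, but a positive element is at least
  1 / (c + 1) for some number \<open>c\<close> of the model, and \<open>hp (c + 1)\<close> is below
  that.\<close>

lemma hp_archimedean:
  assumes "0 < (q :: 'n dint fract)"
  obtains n where "hp n < q"
proof -
  obtain a b c where q: "q = (emb a - emb b) / (emb c + 1)" by (rule fract_cases)
  have c: "0 < emb c + 1" by (simp add: add_nonneg_pos)
  then have "b < a" using assms by (simp add: q zero_less_divide_iff)
  then have "emb (b + 1) \<le> emb a" by (simp add: add_one_le_iff del: emb_simps(3))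
  then have "1 \<le> emb a - emb b" by simp
  then have le: "1 / (emb c + 1) \<le> q" unfolding q using c by (intro divide_right_mono) auto
  have "hp (c + 1) * (emb (c + 1) + 1) \<le> 1" by (rule hp_le_inverse)
  moreover have "hp (c + 1) * (emb (c + 1) + 1) = hp (c + 1) * (emb c + 1) + hp (c + 1)"
    by (simp add: algebra_simps)
  ultimately have "hp (c + 1) * (emb c + 1) < 1" using hp_pos[of "c + 1"] by linarith
  then have "hp (c + 1) < 1 / (emb c + 1)" using c by (simp add: field_simps)
  with le have "hp (c + 1) < q" by linarith
  then show ?thesis by (rule that)
qed

section \<open>Intervals, balls and the principles as seen in the model\<close>

definition inint :: "'n \<Rightarrow> 'n \<Rightarrow> 'n \<Rightarrow> bool" where
  "inint x a b \<longleftrightarrow> \<not> req a (radd a (rabs b)) \<and> rless a x \<and> rless x (radd a (rabs b))"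

definition inopen :: "'n \<Rightarrow> 'n \<Rightarrow> 'n \<Rightarrow> bool" where
  "inopen x p q \<longleftrightarrow> (\<exists>y. isreal y \<and> inint x (p $$ y) (q $$ y))"

definition cen :: "'n \<Rightarrow> 'n dint fract" where "cen n = qv (nfirst n)"
definition rad :: "'n \<Rightarrow> 'n dint fract" where
  "rad n = qv (nrat (nfirst (nsecond n) + 1) 0 (nsecond (nsecond n)))"

text \<open>The index \<open>k + 1\<close> comes from addition of reals, which reads its arguments
  one place further on.\<close>

definition inball :: "'n \<Rightarrow> 'n \<Rightarrow> bool" where
  "inball x n \<longleftrightarrow> (\<exists>k. \<bar>rv x (k + 1) - cen n\<bar> + (hp k + hp k) < rad n)"

definition realfun :: "'n \<Rightarrow> bool" where
  "realfun F \<longleftrightarrow> (\<forall>x. isreal x \<longrightarrow> isreal (F $$ x)) \<and>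
     (\<forall>x y. isreal x \<and> isreal y \<and> req x y \<longrightarrow> req (F $$ x) (F $$ y))"

definition isset :: "'n \<Rightarrow> bool" where
  "isset X \<longleftrightarrow> (\<forall>n. X $ n = 0 \<or> X $ n = 1)"

definition boot :: bool where
  "boot \<longleftrightarrow> (\<forall>Y. \<exists>X. isset X \<and> (\<forall>n. X $ n = 1 \<longleftrightarrow> (\<exists>f. Y $$ f $ n = 0)))"

definition openplus :: bool where
  "openplus \<longleftrightarrow> (\<forall>p q. realfun p \<and> realfun q \<longrightarrow> (\<exists>X. isset X \<and>
     (\<forall>n. X $ n = 1 \<longleftrightarrow> (\<forall>x. isreal x \<longrightarrow> inball x n \<longrightarrow> inopen x p q))))"

lemma in_open [simp]:
  assumes "ty_of x = Some ty1" "ty_of p = Some (ty1 \<rightarrow> ty1)" "ty_of q = Some (ty1 \<rightarrow> ty1)"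
  shows "sat M e (in_open x p q) \<longleftrightarrow> inopen (val M e x) (val M e p) (val M e q)"
  using assms by (simp_all add: in_open_def in_interval_def inopen_def inint_def Let_def conj_ac)

lemma in_ball [simp]:
  assumes "ty_of x = Some ty1" "ty_of n = Some N"
  shows "sat M e (in_ball x n) \<longleftrightarrow> inball (val M e x) (val M e n)"
  using assms by (simp_all add: in_ball_def inball_def ball_centre_def ball_radius_def rless_def cen_def rad_def)

lemma is_real_function [simp]:
  assumes "ty_of F = Some (ty1 \<rightarrow> ty1)"
  shows "sat M e (is_real_function F) \<longleftrightarrow> realfun (val M e F)"
  using assms by (auto simp: is_real_function_def realfun_def Let_def)

lemma is_set [simp]:
  assumes "ty_of X = Some ty1"
  shows "sat M e (is_set X) \<longleftrightarrow> isset (val M e X)"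
  using assms by (auto simp: is_set_def isset_def)

lemma sat_BOOT: "sat M e BOOT \<longleftrightarrow> boot"
  by (simp add: BOOT_def boot_def mem_def Let_def, (rule all_cong1 ex_cong1 conj_cong refl)+, blast)

lemma sat_open_plus: "sat M e open_plus \<longleftrightarrow> openplus"
  by (simp add: open_plus_def openplus_def mem_def Let_def ball_subset_open_def,
      (rule all_cong1 ex_cong1 conj_cong imp_cong refl)+, blast)

end

section \<open>Arithmetical comprehension\<close>

lemma val_cong: "(\<And>\<rho> i. (\<rho>, i) \<in> fv_tm t \<Longrightarrow> e \<rho> i = e' \<rho> i) \<Longrightarrow> val M e t = val M e' t"
  by (induction t) (simp_all cong: option.case_cong ty.case_cong)

lemma sat_cong: "(\<And>\<rho> i. (\<rho>, i) \<in> fv A \<Longrightarrow> e \<rho> i = e' \<rho> i) \<Longrightarrow> sat M e A = sat M e' A"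
proof (induction A arbitrary: e e')
  case (Eq s t)
  then have "val M e s = val M e' s" "val M e t = val M e' t" by (auto intro: val_cong)
  then show ?case by simp
next
  case (Less s t)
  then have "val M e s = val M e' s" "val M e t = val M e' t" by (auto intro: val_cong)
  then show ?case by simp
next
  case (Imp A B)
  have "sat M e A = sat M e' A" "sat M e B = sat M e' B"
    by (rule Imp.IH, rule Imp.prems, simp)+
  then show ?case by simp
next
  case (All \<rho> A)
  have "sat M (push \<rho> x e) A = sat M (push \<rho> x e') A" for x
  proof (rule All.IH)
    fix \<sigma> i assume i: "(\<sigma>, i) \<in> fv A"
    show "push \<rho> x e \<sigma> i = push \<rho> x e' \<sigma> i"
    proof (cases "\<sigma> = \<rho> \<and> i = 0")
      case False
      then have "(\<sigma>, i) = bind \<rho> (\<sigma>, if \<sigma> = \<rho> then i - 1 else i)" by (auto simp: bind_def)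
      then show ?thesis using i All.prems[of \<sigma> "if \<sigma> = \<rho> then i - 1 else i"]
        by (auto simp: push_def split: nat.split)
    qed auto
  qed
  then show ?case by simp
qed simp

context rca_model
begin

declare Rp.simps [simp del]

lemma dec_comp: "dec [N] (\<lambda>c. Q (c 0)) \<Longrightarrow> Rp \<Gamma> N F \<Longrightarrow> dec \<Gamma> (\<lambda>c. Q (F c))"
  unfolding dec_def by (rule Rp_rp[of N N "\<lambda>n. if Q n then 1 else 0"]) (rule rpI)

lemma dec_iff_set: "dec [N] (\<lambda>c. Q (c 0)) \<longleftrightarrow> (\<exists>X. isset X \<and> (\<forall>n. X $ n = 1 \<longleftrightarrow> Q n))"
proof
  assume "dec [N] (\<lambda>c. Q (c 0))"
  then have "rp N N (\<lambda>n. if Q n then 1 else 0)" unfolding dec_def by (rule rpI)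
  then obtain X where "\<And>n. X $ n = (if Q n then 1 else 0)" unfolding rp_def by blast
  then have "isset X \<and> (\<forall>n. X $ n = 1 \<longleftrightarrow> Q n)" by (simp add: isset_def)
  then show "\<exists>X. isset X \<and> (\<forall>n. X $ n = 1 \<longleftrightarrow> Q n)" ..
next
  assume "\<exists>X. isset X \<and> (\<forall>n. X $ n = 1 \<longleftrightarrow> Q n)"
  then obtain X where X: "isset X" "\<And>n. X $ n = 1 \<longleftrightarrow> Q n" by blast
  have "dec [N] (\<lambda>c. X $ c 0 = 1)" by (rule dec_all Rp_rules | simp)+
  then show "dec [N] (\<lambda>c. Q (c 0))" by (simp add: X)
qed

text \<open>The form in which \<open>BOOT\<close> is used: decidability survives an existential
  quantifier over functions, as long as only one number variable remains.\<close>

lemma boot_dec: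
  assumes "boot" "dec [N, ty1] (\<lambda>c. P (c (Suc 0)) (c 0))"
  shows "dec [N] (\<lambda>c. \<exists>f. P f (c 0))"
proof -
  define Y where "Y = Lam ty1 ty1 (\<lambda>f. Lam N N (\<lambda>n. if P f n then 0 else 1))"
  have "Rp [N, ty1] N (\<lambda>c. if P (c (Suc 0)) (c 0) then 0 else 1)"
    using assms(2) by (intro Rp_if Rp_const)
  then have Y: "Y $$ f $ n = (if P f n then 0 else 1)" for f n
    unfolding Y_def by (rule ap_Lam2)
  obtain X where "isset X" "\<And>n. X $ n = 1 \<longleftrightarrow> (\<exists>f. Y $$ f $ n = 0)"
    using assms(1) unfolding boot_def by blast
  then have "isset X \<and> (\<forall>n. X $ n = 1 \<longleftrightarrow> (\<exists>f. P f n))" by (simp add: Y)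
  then show ?thesis unfolding dec_iff_set[of "\<lambda>n. \<exists>f. P f n"] ..
qed

text \<open>A number quantifier is a function quantifier that looks only at the first value;
  constant functions provide all numbers.\<close>

lemma boot_dec_ex:
  assumes "boot" "dec [N, N] (\<lambda>c. P (c (Suc 0)) (c 0))"
  shows "dec [N] (\<lambda>c. \<exists>m. P m (c 0))"
proof -
  have "Rp [N, N] N (\<lambda>c. if P (c (Suc 0)) (c 0) then 1 else 0)" using assms(2) by (simp add: dec_def)
  then have "Rp [N, ty1] N (\<lambda>c. if P (c (Suc 0) $ 0) (c 0) then 1 else 0)"
    by (rule Rp_rp2) (rule Rp_rules | simp)+
  then have "dec [N, ty1] (\<lambda>c. P (c (Suc 0) $ 0) (c 0))" by (simp add: dec_def)
  from boot_dec[OF assms(1), of "\<lambda>f. P (f $ 0)", OF this]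
  have *: "dec [N] (\<lambda>c. \<exists>f. P (f $ 0) (c 0))" .
  have "(\<exists>f. P (f $ 0) n) \<longleftrightarrow> (\<exists>m. P m n)" for n
    using ap_Lam[OF rp_const, of N N _ 0] by metis
  then show ?thesis using * by simp
qed

text \<open>The number variables are evaluated by the components of an iterated pair, so that a
  formula with several number variables still defines a set of numbers.\<close>

definition seq_env :: "(ty \<Rightarrow> nat \<Rightarrow> 'n) \<Rightarrow> 'n \<Rightarrow> ty \<Rightarrow> nat \<Rightarrow> 'n" where
  "seq_env e n = (\<lambda>\<rho> i. if \<rho> = N then nfirst ((nsecond ^^ i) n) else e \<rho> i)"

text \<open>This is why variables are read off iterated second components: binding one more variable
  amounts to a single pairing.\<close>

lemma push_seq_env: "push N m (seq_env e n) = seq_env e (npair m n)"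
proof (intro HOL.ext)
  fix \<rho> i
  show "push N m (seq_env e n) \<rho> i = seq_env e (npair m n) \<rho> i"
    by (cases i) (auto simp: push_def seq_env_def funpow_swap1 split: nat.split)
qed

lemma Rp_seq_env: "ty_of t = Some \<tau> \<Longrightarrow> Rp [N] \<tau> (\<lambda>c. val M (seq_env e (c 0)) t)"
proof (induction t arbitrary: \<tau>)
  case (Var \<rho> i)
  have "Rp [N] N (\<lambda>c. (nsecond ^^ i) (c 0))"
    by (induction i) (auto intro: Rp_nsecond Rp_var[of 0, simplified])
  then show ?case using Var by (cases "\<rho> = N") (auto simp: seq_env_def intro: Rp_nfirst Rp_const)
next
  case (Con c)
  then show ?case by (auto intro: Rp_const)
next
  case (App s t)
  then obtain \<sigma> where "ty_of s = Some (\<sigma> \<rightarrow> \<tau>)" "ty_of t = Some \<sigma>"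
    by (auto split: option.splits ty.splits if_splits)
  then show ?case using App.IH by (auto intro: Rp_ap)
qed

text \<open>Each quantifier costs one use of \<open>BOOT\<close>, with the universal one treated as
  a negated existential one. Keeping all number variables in one code makes the induction hypothesis
  a statement about sets of numbers.\<close>

lemma boot_arithmetical:
  assumes boot
  shows "arithmetical A \<Longrightarrow> wf_fm A \<Longrightarrow> dec [N] (\<lambda>c. sat M (seq_env e (c 0)) A)"
proof (induction A)
  case (Eq s t)
  then show ?case by (auto intro!: dec_eq Rp_seq_env)
next
  case (Less s t)
  then show ?case by (auto intro!: dec_less Rp_seq_env)
next
  case Bot
  then show ?case by (simp only: sat.simps) (rule dec_const)
next
  case (Imp A B)
  then show ?case by (simp only: sat.simps) (intro dec_imp, simp_all)
next
  case (All \<rho> A)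
  have IH: "dec [N] (\<lambda>c. sat M (seq_env e (c 0)) A)" using All by simp
  have "Rp [N, N] N (\<lambda>c. npair (c (Suc 0)) (c 0))" by (rule Rp_rules | simp)+
  then have "dec [N, N] (\<lambda>c. \<not> sat M (seq_env e (npair (c (Suc 0)) (c 0))) A)"
    by (rule dec_not[OF dec_comp[of "\<lambda>n. sat M (seq_env e n) A", OF IH]])
  from dec_not[OF boot_dec_ex[OF assms, of "\<lambda>m n. \<not> sat M (seq_env e (npair m n)) A", OF this]]
  show ?case using All.prems by (simp add: push_seq_env)
qed

text \<open>Here \<open>k\<close> is a number of the metatheory. A formula has only finitely many
  number parameters, and \<open>boot_ACA0\<close> stores them in such a code.\<close>

lemma seq_code: "\<exists>p. \<forall>i<k. nfirst ((nsecond ^^ i) p) = g i"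
proof (induction k arbitrary: g)
  case (Suc k)
  from Suc[of "\<lambda>i. g (Suc i)"] obtain p where "\<And>i. i < k \<Longrightarrow> nfirst ((nsecond ^^ i) p) = g (Suc i)" by blast
  then have "nfirst ((nsecond ^^ i) (npair (g 0) p)) = g i" if "i < Suc k" for i
    using that by (cases i) (simp_all add: funpow_swap1)
  then show ?case by blast
qed simp

lemma boot_ACA0:
  assumes boot "arithmetical A" "wf_fm A"
  shows "sat M e (Ex ty1 (is_set (Var ty1 0) \<andand> All N (mem (Var N 0) (Var ty1 0) \<leftrightarrow> lift_fm ty1 0 A)))"
proof -
  have "finite (snd ` fv A)" using finite_fv by (rule finite_imageI)
  then obtain k where k: "\<forall>i\<in>snd ` fv A. i \<le> k" unfolding finite_nat_set_iff_bounded_le by blast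
  obtain p where p: "\<And>i. i < k \<Longrightarrow> nfirst ((nsecond ^^ i) p) = e N i" using seq_code[of k "e N"] by blast
  have "sat M (push N n e) A = sat M (seq_env e (npair n p)) A" for n
  proof (rule sat_cong)
    fix \<rho> i assume "(\<rho>, i) \<in> fv A"
    then have "i \<le> k" using k by force
    then show "push N n e \<rho> i = seq_env e (npair n p) \<rho> i"
      unfolding push_seq_env[symmetric] by (cases i) (auto simp: push_def seq_env_def p)
  qed
  moreover have "dec [N] (\<lambda>c. sat M (seq_env e (npair (c 0) p)) A)"
    by (rule dec_comp[of "\<lambda>n. sat M (seq_env e n) A"], rule boot_arithmetical[OF assms]) (rule Rp_rules | simp)+
  ultimately have "dec [N] (\<lambda>c. sat M (push N (c 0) e) A)" by simp
  then obtain X where "isset X" "\<And>n. X $ n = 1 \<longleftrightarrow> sat M (push N n e) A"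
    unfolding dec_iff_set[of "\<lambda>n. sat M (push N n e) A"] by blast
  then show ?thesis by (auto simp: mem_def push_commute[of N ty1] sat_lift_push intro!: exI[of _ X])
qed


section \<open>Functionals that are approximated by finite sequences\<close>

lemma diff_diff_cancel_le: "a \<le> k \<Longrightarrow> k - (k - a) = (a :: 'n)"
  by (metis add_diff_cancel_left' le_add_diff_inverse2)

text \<open>\<open>P\<close> may involve parameters of higher type, which arithmetical formulas
  exclude. They disappear in the function \<open>g\<close>, the characteristic function of
  \<open>P\<close> on coded pairs.\<close>

lemma ACA0_dec_ex:
  assumes aca: "\<And>A e. A \<in> ACA0 \<Longrightarrow> wf_fm A \<Longrightarrow> sat M e A"
    and P: "dec [N, N] (\<lambda>c. P (c (Suc 0)) (c 0))"
  shows "dec [N] (\<lambda>c. \<exists>m. P m (c 0))"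
proof -
  have "Rp [N, N] N (\<lambda>c. if P (c (Suc 0)) (c 0) then 1 else 0)" using P by (simp add: dec_def)
  then have "Rp [N] N (\<lambda>c. if P (nfirst (c 0)) (nsecond (c 0)) then 1 else 0)"
    by (rule Rp_rp2) (rule Rp_rules | simp)+
  then have "rp N N (\<lambda>k. if P (nfirst k) (nsecond k) then 1 else 0)" by (rule rpI)
  then obtain g where g: "\<And>k. g $ k = (if P (nfirst k) (nsecond k) then 1 else 0)" unfolding rp_def by blast
  have "rp N N nsecond" by (rule rpI) (rule Rp_rules | simp)+
  then obtain h where h: "\<And>k. h $ k = nsecond k" unfolding rp_def by blast
  let ?A = "Ex N (Var ty1 0 \<cdot> Var N 0 \<doteq> One \<andand> Var ty1 1 \<cdot> Var N 0 \<doteq> Var N 1)"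
  let ?B = "Ex ty1 (is_set (Var ty1 0) \<andand> All N (mem (Var N 0) (Var ty1 0) \<leftrightarrow> lift_fm ty1 0 ?A))"
  have "?B \<in> ACA0" unfolding ACA0_def by (rule CollectI, rule exI[of _ ?A]) simp
  moreover have "wf_fm ?B" by (simp add: mem_def)
  ultimately have "sat M (\<lambda>\<sigma> i. if i = 0 then g else h) ?B" by (rule aca)
  then obtain X where "isset X" "\<And>n. X $ n = 1 \<longleftrightarrow> (\<exists>k. g $ k = 1 \<and> h $ k = n)"
    by (auto simp: mem_def)
  moreover have "(\<exists>k. g $ k = 1 \<and> h $ k = n) \<longleftrightarrow> (\<exists>m. P m n)" for n
    unfolding g h by (metis npair_simps zero_neq_one)
  ultimately have "isset X \<and> (\<forall>n. X $ n = 1 \<longleftrightarrow> (\<exists>m. P m n))" by simp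
  then show ?thesis unfolding dec_iff_set[of "\<lambda>n. \<exists>m. P m n"] ..
qed

section \<open>Finite sequences as numbers\<close>

definition restr :: "'n \<Rightarrow> 'n \<Rightarrow> 'n" where
  "restr f k = Lam N N (\<lambda>i. if i < k then f $ i else 0)"

definition drop_seq :: "'n \<Rightarrow> 'n \<Rightarrow> 'n" where
  "drop_seq s j = prec s (\<lambda>_ h. nsecond h) j"

definition code_seq :: "'n \<Rightarrow> 'n \<Rightarrow> 'n" where
  "code_seq f k = prec 0 (\<lambda>j s. npair (f $ j) s) k"

text \<open>Finite sequences are coded as nested pairs, last entry first.\<close>

definition decode_seq :: "'n \<Rightarrow> 'n" where
  "decode_seq p = Lam N N (\<lambda>i. if i < nfirst p then nfirst (drop_seq (nsecond p) (nfirst p - (i + 1))) else 0)"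

lemma drop_seq_simps: "drop_seq s 0 = s" "drop_seq s (j + 1) = nsecond (drop_seq s j)"
  unfolding drop_seq_def by (subst prec_0 prec_Suc; (rule Rp_rules | simp)+)+

lemma code_seq_simps: "code_seq f 0 = 0" "code_seq f (k + 1) = npair (f $ k) (code_seq f k)"
  unfolding code_seq_def by (subst prec_0 prec_Suc; (rule Rp_rules | simp)+)+

lemma drop_code_seq: "j \<le> k \<Longrightarrow> drop_seq (code_seq f k) j = code_seq f (k - j)"
proof -
  have "j \<le> k \<longrightarrow> drop_seq (code_seq f k) j = code_seq f (k - j)"
  proof (rule dec_induct[of "\<lambda>j. j \<le> k \<longrightarrow> drop_seq (code_seq f k) j = code_seq f (k - j)"])
    show "dec [N] (\<lambda>c. c 0 \<le> k \<longrightarrow> drop_seq (code_seq f k) (c 0) = code_seq f (k - c 0))"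
      unfolding drop_seq_def code_seq_def by (rule dec_all Rp_rules | simp)+
    fix j assume IH: "j \<le> k \<longrightarrow> drop_seq (code_seq f k) j = code_seq f (k - j)"
    show "j + 1 \<le> k \<longrightarrow> drop_seq (code_seq f k) (j + 1) = code_seq f (k - (j + 1))"
    proof
      assume le: "j + 1 \<le> k"
      then have "k = (k - (j + 1)) + 1 + j" by (simp add: add.assoc add.commute[of 1])
      then have "k - j = (k - (j + 1)) + 1" by (metis add_diff_cancel_right')
      moreover have "j \<le> k" using le by (meson less_add_one less_imp_le order_trans)
      ultimately show "drop_seq (code_seq f k) (j + 1) = code_seq f (k - (j + 1))"
        using IH by (simp add: drop_seq_simps code_seq_simps)
    qed
  qed (simp add: drop_seq_simps)
  then show "j \<le> k \<Longrightarrow> ?thesis" by simp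
qed

lemma decode_code_seq: "decode_seq (npair k (code_seq f k)) = restr f k"
proof -
  \<comment> \<open>As the last entry is outermost, entry \<open>i\<close> of a sequence of length
    \<open>k\<close> lies at depth \<open>k - (i + 1)\<close>.\<close>
  have "(if i < k then nfirst (drop_seq (code_seq f k) (k - (i + 1))) else 0) = (if i < k then f $ i else 0)" for i
  proof (cases "i < k")
    case True
    then have le: "i + 1 \<le> k" by (rule less_imp_add_one_le)
    moreover have "k - (i + 1) \<le> k" using le nonneg[of "i + 1"]
      by (metis add_increasing2 le_add_diff_inverse2 order_refl)
    ultimately show ?thesis using True by (simp add: drop_code_seq diff_diff_cancel_le code_seq_simps)
  qed simp
  then show ?thesis by (simp only: decode_seq_def restr_def npair_simps)
qed

text \<open>A zero may be taken to be a finite sequence continued by zeros. The quantifier over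
  functions thus becomes one over codes, which is a matter of arithmetical comprehension.\<close>

lemma dec_approximated:
  assumes aca: "\<And>A e. A \<in> ACA0 \<Longrightarrow> wf_fm A \<Longrightarrow> sat M e A"
    and Y: "\<And>n f. Y $$ f $ n = 0 \<Longrightarrow> \<exists>k. Y $$ restr f k $ n = 0"
  shows "dec [N] (\<lambda>c. \<exists>f. Y $$ f $ c 0 = 0)"
proof -
  have "dec [N, N] (\<lambda>c. Y $$ decode_seq (c (Suc 0)) $ c 0 = 0)"
    unfolding decode_seq_def drop_seq_def by (rule dec_all Rp_rules | simp)+
  from ACA0_dec_ex[OF aca, of "\<lambda>p n. Y $$ decode_seq p $ n = 0", OF _ _ this]
  have "dec [N] (\<lambda>c. \<exists>p. Y $$ decode_seq p $ c 0 = 0)" by simp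
  moreover have "(\<exists>p. Y $$ decode_seq p $ n = 0) \<longleftrightarrow> (\<exists>f. Y $$ f $ n = 0)" for n
    using Y decode_code_seq by metis
  ultimately show ?thesis by simp
qed


section \<open>A discontinuous functional decides number quantifiers\<close>

text \<open>A bounded quantifier evaluated by recursion, which keeps \<open>trunc\<close>
  representable.\<close>

definition no_zero :: "'n \<Rightarrow> 'n \<Rightarrow> 'n" where
  "no_zero g i = prec 1 (\<lambda>j v. if g $ j = 0 then 0 else v) i"

definition trunc :: "'n \<Rightarrow> 'n \<Rightarrow> 'n" where
  "trunc f g = Lam N N (\<lambda>i. if no_zero g (i + 1) = 1 then f $ i else 0)"

lemma no_zero_simps: "no_zero g 0 = 1" "no_zero g (i + 1) = (if g $ i = 0 then 0 else no_zero g i)"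
  unfolding no_zero_def by (subst prec_0 prec_Suc; (rule dec_all Rp_rules | simp)+)+

lemma trunc_nonzero:
  assumes "\<And>i. g $ i \<noteq> 0"
  shows "trunc f g = f"
proof -
  have "no_zero g i = 1" for i
  proof (rule dec_induct[of "\<lambda>i. no_zero g i = 1"])
    show "dec [N] (\<lambda>c. no_zero g (c 0) = 1)" unfolding no_zero_def by (rule dec_all Rp_rules | simp)+
  qed (use assms in \<open>simp_all add: no_zero_simps\<close>)
  then show ?thesis by (simp add: trunc_def)
qed

lemma trunc_zero:
  assumes "g $ m = 0"
  shows "\<exists>k. trunc f g = restr f k"
proof -
  have D: "dec [N] (\<lambda>c. no_zero g (c 0) = 1)" "dec [N] (\<lambda>c. no_zero g (i + c 0) = 0)" for i
    unfolding no_zero_def by (rule dec_all Rp_rules | simp)+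
  \<comment> \<open>The first zero of \<open>g\<close>. If no index had both properties, induction
    would keep \<open>no_zero g\<close> at 1 throughout, contrary to the zero at
    \<open>m\<close>.\<close>
  obtain k where k: "no_zero g k = 1" "g $ k = 0"
  proof (rule ccontr)
    assume "\<not> thesis"
    then have *: "no_zero g k = 1 \<Longrightarrow> g $ k \<noteq> 0" for k using that by blast
    have "no_zero g i = 1" for i
      by (rule dec_induct[of "\<lambda>i. no_zero g i = 1", OF D(1)]) (use * in \<open>simp_all add: no_zero_simps\<close>)
    then show False using * assms by blast
  qed
  have zero: "no_zero g (i + j) = 0" if "no_zero g i = 0" for i j
    by (rule dec_induct[of "\<lambda>j. no_zero g (i + j) = 0", OF D(2)])
      (use that in \<open>simp_all add: no_zero_simps add.assoc[symmetric]\<close>)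
  have "no_zero g (i + 1) = 1 \<longleftrightarrow> i < k" for i
  proof (cases "i < k")
    case True
    have "no_zero g (i + 1) = 0 \<or> no_zero g (i + 1) = 1"
    proof -
      have "no_zero g l = 0 \<or> no_zero g l = 1" for l
        by (rule dec_induct[of "\<lambda>l. no_zero g l = 0 \<or> no_zero g l = 1"],
            unfold no_zero_def, (rule dec_all Rp_rules | simp)+, fold no_zero_def, auto simp: no_zero_simps)
      then show ?thesis .
    qed
    moreover have "k = i + 1 + (k - (i + 1))"
      using True by (metis add.commute le_add_diff_inverse2 less_imp_add_one_le)
    ultimately show ?thesis using zero[of "i + 1" "k - (i + 1)"] k(1) True by auto
  next
    case False
    then have "i + 1 = k + 1 + (i - k)" by (metis add.assoc add.commute le_add_diff_inverse2 not_less)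
    then show ?thesis using zero[of "k + 1" "i - k"] k False by (simp add: no_zero_simps)
  qed
  then show ?thesis by (auto simp: trunc_def restr_def)
qed

text \<open>The existence of Kleene's functional (\<exists>^2), up to the choice of the values that
  stand for yes and no.\<close>

definition decides_ex :: bool where
  "decides_ex \<longleftrightarrow> (\<exists>E. \<forall>g. ap M ty1 N E g = 0 \<longleftrightarrow> (\<forall>i. g $ i \<noteq> 0))"

text \<open>Grilliot's trick: \<open>trunc f g\<close> is \<open>f\<close> if \<open>g\<close> has no zero, and otherwise it is an initial segment of
  \<open>f\<close> continued by zeros.\<close>

lemma decides_exI:
  assumes "Y $$ f $ n = 0" "\<And>k. Y $$ restr f k $ n \<noteq> 0"
  shows decides_ex
proof -
  have "rp ty1 N (\<lambda>g. Y $$ trunc f g $ n)"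
    unfolding trunc_def no_zero_def by (rule rpI) (rule dec_all Rp_rules | simp)+
  then obtain E where "\<And>g. ap M ty1 N E g = Y $$ trunc f g $ n" unfolding rp_def by blast
  then have "ap M ty1 N E g = 0 \<longleftrightarrow> (\<forall>i. g $ i \<noteq> 0)" for g
    using assms trunc_nonzero trunc_zero by metis
  then show ?thesis unfolding decides_ex_def by blast
qed

text \<open>In contrast to \<open>ACA0_dec_ex\<close>, variables of all types may occur in
  \<open>\<Gamma>\<close>. This uniformity is what makes decoding a real an operation of the
  model.\<close>

lemma dec_ex:
  assumes decides_ex "dec (N # \<Gamma>) (\<lambda>c. P (\<lambda>i. c (Suc i)) (c 0))"
  shows "dec \<Gamma> (\<lambda>c. \<exists>i. P c i)"
proof -
  obtain E where E: "\<And>g. ap M ty1 N E g = 0 \<longleftrightarrow> (\<forall>i. g $ i \<noteq> 0)" using assms(1) unfolding decides_ex_def by blast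
  have R: "Rp (N # \<Gamma>) N (\<lambda>c. if P (\<lambda>i. c (Suc i)) (c 0) then 0 else 1)"
    using assms(2) by (intro Rp_if Rp_const)
  then have rp: "rp N N (\<lambda>i. if P c i then 0 else 1)" for c by (simp add: Rp.simps)
  have "dec \<Gamma> (\<lambda>c. ap M ty1 N E (Lam N N (\<lambda>i. if P c i then 0 else 1)) \<noteq> 0)"
    by (intro dec_not dec_eq Rp_ap Rp_const Rp_Lam R)
  moreover have "(if b then 0 else 1) = (0 :: 'n) \<longleftrightarrow> b" for b by simp
  ultimately show ?thesis by (simp only: E ap_Lam[OF rp]) simp
qed

text \<open>With \<open>E\<close> as a parameter, "either \<open>g\<close> has no zero or
  \<open>i\<close> is one" is quantifier-free and always satisfiable, so \<open>QF_AC_1_0\<close>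
  yields a selector.\<close>

lemma search:
  assumes decides_ex
  shows "\<exists>S. \<forall>g. (\<exists>i. g $ i = 0) \<longrightarrow> g $ ap M ty1 N S g = 0"
proof -
  obtain E where E: "\<And>g. ap M ty1 N E g = 0 \<longleftrightarrow> (\<forall>i. g $ i \<noteq> 0)" using assms unfolding decides_ex_def by blast
  let ?A = "Var ty2 0 \<cdot> Var ty1 0 \<doteq> Zero \<oror> Var ty1 0 \<cdot> Var N 0 \<doteq> Zero"
  have "\<exists>S. \<forall>f. sat M (push N (ap M ty1 N S f) (push ty1 f (\<lambda>_ _. E))) ?A"
    by (rule QF_AC) (auto simp: E)
  then show ?thesis by (auto simp: E)
qed


section \<open>Coding functions by reals\<close>

definition rless_q :: "'n \<Rightarrow> 'n \<Rightarrow> bool" where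
  "rless_q y q \<longleftrightarrow> (\<exists>k. qv (nadd (y $ k) (nadd (nhalf k) (nhalf k))) < qv q)"

lemma rless_q_iff: "rless_q y q \<longleftrightarrow> (\<exists>k. rv y k + (hp k + hp k) < qv q)"
  by (simp add: rless_q_def rv_def)

lemma isreal_dist: "isreal x \<Longrightarrow> m \<le> n \<Longrightarrow> \<bar>rv x m - rv x n\<bar> < hp m"
  unfolding isreal_def by (metis add.commute le_add_diff_inverse2)

lemma rless_q_req:
  assumes "isreal x" "req x y" "rless_q x q"
  shows "rless_q y q"
proof -
  obtain k where k: "rv x k + (hp k + hp k) < qv q" using assms(3) by (auto simp: rless_q_iff)
  \<comment> \<open>Moving from \<open>k\<close> to \<open>n\<close> costs \<open>hp k\<close>;
    passing to \<open>y\<close> and the margin required at \<open>n\<close> cost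
    \<open>4 * hp n\<close>, which is again \<open>hp k\<close>. Together they use up the margin at
    \<open>k\<close>.\<close>
  define n where "n = k + 1 + 1"
  have "k \<le> n" using nonneg[of "1 + 1"] by (simp add: n_def add.assoc)
  then have "\<bar>rv x k - rv x n\<bar> < hp k" by (rule isreal_dist[OF assms(1)])
  moreover have "\<bar>rv x n - rv y n\<bar> \<le> hp n + hp n" using assms(2) by (simp add: req_def)
  moreover have "hp n = hp k / 4" by (simp add: n_def)
  ultimately have "rv y n + (hp n + hp n) < qv q" using k by linarith
  then show ?thesis unfolding rless_q_iff by blast
qed

lemma req_sym: "req x y \<Longrightarrow> req y x"
  by (simp add: req_def abs_minus_commute)

text \<open>Equal reals have literally the same cut, so anything computed from
  \<open>rless_q y\<close> alone respects equality of reals.\<close>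

lemma rless_q_cong: "isreal x \<Longrightarrow> isreal y \<Longrightarrow> req x y \<Longrightarrow> rless_q x = rless_q y"
  using rless_q_req req_sym by blast

definition weight :: "'n \<Rightarrow> 'n" where "weight j = nhalf (j + j + 1 + 1)"

text \<open>\<open>weight j\<close> is 4^-(j+1), and \<open>hp2 j\<close> is 4^-j / 2, a bound for
  the sum 4^-j / 3 of all weights from \<open>j\<close> on.\<close>

definition hp2 :: "'n \<Rightarrow> 'n dint fract" where "hp2 j = hp (j + j + 1)"

lemma hp2_simps: "qv (weight j) = hp2 j / 2" "hp2 (j + 1) = hp2 j / 4" "0 < hp2 j" "hp2 j \<le> hp j"
proof -
  show "qv (weight j) = hp2 j / 2" by (simp add: weight_def hp2_def)
  have "j + 1 + (j + 1) + 1 = j + j + 1 + 1 + 1" by (simp add: ac_simps)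
  then show "hp2 (j + 1) = hp2 j / 4" unfolding hp2_def by (simp only: hp_simps)
  show "0 < hp2 j" by (simp add: hp2_def)
  show "hp2 j \<le> hp j" unfolding hp2_def add.assoc by (rule hp_antimono)
qed

text \<open>The bits \<open>b j\<close> of the graph of \<open>f\<close> are stored as the digits of \<open>\<Sum>\<^sub>j b j / 4 ^ (j + 1)\<close>;
  omitting the digits 2 and 3 makes the expansion unambiguous.\<close>

definition enc_sum :: "'n \<Rightarrow> 'n \<Rightarrow> 'n" where
  "enc_sum f = prec (nrat 0 0 0) (\<lambda>j s. if f $ nfirst j = nsecond j then nadd s (weight j) else s)"

definition enc :: "'n \<Rightarrow> 'n" where "enc f = Lam N N (enc_sum f)"

text \<open>Greedy expansion: a digit is taken when the real is not below the sum that includes it.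
  The argument is the cut \<open>L\<close> instead of the real, for the sake of
  extensionality.\<close>

definition dec_sum :: "('n \<Rightarrow> bool) \<Rightarrow> 'n \<Rightarrow> 'n" where
  "dec_sum L = prec (nrat 0 0 0) (\<lambda>j s. if \<not> L (nadd s (weight j)) then nadd s (weight j) else s)"

definition dec_fun :: "'n \<Rightarrow> ('n \<Rightarrow> bool) \<Rightarrow> 'n" where
  "dec_fun S L = Lam N N (\<lambda>i. ap M ty1 N S (Lam N N (\<lambda>m.
     if \<not> L (nadd (dec_sum L (npair i m)) (weight (npair i m))) then 0 else 1)))"

lemma enc_sum_simps: "enc_sum f 0 = nrat 0 0 0"
  "enc_sum f (j + 1) = (if f $ nfirst j = nsecond j then nadd (enc_sum f j) (weight j) else enc_sum f j)"
  unfolding enc_sum_def weight_def by (subst prec_0 prec_Suc; (rule dec_all Rp_rules | simp)+)+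

lemma rv_enc: "rv (enc f) k = qv (enc_sum f k)"
proof -
  have "rp N N (enc_sum f)" by (simp add: enc_sum_def rp_prec)
  then show ?thesis by (simp add: rv_def enc_def ap_Lam)
qed

text \<open>A digit adds at most \<open>hp2 j / 2\<close> while \<open>hp2\<close> loses three
  quarters of its value, so the upper estimate never increases.\<close>

lemma enc_sum_bounds:
  "qv (enc_sum f j) \<le> qv (enc_sum f (j + i))"
  "qv (enc_sum f (j + i)) + hp2 (j + i) \<le> qv (enc_sum f j) + hp2 j"
proof -
  have "qv (enc_sum f j) \<le> qv (enc_sum f (j + i)) \<and>
    qv (nadd (enc_sum f (j + i)) (nhalf (j + i + (j + i) + 1))) \<le> qv (nadd (enc_sum f j) (nhalf (j + j + 1)))" (is "?P i")
  proof (rule dec_induct[of ?P])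
    show "dec [N] (\<lambda>c. ?P (c 0))"
      unfolding enc_sum_def weight_def by (rule dec_all Rp_rules | simp del: qv_nadd)+
    fix i assume "?P i"
    then have "qv (enc_sum f j) \<le> qv (enc_sum f (j + i)) \<and> qv (enc_sum f (j + i)) + hp2 (j + i) \<le> qv (enc_sum f j) + hp2 j"
      by (simp add: hp2_def)
    moreover have "qv (enc_sum f (j + i + 1)) = qv (enc_sum f (j + i)) + hp2 (j + i) / 2 \<or>
        qv (enc_sum f (j + i + 1)) = qv (enc_sum f (j + i))"
      by (simp add: enc_sum_simps hp2_simps)
    ultimately have "qv (enc_sum f j) \<le> qv (enc_sum f (j + i + 1)) \<and>
        qv (enc_sum f (j + i + 1)) + hp2 (j + i + 1) \<le> qv (enc_sum f j) + hp2 j"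
      using hp2_simps(3)[of "j + i"] hp2_simps(2)[of "j + i"] by linarith
    then show "?P (i + 1)" by (simp add: hp2_def add.assoc)
  qed simp
  then show "qv (enc_sum f j) \<le> qv (enc_sum f (j + i))"
    "qv (enc_sum f (j + i)) + hp2 (j + i) \<le> qv (enc_sum f j) + hp2 j"
    by (simp_all add: hp2_def)
qed

lemma isreal_enc: "isreal (enc f)"
  unfolding isreal_def rv_enc
proof (intro allI)
  fix n i
  show "\<bar>qv (enc_sum f n) - qv (enc_sum f (n + i))\<bar> < hp n"
    using enc_sum_bounds[of f n i] hp2_simps(3)[of "n + i"] hp2_simps(4)[of n] by linarith
qed

text \<open>If the digit is present, the partial sum itself reaches the threshold. If it is missing,
  all later digits together are bounded by \<open>hp2 (j + 1)\<close>, half of the missing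
  weight.\<close>

lemma enc_digit: "\<not> rless_q (enc f) (nadd (enc_sum f j) (weight j)) \<longleftrightarrow> f $ nfirst j = nsecond j"
proof
  assume b: "f $ nfirst j = nsecond j"
  have le: "qv (enc_sum f (j + 1)) \<le> qv (enc_sum f k) + hp k" for k
  proof (cases "k \<le> j + 1")
    case True
    then have "j + 1 = k + (j + 1 - k)" by (simp add: add.commute)
    then show ?thesis
      using enc_sum_bounds(2)[of f k "j + 1 - k"] hp2_simps(3)[of "j + 1"] hp2_simps(4)[of k] by simp
  next
    case False
    then have "k = j + 1 + (k - (j + 1))" by (simp add: add.commute[of "j + 1"] less_imp_le)
    then have "qv (enc_sum f (j + 1)) \<le> qv (enc_sum f k)"
      using enc_sum_bounds(1)[of f "j + 1" "k - (j + 1)"] by simp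
    then show ?thesis using hp_pos[of k] by linarith
  qed
  have "\<not> qv (enc_sum f k) + (hp k + hp k) < qv (enc_sum f (j + 1))" for k
    using le[of k] hp_pos[of k] by linarith
  then show "\<not> rless_q (enc f) (nadd (enc_sum f j) (weight j))"
    using b by (simp add: rless_q_iff rv_enc enc_sum_simps)
next
  assume *: "\<not> rless_q (enc f) (nadd (enc_sum f j) (weight j))"
  show "f $ nfirst j = nsecond j"
  proof (rule ccontr)
    assume b: "f $ nfirst j \<noteq> nsecond j"
    \<comment> \<open>\<open>hp k\<close> is an eighth of \<open>hp2 j\<close>, so the margin
      \<open>2 * hp k\<close> just fills the gap between the bound \<open>hp2 j / 4\<close> on later
      digits and the weight \<open>hp2 j / 2\<close>.\<close>
    define k where "k = j + j + 1 + 1 + 1 + 1"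
    have k: "k = j + 1 + (j + 1 + 1 + 1)" by (simp add: k_def ac_simps)
    have "hp k = hp2 j / 8" by (simp add: k_def hp2_def)
    moreover have "qv (enc_sum f k) + hp2 k \<le> qv (enc_sum f j) + hp2 j / 4"
      using enc_sum_bounds(2)[of f "j + 1" "j + 1 + 1 + 1"] b by (simp add: k enc_sum_simps hp2_simps)
    ultimately have "qv (enc_sum f k) + (hp k + hp k) < qv (enc_sum f j) + hp2 j / 2"
      using hp2_simps(3)[of k] by linarith
    then show False using * by (simp add: rless_q_iff rv_enc hp2_simps)
  qed
qed

text \<open>A point strictly between the end points forces \<open>qv b\<close> to be nonzero, and a
  positive rational exceeds \<open>2 * hp n\<close> for some \<open>n\<close>; so the end points
  differ automatically.\<close>

lemma inint_rofq:
  assumes "isreal x"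
  shows "inint x (rofq a) (rofq b) \<longleftrightarrow>
    (\<exists>k. qv a + (hp k + hp k) < rv x k) \<and> (\<exists>k. rv x k + (hp k + hp k) < qv a + \<bar>qv b\<bar>)"
proof -
  have "\<not> req (rofq a) (radd (rofq a) (rabs (rofq b)))"
    if ab: "\<exists>k. qv a + (hp k + hp k) < rv x k" "\<exists>k. rv x k + (hp k + hp k) < qv a + \<bar>qv b\<bar>"
  proof
    assume *: "req (rofq a) (radd (rofq a) (rabs (rofq b)))"
    obtain k l where k: "qv a + (hp k + hp k) < rv x k" and l: "rv x l + (hp l + hp l) < qv a + \<bar>qv b\<bar>"
      using ab by blast
    have "\<bar>rv x k - rv x l\<bar> < hp k + hp l"
    proof (cases "k \<le> l")
      case True
      then show ?thesis using isreal_dist[OF assms True] hp_pos[of l] by linarith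
    next
      case False
      then have "l \<le> k" by simp
      then show ?thesis using isreal_dist[OF assms, of l k] hp_pos[of k] by linarith
    qed
    then have "0 < \<bar>qv b\<bar>" using k l hp_pos[of k] hp_pos[of l] by linarith
    then obtain n where "hp n < \<bar>qv b\<bar> / 2" using hp_archimedean[of "\<bar>qv b\<bar> / 2"] by auto
    moreover have "\<bar>qv b\<bar> \<le> hp n + hp n" using * by (simp add: req_def)
    ultimately show False by linarith
  qed
  then show ?thesis unfolding inint_def rless_def by auto
qed

definition tail :: "'n \<Rightarrow> 'n" where "tail h = Lam N N (\<lambda>i. h $ (i + 1))"
definition cons_seq :: "'n \<Rightarrow> 'n \<Rightarrow> 'n" where "cons_seq n f = Lam N N (\<lambda>i. if i = 0 then n else f $ (i - 1))"

lemma cons_seq: "cons_seq n f $ 0 = n" "tail (cons_seq n f) = f"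
proof -
  have "rp N N (\<lambda>i. if i = 0 then n else f $ (i - 1))" by (rule rpI) (rule dec_all Rp_rules | simp)+
  then have c: "cons_seq n f $ i = (if i = 0 then n else f $ (i - 1))" for i
    by (simp add: cons_seq_def ap_Lam)
  then show "cons_seq n f $ 0 = n" by simp
  have "i + 1 \<noteq> 0" for i :: 'n using nonneg[of i] by (metis add_nonneg_pos less_irrefl zero_less_one)
  then show "tail (cons_seq n f) = f" by (simp add: tail_def c)
qed

lemma isreal_rofq: "isreal (rofq q)" and req_refl: "req x x"
  by (simp_all add: isreal_def req_def less_imp_le add_nonneg_nonneg)

section \<open>Decoding reals and the resulting open set\<close>

context
  assumes decides: decides_ex
begin

lemmas dec_rules_ex = dec_all dec_ex[OF decides]

lemma dec_sum_enc: "dec_sum (rless_q (enc f)) j = enc_sum f j"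
proof -
  have R: "Rp [N, N] N (\<lambda>c. if \<not> rless_q (enc f) (nadd (c 0) (weight (c (Suc 0)))) then nadd (c 0) (weight (c (Suc 0))) else c 0)"
    unfolding rless_q_def weight_def by (rule dec_rules_ex Rp_rules | simp)+
  show ?thesis
  proof (rule dec_induct[of "\<lambda>j. dec_sum (rless_q (enc f)) j = enc_sum f j"])
    show "dec [N] (\<lambda>c. dec_sum (rless_q (enc f)) (c 0) = enc_sum f (c 0))"
      unfolding dec_sum_def enc_sum_def rless_q_def weight_def by (rule dec_rules_ex Rp_rules | simp)+
    show "dec_sum (rless_q (enc f)) 0 = enc_sum f 0"
      unfolding dec_sum_def by (subst prec_0[OF R]) (simp add: enc_sum_simps)
    fix j assume IH: "dec_sum (rless_q (enc f)) j = enc_sum f j"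
    have "dec_sum (rless_q (enc f)) (j + 1) =
        (if \<not> rless_q (enc f) (nadd (enc_sum f j) (weight j)) then nadd (enc_sum f j) (weight j) else enc_sum f j)"
      unfolding IH[symmetric] unfolding dec_sum_def by (rule prec_Suc[OF R])
    then show "dec_sum (rless_q (enc f)) (j + 1) = enc_sum f (j + 1)"
      unfolding enc_digit enc_sum_simps .
  qed
qed

lemma dec_fun_enc:
  assumes S: "\<And>g. (\<exists>i. g $ i = 0) \<Longrightarrow> g $ ap M ty1 N S g = 0"
  shows "dec_fun S (rless_q (enc f)) = f"
proof -
  \<comment> \<open>\<open>G i\<close> vanishes only at \<open>f $ i\<close>, so the selector
    \<open>S\<close> has to return that value.\<close>
  define G where "G i = Lam N N (\<lambda>m. if f $ i = m then 0 else 1)" for i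
  have "rp N N (\<lambda>m. if f $ i = m then 0 else 1)" for i
    by (rule rpI) (rule dec_all Rp_rules | simp)+
  then have G: "G i $ m = (if f $ i = m then 0 else 1)" for i m by (simp add: G_def ap_Lam)
  then have "G i $ (f $ i) = 0" for i by simp
  then have "G i $ ap M ty1 N S (G i) = 0" for i using S by blast
  then have "ap M ty1 N S (G i) = f $ i" for i unfolding G by (metis zero_neq_one)
  then have "Lam N N (\<lambda>i. ap M ty1 N S (G i)) = f" by simp
  then show ?thesis unfolding dec_fun_def dec_sum_enc enc_digit npair_simps G_def .
qed

lemma dec_openplus:
  assumes openplus
  shows "dec [N] (\<lambda>c. \<exists>f. Y $$ f $ c 0 = 0)"
proof -
  obtain S where S: "\<And>g. (\<exists>i. g $ i = 0) \<Longrightarrow> g $ ap M ty1 N S g = 0" using search[OF decides] by blast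
  \<comment> \<open>The decoded sequence is read as a number \<open>h y $ 0\<close> followed by a
    function. It is defined for every \<open>y\<close>, whether or not \<open>y\<close> is a
    code.\<close>
  define h where "h y = dec_fun S (rless_q y)" for y
  \<comment> \<open>The width of the interval. Width 0 makes the interval empty, so a real
    contributes only if what it decodes to is a zero of \<open>Y\<close>.\<close>
  define v where "v h = (if Y $$ (tail h) $ (h $ 0) = 0 then 1 else (0 :: 'n))" for h
  define p where "p = Lam ty1 ty1 (\<lambda>y. rofq (nrat (h y $ 0) 0 0))"
  define q where "q = Lam ty1 ty1 (\<lambda>y. rofq (nrat (v (h y)) 0 0))"
  have "rp ty1 ty1 (\<lambda>y. rofq (nrat (h y $ 0) 0 0))"
    unfolding rofq_def h_def dec_fun_def dec_sum_def rless_q_def weight_def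
    by (rule rpI) (rule dec_rules_ex Rp_rules | simp)+
  then have p: "p $$ y = rofq (nrat (h y $ 0) 0 0)" for y by (simp add: p_def ap_Lam)
  have "rp ty1 ty1 (\<lambda>y. rofq (nrat (v (h y)) 0 0))"
    unfolding rofq_def v_def h_def tail_def dec_fun_def dec_sum_def rless_q_def weight_def
    by (rule rpI) (rule dec_rules_ex Rp_rules | simp)+
  then have q: "q $$ y = rofq (nrat (v (h y)) 0 0)" for y by (simp add: q_def ap_Lam)
  \<comment> \<open>Decoding goes through the cut, so equal reals give identical sequences and the
    end points depend on the real only.\<close>
  have h_cong: "h x = h y" if "isreal x" "isreal y" "req x y" for x y
    using rless_q_cong[OF that] by (simp add: h_def)
  have req: "req (p $$ x) (p $$ y)" "req (q $$ x) (q $$ y)"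
    if "isreal x" "isreal y" "req x y" for x y
    unfolding p q h_cong[OF that] by (rule req_refl)+
  have "realfun p" "realfun q"
    using req by (auto simp: realfun_def isreal_rofq) (simp_all add: p q isreal_rofq)
  then obtain X where X: "\<And>n. X $ n = 1 \<longleftrightarrow> (\<forall>x. isreal x \<longrightarrow> inball x n \<longrightarrow> inopen x p q)"
    using assms unfolding openplus_def by blast
  \<comment> \<open>The centre is (2n + 1) / 2. Numerator and denominator of a radius are stored
    less one, so \<open>npair 0 1\<close> stands for 1/2.\<close>
  define B where "B n = npair (nrat (n + n + 1) 0 1) (npair 0 1)" for n
  have cen: "cen (B n) = emb n + 1 / 2" for n
    by (simp add: B_def cen_def qv_nrat field_simps)
  have rad: "rad (B n) = 1 / 2" for n
    by (simp add: B_def rad_def qv_nrat)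
  have "X $ B n = 1 \<longleftrightarrow> (\<exists>f. Y $$ f $ n = 0)" for n
  proof
    assume "X $ B n = 1"
    obtain c where c: "qv c = emb n + 1 / 2" by (rule qv_surj)
    have "inball (rofq c) (B n)"
    proof -
      \<comment> \<open>The centre lies in the ball as soon as \<open>2 * hp m < 1 / 2\<close>;
        precision 2 would give only equality.\<close>
      define m where "m = 0 + 1 + 1 + (1 :: 'n)"
      have "hp m = 1 / 8" by (simp only: m_def hp_simps)
      then have "hp m + hp m < 1 / 2" by simp
      then show ?thesis unfolding inball_def cen rad by (auto simp: c)
    qed
    then have "inopen (rofq c) p q" using X \<open>X $ B n = 1\<close> isreal_rofq by blast
    then obtain y where "inint (rofq c) (p $$ y) (q $$ y)" unfolding inopen_def by blast
    then obtain k l where kl: "emb (h y $ 0) + (hp k + hp k) < emb n + 1 / 2"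
        "emb n + 1 / 2 + (hp l + hp l) < emb (h y $ 0) + emb (v (h y))"
      unfolding p q inint_rofq[OF isreal_rofq] by (auto simp: c qv_nrat)
    have "v (h y) \<noteq> 0"
    proof
      assume "v (h y) = 0"
      then show False using kl hp_pos[of k] hp_pos[of l] by simp
    qed
    then have 1: "v (h y) = 1" and 2: "Y $$ (tail (h y)) $ (h y $ 0) = 0" by (auto simp: v_def split: if_splits)
    \<comment> \<open>Two numbers of the model at distance less than 1 are equal by
      discreteness.\<close>
    have "emb (h y $ 0) < emb n + 1" "emb n < emb (h y $ 0) + 1"
      using kl hp_pos[of k] hp_pos[of l] unfolding 1 emb_simps(2) by linarith+
    then have "emb (h y $ 0) < emb (n + 1)" "emb n < emb (h y $ 0 + 1)" by simp_all
    then have "h y $ 0 = n" unfolding emb_simps(7) less_add_one_iff by simp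
    then show "\<exists>f. Y $$ f $ n = 0" using 2 by blast
  next
    assume "\<exists>f. Y $$ f $ n = 0"
    then obtain f where f: "Y $$ f $ n = 0" by blast
    define y where "y = enc (cons_seq n f)"
    have hy: "h y = cons_seq n f" unfolding h_def y_def by (rule dec_fun_enc) (rule S)
    have v: "v (h y) = 1" by (simp add: hy v_def cons_seq f)
    have "inopen x p q" if x: "isreal x" "inball x (B n)" for x
    proof -
      obtain k where "\<bar>rv x (k + 1) - (emb n + 1 / 2)\<bar> + (hp k + hp k) < 1 / 2"
        using x(2) unfolding inball_def cen rad by blast
      then have *: "emb n + (hp (k + 1) + hp (k + 1)) < rv x (k + 1)" "rv x (k + 1) + (hp (k + 1) + hp (k + 1)) < emb n + 1"
        using hp_pos[of k] hp_simps(2)[of k] by linarith+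
      have "h y $ 0 = n" by (simp add: hy cons_seq)
      then have "inint x (p $$ y) (q $$ y)"
        unfolding p q inint_rofq[OF x(1)] v using *
        by (intro conjI exI[of _ "k + 1"]) (simp_all add: qv_nrat del: hp_simps)
      then show ?thesis unfolding inopen_def y_def using isreal_enc by blast
    qed
    then show "X $ B n = 1" using X by blast
  qed
  moreover have "dec [N] (\<lambda>c. X $ B (c 0) = 1)" unfolding B_def by (rule dec_all Rp_rules | simp)+
  ultimately show ?thesis by simp
qed

end

lemma openplus_ACA0_boot:
  assumes "\<And>A e. A \<in> ACA0 \<Longrightarrow> wf_fm A \<Longrightarrow> sat M e A" openplus
  shows boot
  unfolding boot_def
proof
  fix Y
  have "dec [N] (\<lambda>c. \<exists>f. Y $$ f $ c 0 = 0)"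
  proof (cases "\<forall>n f. Y $$ f $ n = 0 \<longrightarrow> (\<exists>k. Y $$ restr f k $ n = 0)")
    case True
    then show ?thesis by (intro dec_approximated assms(1)) auto
  next
    case False
    then have decides_ex using decides_exI by blast
    then show ?thesis using assms(2) by (rule dec_openplus)
  qed
  then show "\<exists>X. isset X \<and> (\<forall>n. X $ n = 1 \<longleftrightarrow> (\<exists>f. Y $$ f $ n = 0))"
    unfolding dec_iff_set[of "\<lambda>n. \<exists>f. Y $$ f $ n = 0"] .
qed


section \<open>Open sets under bootstrapping\<close>

text \<open>An approximation that deviates too much is replaced by the previous one; every \<open>f\<close> thus
  yields a real, and every real arises in this way up to equality.\<close>

definition hat :: "'n \<Rightarrow> 'n" where
  "hat f = Lam N N (prec (f $ 0) (\<lambda>n z. if qv (ndist (f $ (n + 1)) z) \<le> qv (nhalf (n + 1 + 1)) then f $ (n + 1) else z))"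

lemma hat_simps: "hat f $ 0 = f $ 0"
  "hat f $ (n + 1) = (if \<bar>qv (f $ (n + 1)) - rv (hat f) n\<bar> \<le> hp (n + 1 + 1) then f $ (n + 1) else hat f $ n)"
proof -
  define G where "G n z = (if qv (ndist (f $ (n + 1)) z) \<le> qv (nhalf (n + 1 + 1)) then f $ (n + 1) else z)" for n z
  have R: "Rp [N, N] N (\<lambda>c. G (c (Suc 0)) (c 0))"
    unfolding G_def ndist_def by (rule dec_all Rp_rules | simp)+
  have hat: "hat f $ n = prec (f $ 0) G n" for n by (simp add: hat_def G_def[abs_def] ap_Lam rp_prec)
  show "hat f $ 0 = f $ 0" unfolding hat by (rule prec_0[OF R])
  have "hat f $ (n + 1) = G n (hat f $ n)" unfolding hat by (rule prec_Suc[OF R])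
  then show "hat f $ (n + 1) = (if \<bar>qv (f $ (n + 1)) - rv (hat f) n\<bar> \<le> hp (n + 1 + 1) then f $ (n + 1) else hat f $ n)"
    by (simp add: G_def rv_def)
qed

lemma isreal_hat: "isreal (hat f)"
  unfolding isreal_def
proof (intro allI)
  fix n i :: 'n
  \<comment> \<open>The extra term pays for the next step: a correction of size at most
    \<open>hp (n + i + 1 + 1)\<close> is covered by the halving of
    \<open>hp (n + i + 1)\<close>.\<close>
  let ?P = "\<lambda>i. qv (nadd (ndist (hat f $ n) (hat f $ (n + i))) (nhalf (n + i + 1))) \<le> qv (nhalf (n + 1))"
  have "?P i"
  proof (rule dec_induct[of ?P])
    show "dec [N] (\<lambda>c. ?P (c 0))" unfolding ndist_def by (rule dec_all Rp_rules | simp)+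
    fix i assume "?P i"
    then have "\<bar>rv (hat f) n - rv (hat f) (n + i)\<bar> + hp (n + i + 1) \<le> hp (n + 1)"
      by (simp only: qv_nadd qv_ndist rv_def hp_def)
    moreover have "hp (n + i + 1 + 1) = hp (n + i + 1) / 2" by (rule hp_simps)
    moreover have "\<bar>rv (hat f) (n + i + 1) - rv (hat f) (n + i)\<bar> \<le> hp (n + i + 1 + 1)"
      by (simp add: rv_def hat_simps(2) less_imp_le del: hp_simps)
    ultimately have "\<bar>rv (hat f) n - rv (hat f) (n + i + 1)\<bar> + hp (n + i + 1 + 1) \<le> hp (n + 1)" by linarith
    then show "?P (i + 1)" by (simp only: qv_nadd qv_ndist rv_def hp_def add.assoc)
  qed simp
  then have "\<bar>rv (hat f) n - rv (hat f) (n + i)\<bar> + hp (n + i + 1) \<le> hp (n + 1)"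
    by (simp only: qv_nadd qv_ndist rv_def hp_def)
  then show "\<bar>rv (hat f) n - rv (hat f) (n + i)\<bar> < hp n"
    using hp_pos[of "n + i + 1"] hp_pos[of n] hp_simps(2)[of n] by linarith
qed

text \<open>Skipping two places makes consecutive approximations closer than the tolerance of
  \<open>hat\<close>, which then leaves them unchanged.\<close>

definition shift2 :: "'n \<Rightarrow> 'n" where "shift2 y = Lam N N (\<lambda>n. y $ (n + 1 + 1))"

lemma hat_shift2:
  assumes "isreal y"
  shows "req (hat (shift2 y)) y"
proof -
  have "rp N N (\<lambda>n. y $ (n + 1 + 1))" by (rule rpI) (rule Rp_rules | simp)+
  then have s: "shift2 y $ n = y $ (n + 1 + 1)" for n by (simp only: shift2_def ap_Lam)
  have hat: "hat (shift2 y) $ n = y $ (n + 1 + 1)" for n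
  proof (rule dec_induct[of "\<lambda>n. hat (shift2 y) $ n = y $ (n + 1 + 1)"])
    show "dec [N] (\<lambda>c. hat (shift2 y) $ c 0 = y $ (c 0 + 1 + 1))" by (rule dec_all Rp_rules | simp)+
    show "hat (shift2 y) $ 0 = y $ (0 + 1 + 1)" by (simp only: hat_simps s)
    fix n assume IH: "hat (shift2 y) $ n = y $ (n + 1 + 1)"
    have "n + 1 + 1 \<le> n + 1 + 1 + 1" using nonneg[of "1 :: 'n"] by simp
    from isreal_dist[OF assms this]
    have "\<bar>qv (shift2 y $ (n + 1)) - rv (hat (shift2 y)) n\<bar> \<le> hp (n + 1 + 1)"
      by (simp only: rv_def IH s abs_minus_commute less_imp_le)
    then show "hat (shift2 y) $ (n + 1) = y $ (n + 1 + 1 + 1)" by (simp only: hat_simps if_True s)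
  qed
  show ?thesis
    unfolding req_def
  proof
    fix n :: 'n
    have "n \<le> n + 1 + 1" using nonneg[of "1 + 1 :: 'n"] by (simp add: add.assoc)
    from isreal_dist[OF assms this]
    have "\<bar>rv (hat (shift2 y)) n - rv y n\<bar> < hp n" by (simp only: rv_def hat abs_minus_commute)
    then show "\<bar>rv (hat (shift2 y)) n - rv y n\<bar> \<le> hp n + hp n" using hp_pos[of n] by linarith
  qed
qed

definition rgreater_q :: "'n \<Rightarrow> 'n \<Rightarrow> bool" where
  "rgreater_q y q \<longleftrightarrow> (\<exists>k. qv q + (hp k + hp k) < rv y k)"

lemma rgreater_q_req:
  assumes "isreal x" "req x y" "rgreater_q x q"
  shows "rgreater_q y q"
proof -
  obtain k where k: "qv q + (hp k + hp k) < rv x k" using assms(3) by (auto simp: rgreater_q_def)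
  define n where "n = k + 1 + 1"
  have "k \<le> n" using nonneg[of "1 + 1 :: 'n"] by (simp add: n_def add.assoc)
  then have "\<bar>rv x k - rv x n\<bar> < hp k" by (rule isreal_dist[OF assms(1)])
  moreover have "\<bar>rv x n - rv y n\<bar> \<le> hp n + hp n" using assms(2) by (simp add: req_def)
  moreover have "hp n = hp k / 4" by (simp add: n_def)
  ultimately have "qv q + (hp n + hp n) < rv y n" using k by linarith
  then show ?thesis unfolding rgreater_q_def by blast
qed

lemma isreal_radd_rabs:
  assumes "isreal a" "isreal b"
  shows "isreal (radd a (rabs b))"
  unfolding isreal_def
proof (intro allI)
  fix n i :: 'n
  have "n + 1 \<le> n + i + 1" using nonneg[of i] by simp
  then have "\<bar>rv a (n + 1) - rv a (n + i + 1)\<bar> < hp (n + 1)" "\<bar>rv b (n + 1) - rv b (n + i + 1)\<bar> < hp (n + 1)"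
    using isreal_dist assms by blast+
  then show "\<bar>rv (radd a (rabs b)) n - rv (radd a (rabs b)) (n + i)\<bar> < hp n"
    using hp_simps(2)[of n] unfolding rv_simps by linarith
qed

lemma req_radd_rabs:
  assumes "req a a'" "req b b'"
  shows "req (radd a (rabs b)) (radd a' (rabs b'))"
  unfolding req_def
proof
  fix n :: 'n
  have "\<bar>rv a (n + 1) - rv a' (n + 1)\<bar> \<le> hp (n + 1) + hp (n + 1)" "\<bar>rv b (n + 1) - rv b' (n + 1)\<bar> \<le> hp (n + 1) + hp (n + 1)"
    using assms unfolding req_def by blast+
  then show "\<bar>rv (radd a (rabs b)) n - rv (radd a' (rabs b')) n\<bar> \<le> hp n + hp n"
    using hp_simps(2)[of n] unfolding rv_simps by linarith
qed

lemma hp_archimedean4: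
  assumes "0 < (q :: 'n dint fract)"
  obtains n where "4 * hp n < q"
proof -
  have "0 < q / 4" using assms by simp
  then obtain n where "hp n < q / 4" by (rule hp_archimedean)
  then have "4 * hp n < q" by (simp add: field_simps)
  then show ?thesis by (rule that)
qed

text \<open>The surplus of the first strict inequality exceeds some \<open>4 * hp m\<close>. At an
  index beyond all those involved, \<open>e\<close> still exceeds \<open>a\<close> by more than the
  \<open>2 * hp n\<close> that equality of reals tolerates.\<close>

lemma rless_not_req:
  assumes "isreal a" "isreal x" "isreal e" "rless a x" "rless x e"
  shows "\<not> req a e"
proof
  assume req: "req a e"
  obtain k l where k: "rv a k + (hp k + hp k) < rv x k" and l: "rv x l + (hp l + hp l) < rv e l"
    using assms(4,5) unfolding rless_def by blast
  have "0 < rv x k - rv a k - (hp k + hp k)" using k by simp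
  then obtain m where m: "4 * hp m < rv x k - rv a k - (hp k + hp k)" by (rule hp_archimedean4)
  define n where "n = m + k + l"
  have n: "m \<le> n" "k \<le> n" "l \<le> n" unfolding n_def by (simp_all add: add_increasing add_increasing2 nonneg)
  have "\<bar>rv x k - rv x n\<bar> < hp k" "\<bar>rv a k - rv a n\<bar> < hp k" "\<bar>rv x l - rv x n\<bar> < hp l" "\<bar>rv e l - rv e n\<bar> < hp l"
    using isreal_dist n assms by blast+
  moreover have "hp n \<le> hp m" using n by (intro hp_mono)
  moreover have "\<bar>rv a n - rv e n\<bar> \<le> hp n + hp n" using req by (simp add: req_def)
  ultimately show False using m k l hp_pos[of m] by linarith
qed

lemma boot_dec_pair:
  assumes boot "dec [N] (\<lambda>c. Q (c 0))"
  shows "dec [N] (\<lambda>c. \<exists>m. Q (npair m (c 0)))"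
proof (rule boot_dec_ex[OF assms(1)])
  show "dec [N, N] (\<lambda>c. Q (npair (c (Suc 0)) (c 0)))"
    by (rule dec_comp[OF assms(2)]) (rule Rp_rules | simp)+
qed

definition nhalve :: "'n \<Rightarrow> 'n" where
  "nhalve x = nrat (npos x) (nneg x) (nden x + nden x - 1)"

lemma qv_nhalve [simp]: "qv (nhalve x) = qv x / 2"
proof -
  have "1 \<le> nden x + nden x" using nonneg[of "nsecond x"] by (simp add: nden_def add_increasing)
  then have "emb (nden x + nden x - 1) + 1 = 2 * emb (nden x)" by (simp add: emb_diff)
  then show ?thesis unfolding nhalve_def qv_nrat using nden_pos[of x] by (simp add: qv_def)
qed

lemma Rp_nhalve: "Rp \<Gamma> N F \<Longrightarrow> Rp \<Gamma> N (\<lambda>c. nhalve (F c))"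
  unfolding nhalve_def by (intro Rp_nrat Rp_parts Rp_add Rp_minus Rp_const)

context
  fixes p q :: 'n
  assumes boot: boot and p: "realfun p" and q: "realfun q"
begin

abbreviation "lo y \<equiv> p $$ y"
abbreviation "hi y \<equiv> radd (p $$ y) (rabs (q $$ y))"

lemma isreal_ends: "isreal y \<Longrightarrow> isreal (lo y)" "isreal y \<Longrightarrow> isreal (hi y)"
  using p q by (auto simp: realfun_def intro: isreal_radd_rabs)

lemma req_ends: "isreal x \<Longrightarrow> isreal y \<Longrightarrow> req x y \<Longrightarrow> req (lo x) (lo y) \<and> req (hi x) (hi y)"
  using p q by (auto simp: realfun_def intro: req_radd_rabs)

section \<open>Covers of closed rational intervals\<close>

definition within :: "'n \<Rightarrow> 'n \<Rightarrow> bool" where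
  "within c d \<longleftrightarrow> (\<exists>y. isreal y \<and> rless_q (lo y) c \<and> rgreater_q (hi y) d)"

text \<open>The real and the witnesses of both strict inequalities are packed into one function: its
  first value codes the witnesses, and \<open>hat\<close> turns the rest into a real. A single use
  of \<open>BOOT\<close> then suffices.\<close>

lemma dec_within_aux: "dec [N] (\<lambda>c. within (nfirst (c 0)) (nsecond (c 0)))"
proof -
  define P where "P f m \<longleftrightarrow>
      qv (nadd (lo (hat (tail f)) $ nfirst (f $ 0)) (nadd (nhalf (nfirst (f $ 0))) (nhalf (nfirst (f $ 0))))) < qv (nfirst m) \<and>
      qv (nadd (nsecond m) (nadd (nhalf (nsecond (f $ 0))) (nhalf (nsecond (f $ 0))))) < qv (hi (hat (tail f)) $ nsecond (f $ 0))"
    for f m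
  have "dec [N, ty1] (\<lambda>c. P (c (Suc 0)) (c 0))"
    unfolding P_def hat_def tail_def radd_def rabs_def ndist_def
    by (rule dec_all Rp_rules | simp del: qv_nadd)+
  then have "dec [N] (\<lambda>c. \<exists>f. P f (c 0))" by (rule boot_dec[OF boot])
  moreover have "(\<exists>f. P f m) \<longleftrightarrow> within (nfirst m) (nsecond m)" for m
  proof
    assume "\<exists>f. P f m"
    then obtain f where "P f m" by blast
    then have "rless_q (lo (hat (tail f))) (nfirst m)" "rgreater_q (hi (hat (tail f))) (nsecond m)"
      unfolding P_def rless_q_def rgreater_q_def by (auto simp: rv_def hp_def simp del: hp_def[symmetric])
    then show "within (nfirst m) (nsecond m)" unfolding within_def using isreal_hat by blast
  next
    assume "within (nfirst m) (nsecond m)"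
    then obtain y where y: "isreal y" "rless_q (lo y) (nfirst m)" "rgreater_q (hi y) (nsecond m)"
      unfolding within_def by blast
    \<comment> \<open>\<open>?z\<close> and \<open>y\<close> are equal only as reals. As
      \<open>p\<close> and \<open>q\<close> respect this equality, the end points are equal reals
      too, but the strict inequalities need new witnesses \<open>k\<close> and
      \<open>l\<close>.\<close>
    let ?z = "hat (shift2 y)"
    have "req (lo y) (lo ?z)" "req (hi y) (hi ?z)"
      using req_ends[OF y(1) isreal_hat req_sym[OF hat_shift2[OF y(1)]]] by blast+
    then have "rless_q (lo ?z) (nfirst m)" "rgreater_q (hi ?z) (nsecond m)"
      using rless_q_req rgreater_q_req isreal_ends y by blast+
    then obtain k l where "rv (lo ?z) k + (hp k + hp k) < qv (nfirst m)" "qv (nsecond m) + (hp l + hp l) < rv (hi ?z) l"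
      unfolding rless_q_iff rgreater_q_def by blast
    then have "P (cons_seq (npair k l) (shift2 y)) m"
      unfolding P_def cons_seq npair_simps qv_nadd by (simp only: rv_def hp_def)
    then show "\<exists>f. P f m" by blast
  qed
  ultimately show ?thesis by simp
qed

lemma dec_within: "Rp \<Gamma> N F \<Longrightarrow> Rp \<Gamma> N G \<Longrightarrow> dec \<Gamma> (\<lambda>c. within (F c) (G c))"
  using dec_comp[of "\<lambda>x. within (nfirst x) (nsecond x)" \<Gamma> "\<lambda>c. npair (F c) (G c)", OF dec_within_aux]
  by (simp add: Rp_npair)

text \<open>The number \<open>2\<^sup>-\<^sup>j\<close> is a Lebesgue number of \<open>[l, r]\<close> for the cover by the intervals that
  constitute the open set.\<close>

definition covered :: "'n \<Rightarrow> 'n \<Rightarrow> bool" where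
  "covered l r \<longleftrightarrow> (\<exists>j. \<forall>c d. qv l \<le> qv c \<and> qv c < qv d \<and> qv d \<le> qv r \<and> qv d < qv c + hp j \<longrightarrow> within c d)"

text \<open>\<open>BOOT\<close> removes one number quantifier at a time, so the remaining variables
  are packed into one number, with the innermost quantified one in front.\<close>

lemma dec_covered: "Rp \<Gamma> N F \<Longrightarrow> Rp \<Gamma> N G \<Longrightarrow> dec \<Gamma> (\<lambda>c. covered (F c) (G c))"
proof -
  define Q where "Q x \<longleftrightarrow> (let d = nfirst x; c = nfirst (nsecond x); j = nfirst (nsecond (nsecond x));
      l = nfirst (nsecond (nsecond (nsecond x))); r = nsecond (nsecond (nsecond (nsecond x))) in
      \<not> (qv l \<le> qv c \<and> qv c < qv d \<and> qv d \<le> qv r \<and> qv d < qv (nadd c (nhalf j)) \<longrightarrow> within c d))" for x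
  have "dec [N] (\<lambda>c. Q (c 0))"
    unfolding Q_def Let_def by (rule dec_all dec_within Rp_rules | simp del: qv_nadd)+
  then have "dec [N] (\<lambda>c. \<exists>d. Q (npair d (c 0)))" by (rule boot_dec_pair[OF boot])
  then have "dec [N] (\<lambda>x. \<exists>c d. Q (npair d (npair c (x 0))))"
    by (rule boot_dec_pair[OF boot, of "\<lambda>x. \<exists>d. Q (npair d x)"])
  then have "dec [N] (\<lambda>x. \<exists>j. \<not> (\<exists>c d. Q (npair d (npair c (npair j (x 0))))))"
    by (rule boot_dec_pair[OF boot, of "\<lambda>x. \<not> (\<exists>c d. Q (npair d (npair c x)))", OF dec_not])
  moreover assume "Rp \<Gamma> N F" "Rp \<Gamma> N G"
  ultimately have "dec \<Gamma> (\<lambda>x. \<exists>j. \<not> (\<exists>c d. Q (npair d (npair c (npair j (npair (F x) (G x)))))))"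
    using dec_comp[of "\<lambda>x. \<exists>j. \<not> (\<exists>c d. Q (npair d (npair c (npair j x))))" \<Gamma> "\<lambda>c. npair (F c) (G c)"]
    by (simp add: Rp_npair)
  then show ?thesis unfolding Q_def Let_def npair_simps not_ex not_not covered_def by simp
qed

lemma covered_subset:
  assumes "isreal x" "covered l r" "rgreater_q x l" "rless_q x r"
  shows "inopen x p q"
proof -
  obtain j where j: "\<And>c d. qv l \<le> qv c \<Longrightarrow> qv c < qv d \<Longrightarrow> qv d \<le> qv r \<Longrightarrow> qv d < qv c + hp j \<Longrightarrow> within c d"
    using assms(2) unfolding covered_def by blast
  obtain k1 k2 where k: "qv l + (hp k1 + hp k1) < rv x k1" "rv x k2 + (hp k2 + hp k2) < qv r"
    using assms(3,4) unfolding rless_q_iff rgreater_q_def by blast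
  define m where "m = k1 + k2 + j"
  \<comment> \<open>Three extra places: the interval of radius \<open>2 * hp n\<close> about the
    approximation has length \<open>hp m / 2\<close>, less than \<open>hp j\<close>, and stays
    inside \<open>[l, r]\<close>.\<close>
  define n where "n = m + 1 + 1 + 1"
  have m: "k1 \<le> m" "k2 \<le> m" "j \<le> m" unfolding m_def by (simp_all add: add_increasing add_increasing2 nonneg)
  have "m \<le> n" unfolding n_def by (simp add: add.assoc nonneg)
  then have n: "k1 \<le> n" "k2 \<le> n" using m by simp_all
  have hp: "hp n = hp m / 8" "hp m \<le> hp k1" "hp m \<le> hp k2" "hp m \<le> hp j"
    using m by (simp_all add: n_def hp_mono)
  define c where "c = nadd (x $ n) (numinus (nadd (nhalf n) (nhalf n)))"
  define d where "d = nadd (x $ n) (nadd (nhalf n) (nhalf n))"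
  have cd: "qv c = rv x n - (hp n + hp n)" "qv d = rv x n + (hp n + hp n)" by (simp_all add: c_def d_def rv_def)
  have "\<bar>rv x k1 - rv x n\<bar> < hp k1" "\<bar>rv x k2 - rv x n\<bar> < hp k2" using isreal_dist[OF assms(1)] n by blast+
  then have "within c d"
    using k hp hp_pos[of m] by (intro j) (unfold cd, linarith+)
  then obtain y where y: "isreal y" "rless_q (lo y) c" "rgreater_q (hi y) d" unfolding within_def by blast
  have a: "rless (lo y) x"
  proof -
    obtain k where k: "rv (lo y) k + (hp k + hp k) < qv c" using y(2) unfolding rless_q_iff by blast
    \<comment> \<open>One place beyond \<open>k\<close> and \<open>n\<close>, so that
      \<open>2 * hp i\<close> is at most \<open>hp k\<close>; the radius \<open>2 * hp n\<close>
      absorbs the distance of \<open>x\<close> from its approximation.\<close>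
    define i where "i = k + n + 1"
    have "k \<le> i" "n \<le> i" unfolding i_def by (simp_all add: add_increasing add_increasing2 nonneg add.assoc)
    then have "\<bar>rv (lo y) k - rv (lo y) i\<bar> < hp k" "\<bar>rv x n - rv x i\<bar> < hp n"
      using isreal_dist isreal_ends y(1) assms(1) by blast+
    moreover have "hp i = hp (k + n) / 2" "hp (k + n) \<le> hp k" by (simp_all add: i_def hp_antimono)
    ultimately have "rv (lo y) i + (hp i + hp i) < rv x i" using k hp_pos[of n] unfolding cd by linarith
    then show ?thesis unfolding rless_def by blast
  qed
  have b: "rless x (hi y)"
  proof -
    obtain k where k: "qv d + (hp k + hp k) < rv (hi y) k" using y(3) unfolding rgreater_q_def by blast
    define i where "i = k + n + 1"
    have "k \<le> i" "n \<le> i" unfolding i_def by (simp_all add: add_increasing add_increasing2 nonneg add.assoc)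
    then have "\<bar>rv (hi y) k - rv (hi y) i\<bar> < hp k" "\<bar>rv x n - rv x i\<bar> < hp n"
      using isreal_dist isreal_ends y(1) assms(1) by blast+
    moreover have "hp i = hp (k + n) / 2" "hp (k + n) \<le> hp k" by (simp_all add: i_def hp_antimono)
    ultimately have "rv x i + (hp i + hp i) < rv (hi y) i" using k hp_pos[of n] unfolding cd by linarith
    then show ?thesis unfolding rless_def by blast
  qed
  have "\<not> req (lo y) (hi y)" by (rule rless_not_req[OF isreal_ends(1)[OF y(1)] assms(1) isreal_ends(2)[OF y(1)] a b])
  then show ?thesis unfolding inopen_def inint_def using y(1) a b by blast
qed

text \<open>Halving an interval that is not covered: since intervals of length below a quarter of the
  width lie in one of three overlapping halves, one of these is not covered either.\<close>

definition quarter :: "'n \<Rightarrow> 'n" where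
  "quarter x = nhalve (nhalve (nadd (nsecond x) (numinus (nfirst x))))"

definition half_from :: "'n \<Rightarrow> 'n \<Rightarrow> 'n" where
  "half_from l t = npair l (nadd l (nadd t t))"

definition bisect :: "'n \<Rightarrow> 'n" where
  "bisect x = (let l = nfirst x; t = quarter x in
     if \<not> covered l (nadd l (nadd t t)) then half_from l t
     else if \<not> covered (nadd l t) (nadd (nadd l t) (nadd t t)) then half_from (nadd l t) t
     else half_from (nadd (nadd l t) t) t)"

lemma bisect_uncovered:
  assumes lr: "qv (nfirst x) < qv (nsecond x)" and "\<not> covered (nfirst x) (nsecond x)"
  shows "\<not> covered (nfirst (bisect x)) (nsecond (bisect x))"
proof
  define l where "l = nfirst x"
  define t where "t = quarter x"
  have t: "qv t = (qv (nsecond x) - qv l) / 4" by (simp add: t_def quarter_def l_def)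
  assume cov: "covered (nfirst (bisect x)) (nsecond (bisect x))"
  \<comment> \<open>\<open>bisect\<close> takes the first half that is not covered, and the third
    one by default. If the half taken is covered, then all three are.\<close>
  have c: "covered l (nadd l (nadd t t))" "covered (nadd l t) (nadd (nadd l t) (nadd t t))"
    "covered (nadd (nadd l t) t) (nadd (nadd (nadd l t) t) (nadd t t))"
    using cov unfolding bisect_def Let_def half_from_def l_def[symmetric] t_def[symmetric]
    by (auto split: if_splits)
  have e: "qv (nadd l t) = qv l + qv t" "qv (nadd (nadd l t) t) = qv l + 2 * qv t" "qv (nadd l (nadd t t)) = qv l + 2 * qv t"
    "qv (nadd (nadd l t) (nadd t t)) = qv l + 3 * qv t" "qv (nadd (nadd (nadd l t) t) (nadd t t)) = qv l + 4 * qv t"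
    by simp_all
  obtain j0 where j0: "\<And>c d. qv l \<le> qv c \<Longrightarrow> qv c < qv d \<Longrightarrow> qv d \<le> qv l + 2 * qv t \<Longrightarrow> qv d < qv c + hp j0 \<Longrightarrow> within c d"
    using c(1) unfolding covered_def e by blast
  obtain j1 where j1: "\<And>c d. qv l + qv t \<le> qv c \<Longrightarrow> qv c < qv d \<Longrightarrow> qv d \<le> qv l + 3 * qv t \<Longrightarrow> qv d < qv c + hp j1 \<Longrightarrow> within c d"
    using c(2) unfolding covered_def e by blast
  obtain j2 where j2: "\<And>c d. qv l + 2 * qv t \<le> qv c \<Longrightarrow> qv c < qv d \<Longrightarrow> qv d \<le> qv l + 4 * qv t \<Longrightarrow> qv d < qv c + hp j2 \<Longrightarrow> within c d"
    using c(3) unfolding covered_def e by blast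
  have "0 < qv t" using lr t by (simp add: l_def)
  then obtain j3 where j3: "hp j3 < qv t" by (rule hp_archimedean)
  \<comment> \<open>The sum of the indices is at least each of them, so \<open>hp j\<close> lies
    below all four bounds.\<close>
  define j where "j = j0 + j1 + j2 + j3"
  have "j0 \<le> j" "j1 \<le> j" "j2 \<le> j" "j3 \<le> j" unfolding j_def
    by (simp_all add: add_increasing add_increasing2 nonneg)
  then have hp: "hp j \<le> hp j0" "hp j \<le> hp j1" "hp j \<le> hp j2" "hp j \<le> hp j3" by (simp_all add: hp_mono)
  have "within c d" if cd: "qv l \<le> qv c" "qv c < qv d" "qv d \<le> qv (nsecond x)" "qv d < qv c + hp j" for c d
  proof -
    have r: "qv (nsecond x) = qv l + 4 * qv t" using t by simp
    \<comment> \<open>An interval shorter than a quarter of the width lies in one of the overlapping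
      halves, and its left end point tells which.\<close>
    consider "qv c < qv l + qv t" | "qv l + qv t \<le> qv c" "qv c < qv l + 2 * qv t" | "qv l + 2 * qv t \<le> qv c"
      by linarith
    then show ?thesis
    proof cases
      case 1
      then show ?thesis using cd hp j3 by (intro j0) linarith+
    next
      case 2
      then show ?thesis using cd hp j3 by (intro j1) linarith+
    next
      case 3
      then show ?thesis using cd hp r by (intro j2) linarith+
    qed
  qed
  then have "covered (nfirst x) (nsecond x)" unfolding covered_def l_def by blast
  then show False using assms(2) by blast
qed

lemma bisect_bounds:
  assumes "qv (nfirst x) < qv (nsecond x)"
  shows "qv (nfirst x) \<le> qv (nfirst (bisect x))" "qv (nsecond (bisect x)) \<le> qv (nsecond x)"
    "qv (nsecond (bisect x)) - qv (nfirst (bisect x)) = (qv (nsecond x) - qv (nfirst x)) / 2"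
proof -
  have t: "qv (quarter x) = (qv (nsecond x) - qv (nfirst x)) / 4" by (simp add: quarter_def)
  show "qv (nfirst x) \<le> qv (nfirst (bisect x))" "qv (nsecond (bisect x)) \<le> qv (nsecond x)"
    "qv (nsecond (bisect x)) - qv (nfirst (bisect x)) = (qv (nsecond x) - qv (nfirst x)) / 2"
    using assms by (simp_all add: bisect_def Let_def half_from_def t field_simps)
qed

definition nested :: "'n \<Rightarrow> 'n \<Rightarrow> 'n" where
  "nested x = prec x (\<lambda>_. bisect)"

lemma Rp_bisect: "Rp \<Gamma> N F \<Longrightarrow> Rp \<Gamma> N (\<lambda>c. bisect (F c))"
proof -
  have "Rp [N] N (\<lambda>c. if \<not> covered (nfirst (c 0)) (nadd (nfirst (c 0)) (nadd (quarter (c 0)) (quarter (c 0))))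
     then half_from (nfirst (c 0)) (quarter (c 0))
     else if \<not> covered (nadd (nfirst (c 0)) (quarter (c 0)))
        (nadd (nadd (nfirst (c 0)) (quarter (c 0))) (nadd (quarter (c 0)) (quarter (c 0))))
     then half_from (nadd (nfirst (c 0)) (quarter (c 0))) (quarter (c 0))
     else half_from (nadd (nadd (nfirst (c 0)) (quarter (c 0))) (quarter (c 0))) (quarter (c 0)))"
    unfolding half_from_def quarter_def by (rule dec_all dec_covered Rp_nhalve Rp_rules | simp)+
  then have "rp N N bisect" unfolding bisect_def[abs_def] Let_def by (rule rpI)
  then show "Rp \<Gamma> N F \<Longrightarrow> Rp \<Gamma> N (\<lambda>c. bisect (F c))" by (rule Rp_rp)
qed

lemma nested_simps: "nested x 0 = x" "nested x (n + 1) = bisect (nested x n)"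
proof -
  have R: "Rp [N, N] N (\<lambda>c. bisect (c 0))" by (rule Rp_bisect Rp_rules | simp)+
  show "nested x 0 = x" unfolding nested_def by (rule prec_0[of "\<lambda>_. bisect", OF R])
  show "nested x (n + 1) = bisect (nested x n)" unfolding nested_def by (rule prec_Suc[of "\<lambda>_. bisect", OF R])
qed

lemma Rp_nested: "Rp \<Gamma> N F \<Longrightarrow> Rp \<Gamma> N (\<lambda>c. nested x (F c))"
  by (rule Rp_rp[of N N "nested x"]) (simp_all add: nested_def rp_prec)

text \<open>The left end points of the nested intervals form the real. Starting with length at most
  1 = \<open>hp 0\<close> makes the \<open>n\<close>-th length at most \<open>hp n\<close>, which is
  the modulus that reals must have.\<close>

lemma uncovered_point:
  assumes lr: "qv l < qv r" "qv r \<le> qv l + 1" and unc: "\<not> covered l r"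
  obtains x where "isreal x" "\<And>n. qv l \<le> rv x n" "\<And>n. rv x n \<le> qv r" "\<not> inopen x p q"
proof -
  define X where "X = nested (npair l r)"
  define L where "L n = nfirst (X n)" for n
  define R where "R n = nsecond (X n)" for n
  have X: "X 0 = npair l r" "X (n + 1) = bisect (X n)" for n unfolding X_def by (rule nested_simps)+
  have inv: "qv (L n) < qv (R n) \<and> qv (R n) \<le> qv (nadd (L n) (nhalf n)) \<and> \<not> covered (L n) (R n)" for n
  proof (rule dec_induct[of "\<lambda>n. qv (L n) < qv (R n) \<and> qv (R n) \<le> qv (nadd (L n) (nhalf n)) \<and> \<not> covered (L n) (R n)"])
    show "dec [N] (\<lambda>c. qv (L (c 0)) < qv (R (c 0)) \<and> qv (R (c 0)) \<le> qv (nadd (L (c 0)) (nhalf (c 0))) \<and> \<not> covered (L (c 0)) (R (c 0)))"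
      unfolding L_def R_def X_def by (rule dec_all dec_covered Rp_nested Rp_rules | simp del: qv_nadd)+
    show "qv (L 0) < qv (R 0) \<and> qv (R 0) \<le> qv (nadd (L 0) (nhalf 0)) \<and> \<not> covered (L 0) (R 0)"
      using assms by (simp add: L_def R_def X)
    fix n assume IH: "qv (L n) < qv (R n) \<and> qv (R n) \<le> qv (nadd (L n) (nhalf n)) \<and> \<not> covered (L n) (R n)"
    have "qv (R (n + 1)) - qv (L (n + 1)) = (qv (R n) - qv (L n)) / 2"
      using bisect_bounds(3)[of "X n"] IH unfolding L_def R_def X by blast
    moreover have "\<not> covered (L (n + 1)) (R (n + 1))"
      using bisect_uncovered[of "X n"] IH unfolding L_def R_def X by blast
    moreover have "qv (R n) \<le> qv (L n) + hp n" using IH by simp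
    ultimately show "qv (L (n + 1)) < qv (R (n + 1)) \<and> qv (R (n + 1)) \<le> qv (nadd (L (n + 1)) (nhalf (n + 1))) \<and>
        \<not> covered (L (n + 1)) (R (n + 1))"
      using IH by simp
  qed
  then have lt: "qv (L n) < qv (R n)" and width: "qv (R n) \<le> qv (L n) + hp n" and Xunc: "\<not> covered (L n) (R n)" for n
    using inv[of n] by simp_all
  have mono: "qv (L n) \<le> qv (L (n + i)) \<and> qv (R (n + i)) \<le> qv (R n)" for n i
  proof (rule dec_induct[of "\<lambda>i. qv (L n) \<le> qv (L (n + i)) \<and> qv (R (n + i)) \<le> qv (R n)"])
    show "dec [N] (\<lambda>c. qv (L n) \<le> qv (L (n + c 0)) \<and> qv (R (n + c 0)) \<le> qv (R n))"
      unfolding L_def R_def X_def by (rule dec_all Rp_nested Rp_rules | simp)+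
    fix i assume IH: "qv (L n) \<le> qv (L (n + i)) \<and> qv (R (n + i)) \<le> qv (R n)"
    have "qv (L (n + i)) \<le> qv (L (n + i + 1)) \<and> qv (R (n + i + 1)) \<le> qv (R (n + i))"
      using bisect_bounds(1,2)[of "X (n + i)"] lt[of "n + i"] unfolding L_def R_def X by blast
    then show "qv (L n) \<le> qv (L (n + (i + 1))) \<and> qv (R (n + (i + 1))) \<le> qv (R n)"
      using IH by (simp only: add.assoc) linarith
  qed simp
  define x where "x = Lam N N L"
  have "rp N N L" unfolding L_def X_def by (rule rpI) (rule Rp_nested Rp_rules | simp)+
  then have rv: "rv x n = qv (L n)" for n by (simp add: x_def rv_def ap_Lam)
  have real: "isreal x"
    unfolding isreal_def rv
  proof (intro allI)
    fix n i :: 'n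
    show "\<bar>qv (L n) - qv (L (n + i))\<bar> < hp n"
      using mono[of n i] lt[of "n + i"] width[of n] by linarith
  qed
  have "\<not> inopen x p q"
  proof
    assume "inopen x p q"
    then obtain y where y: "isreal y" "rless (lo y) x" "rless x (hi y)" unfolding inopen_def inint_def by blast
    then obtain k1 k2 where k1: "rv (lo y) k1 + (hp k1 + hp k1) < rv x k1" and k2: "rv x k2 + (hp k2 + hp k2) < rv (hi y) k2"
      unfolding rless_def by blast
    have "0 < rv x k1 - rv (lo y) k1 - (hp k1 + hp k1)" "0 < rv (hi y) k2 - rv x k2 - (hp k2 + hp k2)"
      using k1 k2 by (simp_all del: rv_simps)
    then obtain m1 m2 where m: "4 * hp m1 < rv x k1 - rv (lo y) k1 - (hp k1 + hp k1)"
        "4 * hp m2 < rv (hi y) k2 - rv x k2 - (hp k2 + hp k2)" by (meson hp_archimedean4)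
    \<comment> \<open>At \<open>n\<close> both margins exceed \<open>4 * hp n\<close>. The right one
      must also pay for the length of the \<open>n\<close>-th interval, since \<open>x\<close> is
      approximated by left end points.\<close>
    define n where "n = k1 + k2 + m1 + m2"
    have n: "k1 \<le> n" "k2 \<le> n" "m1 \<le> n" "m2 \<le> n"
      unfolding n_def by (simp_all add: add_increasing add_increasing2 nonneg)
    have hp: "hp n \<le> hp m1" "hp n \<le> hp m2" using n by (simp_all add: hp_mono)
    have near: "\<bar>rv x k1 - rv x n\<bar> < hp k1" "\<bar>rv x k2 - rv x n\<bar> < hp k2"
        "\<bar>rv (lo y) k1 - rv (lo y) n\<bar> < hp k1" "\<bar>rv (hi y) k2 - rv (hi y) n\<bar> < hp k2"
      using isreal_dist isreal_ends y(1) real n by blast+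
    have "within c d" if cd: "qv (L n) \<le> qv c" "qv d \<le> qv (R n)" for c d
    proof -
      have "rv (lo y) n + (hp n + hp n) < qv c"
        using near cd(1) m hp k1 hp_pos[of n] unfolding rv[of n, symmetric] by linarith
      moreover have "qv d + (hp n + hp n) < rv (hi y) n"
        using near cd(2) m hp k2 hp_pos[of n] width[of n] unfolding rv[of n, symmetric] by linarith
      ultimately show ?thesis unfolding within_def rless_q_iff rgreater_q_def using y(1) by blast
    qed
    \<comment> \<open>The whole interval lies inside one interval of the cover, so any
      \<open>j\<close> will do.\<close>
    then have "covered (L n) (R n)" unfolding covered_def by blast
    then show False using Xunc by blast
  qed
  moreover have "qv l \<le> rv x n" "rv x n \<le> qv r" for n
    using mono[of 0 n] lt[of n] by (simp_all add: rv L_def R_def X)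
  ultimately show ?thesis using that real by blast
qed

text \<open>This replaces the quantifier over reals by one over rational intervals. Restricting to
  length at most 1 fits \<open>uncovered_point\<close> and loses nothing, as a point of the ball has
  short intervals around it.\<close>

lemma ball_iff:
  "(\<forall>x. isreal x \<longrightarrow> inball x n \<longrightarrow> inopen x p q) \<longleftrightarrow>
   (\<forall>l r. cen n - rad n < qv l \<and> qv l < qv r \<and> qv r < cen n + rad n \<and> qv r \<le> qv l + 1 \<longrightarrow> covered l r)"
  (is "?A \<longleftrightarrow> ?B")
proof
  assume A: ?A
  show ?B
  proof (intro allI impI, elim conjE, rule ccontr)
    fix l r assume lr: "cen n - rad n < qv l" "qv l < qv r" "qv r < cen n + rad n" "qv r \<le> qv l + 1"
      and "\<not> covered l r"
    then obtain x where x: "isreal x" "\<And>k. qv l \<le> rv x k" "\<And>k. rv x k \<le> qv r" "\<not> inopen x p q"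
      using uncovered_point by metis
    \<comment> \<open>The distance of \<open>[l, r]\<close> from the boundary of the ball determines
      the precision at which the point is recognized as lying in the ball.\<close>
    have "0 < qv l - cen n + rad n" "0 < cen n + rad n - qv r" using lr by (simp_all add: algebra_simps)
    then obtain k1 k2 where k: "4 * hp k1 < qv l - cen n + rad n" "4 * hp k2 < cen n + rad n - qv r"
      by (meson hp_archimedean4)
    have "hp (k1 + k2) \<le> hp k1" "hp (k1 + k2) \<le> hp k2" by (simp_all add: hp_mono add_increasing add_increasing2 nonneg)
    then have "\<bar>rv x (k1 + k2 + 1) - cen n\<bar> + (hp (k1 + k2) + hp (k1 + k2)) < rad n"
      using k x(2,3)[of "k1 + k2 + 1"] hp_pos[of k1] hp_pos[of k2] by linarith
    then have "inball x n" unfolding inball_def by blast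
    then show False using A x(1,4) by blast
  qed
next
  assume B: ?B
  show ?A
  proof (intro allI impI)
    fix x assume x: "isreal x" "inball x n"
    then obtain k where k: "\<bar>rv x (k + 1) - cen n\<bar> + (hp k + hp k) < rad n" unfolding inball_def by blast
    \<comment> \<open>With \<open>hp m = hp k / 4\<close> the interval about the approximation has
      length \<open>hp k\<close>, at most 1, and the margin \<open>2 * hp k\<close> keeps it inside
      the ball.\<close>
    define m where "m = k + 1 + 1"
    have hp: "hp (k + 1) = hp k / 2" "hp m = hp k / 4" by (simp_all add: m_def)
    have "hp k \<le> hp 0" by (rule hp_mono) (rule nonneg)
    have "k + 1 \<le> m" using nonneg[of "1 :: 'n"] by (simp add: m_def)
    then have near: "\<bar>rv x (k + 1) - rv x m\<bar> < hp (k + 1)" by (rule isreal_dist[OF x(1)])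
    define l where "l = nadd (x $ m) (numinus (nadd (nhalf m) (nhalf m)))"
    define r where "r = nadd (x $ m) (nadd (nhalf m) (nhalf m))"
    have lr: "qv l = rv x m - (hp m + hp m)" "qv r = rv x m + (hp m + hp m)" by (simp_all add: l_def r_def rv_def)
    have "hp k \<le> 1" using hp_mono[OF nonneg, of k] by simp
    then have "cen n - rad n < qv l \<and> qv l < qv r \<and> qv r < cen n + rad n \<and> qv r \<le> qv l + 1"
      using k near hp_pos[of k] unfolding lr hp by linarith
    then have "covered l r" using B by blast
    moreover have "\<bar>rv x m - rv x (m + 1)\<bar> < hp m" by (rule isreal_dist[OF x(1)]) simp
    then have "qv l + (hp (m + 1) + hp (m + 1)) < rv x (m + 1)" "rv x (m + 1) + (hp (m + 1) + hp (m + 1)) < qv r"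
      using hp_simps(2)[of m] unfolding lr by linarith+
    then have "rgreater_q x l" "rless_q x r" unfolding rgreater_q_def rless_q_iff by blast+
    ultimately show "inopen x p q" using covered_subset[OF x(1)] by blast
  qed
qed

lemma dec_ball: "dec [N] (\<lambda>c. \<forall>x. isreal x \<longrightarrow> inball x (c 0) \<longrightarrow> inopen x p q)"
proof -
  define R where "R n = nrat (nfirst (nsecond n) + 1) 0 (nsecond (nsecond n))" for n
  define Q where "Q x \<longleftrightarrow> (let r = nfirst x; l = nfirst (nsecond x); n = nsecond (nsecond x) in
      \<not> (qv (nadd (nfirst n) (numinus (R n))) < qv l \<and> qv l < qv r \<and> qv r < qv (nadd (nfirst n) (R n)) \<and>
        qv r \<le> qv (nadd l (nrat 1 0 0)) \<longrightarrow> covered l r))" for x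
  have "dec [N] (\<lambda>c. Q (c 0))"
    unfolding Q_def R_def Let_def by (rule dec_all dec_covered Rp_rules | simp del: qv_nadd)+
  then have "dec [N] (\<lambda>c. \<exists>r. Q (npair r (c 0)))" by (rule boot_dec_pair[OF boot])
  then have "dec [N] (\<lambda>c. \<exists>l r. Q (npair r (npair l (c 0))))"
    by (rule boot_dec_pair[OF boot, of "\<lambda>x. \<exists>r. Q (npair r x)"])
  then have "dec [N] (\<lambda>c. \<not> (\<exists>l r. Q (npair r (npair l (c 0)))))" by (rule dec_not)
  moreover have "\<not> (\<exists>l r. Q (npair r (npair l n))) \<longleftrightarrow>
      (\<forall>x. isreal x \<longrightarrow> inball x n \<longrightarrow> inopen x p q)" for n
    unfolding ball_iff Q_def Let_def npair_simps not_ex not_not cen_def rad_def R_def[symmetric]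
    by (simp add: qv_nrat)
  ultimately show ?thesis by simp
qed

end

lemma boot_openplus: "boot \<Longrightarrow> openplus"
  unfolding openplus_def
proof (intro allI impI, elim conjE)
  fix p q assume "boot" "realfun p" "realfun q"
  from dec_ball[OF this] show "\<exists>X. isset X \<and> (\<forall>n. X $ n = 1 \<longleftrightarrow> (\<forall>x. isreal x \<longrightarrow> inball x n \<longrightarrow> inopen x p q))"
    unfolding dec_iff_set[of "\<lambda>n. \<forall>x. isreal x \<longrightarrow> inball x n \<longrightarrow> inopen x p q"] .
qed

end

section \<open>The equivalence\<close>

text \<open>Any countermodel makes \<open>the_cm\<close> one as well. The operations of
  \<open>mnat\<close> are then those of its transport, so everything shown in
  \<open>rca_model\<close> applies to it.\<close>

lemma no_countermodel: "\<not> countermodel M"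
proof
  assume "countermodel M"
  then have ex: "HOL.Ex countermodel" by blast
  then have cm: "countermodel the_cm" unfolding the_cm_def by (rule someI_ex)
  let ?M = "transport the_cm"
  have r: "rca the_cm" using cm by (simp add: countermodel_def)
  interpret rca_model ?M
  proof
    show "extensional ?M" by (rule extensional_transport) (rule rca.ext[OF r])
    show "sat ?M e B" if "B \<in> RCA0_omega" "wf_fm B" for B e
      using that by (simp add: sat_transport rca.ax[OF r])
    show "cst ?M C0 = 0" "cst ?M C1 = 1" using ex by (simp_all add: transport_def mnat_defs)
    show "ap ?M N N (ap ?M N ty1 (cst ?M CPlus) x) y = x + y"
      "ap ?M N N (ap ?M N ty1 (cst ?M CTimes) x) y = x * y" "lt ?M x y \<longleftrightarrow> x < y" for x y
      using ex by (simp_all add: transport_def mnat_defs)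
  qed
  have all_env: "(\<forall>e. sat the_cm e A) \<longleftrightarrow> (\<forall>e. sat ?M e A)" if "wf_fm A" for A
  proof
    assume *: "\<forall>e. sat ?M e A"
    show "\<forall>e. sat the_cm e A"
    proof
      fix e
      have "sat ?M (\<lambda>\<rho> i. Abs_mnat (e \<rho> i)) A" using * by blast
      then show "sat the_cm e A" using that by (simp add: sat_transport Abs_mnat_inverse)
    qed
  qed (simp add: sat_transport that)
  have BOOT: "(\<forall>e. sat the_cm e BOOT) \<longleftrightarrow> boot"
    by (simp add: all_env wf_BOOT sat_BOOT)
  have op: "(\<forall>e. sat the_cm e open_plus) \<longleftrightarrow> openplus"
    by (simp add: all_env wf_open_plus sat_open_plus)
  show False
  proof (cases boot)
    case True
    then obtain A e where A: "A \<in> insert open_plus ACA0" "wf_fm A" "\<not> sat the_cm e A"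
      using cm BOOT unfolding countermodel_def by blast
    have "A \<noteq> open_plus" using A(3) op boot_openplus[OF True] by blast
    then obtain B where "arithmetical B" "wf_fm B"
      and "A = Ex ty1 (is_set (Var ty1 0) \<andand> All N (mem (Var N 0) (Var ty1 0) \<leftrightarrow> lift_fm ty1 0 B))"
      using A(1) unfolding ACA0_def by blast
    then have "\<forall>e. sat ?M e A" using boot_ACA0[OF True] by blast
    then show False using A(2,3) all_env by blast
  next
    case False
    then have *: "\<And>A e. A \<in> insert open_plus ACA0 \<Longrightarrow> wf_fm A \<Longrightarrow> sat the_cm e A"
      using cm BOOT unfolding countermodel_def by blast
    then have openplus using op wf_open_plus by blast
    moreover have "sat ?M e A" if "A \<in> ACA0" "wf_fm A" for A e
      using * all_env that by blast
    ultimately show False using openplus_ACA0_boot False by blast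
  qed
qed

lemma wf_ACA0: "A \<in> ACA0 \<Longrightarrow> wf_fm A"
  by (auto simp: ACA0_def mem_def)

theorem theorem3p14:
  shows "proves_equivalence (RCA0_omega \<union> {NCC}) {BOOT} ({open_plus} \<union> ACA0)"
  unfolding proves_equivalence_def
proof (intro conjI ballI)
  fix A assume A: "A \<in> {open_plus} \<union> ACA0"
  then have wf: "wf_fm A" using wf_open_plus wf_ACA0 by blast
  show "RCA0_omega \<union> {NCC} \<union> {BOOT} \<turnstile> A"
  proof (rule ccontr)
    assume "\<not> (RCA0_omega \<union> {NCC} \<union> {BOOT} \<turnstile> A)"
    then obtain M :: "nat struct" and e where M: "extensional M" "\<not> sat M e A"
      "\<And>B e. B \<in> RCA0_omega \<union> {NCC} \<union> {BOOT} \<Longrightarrow> wf_fm B \<Longrightarrow> sat M e B"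
      by (rule completeness) (use wf in auto)
    \<comment> \<open>\<open>BOOT\<close> holds under all assignments while \<open>A\<close> fails
      under \<open>e\<close>, which is the first alternative in \<open>countermodel\<close>.\<close>
    then have "countermodel M"
      using A wf wf_BOOT unfolding countermodel_def rca_def by blast
    then show False by (simp add: no_countermodel)
  qed
next
  fix A assume "A \<in> {BOOT}"
  then have A: "A = BOOT" by simp
  show "RCA0_omega \<union> {NCC} \<union> ({open_plus} \<union> ACA0) \<turnstile> A"
  proof (rule ccontr)
    assume "\<not> (RCA0_omega \<union> {NCC} \<union> ({open_plus} \<union> ACA0) \<turnstile> A)"
    then obtain M :: "nat struct" and e where M: "extensional M" "\<not> sat M e A"
      "\<And>B e. B \<in> RCA0_omega \<union> {NCC} \<union> ({open_plus} \<union> ACA0) \<Longrightarrow> wf_fm B \<Longrightarrow> sat M e B"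
      by (rule completeness) (use wf_BOOT A in auto)
    then have "countermodel M"
      using A unfolding countermodel_def rca_def by blast
    then show False by (simp add: no_countermodel)
  qed
qed

end
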